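(* Let $T>0$ and $c\in\mathbb{R}$. Let $g\colon[0,+\infty)\to[0,+\infty)$ be a continuously differentiable function such that $g(0)=0$, $g(s)>0$ for all $s>0$, $g'(0)=0$ and $g'(\infty):=\lim_{s\to+\infty}g'(s)=0$. Let $a\colon\mathbb{R}\to\mathbb{R}$ be a locally integrable $T$-periodic function for which there exists an interval $I\subseteq[0,T]$ such that $a(t)\geq0$ for a.e. $t\in I$ and $\int_{I}a(t)\,dt>0$. For $\lambda>0$ consider the equation $$u''+cu'+\lambda a(t)g(u)=0. \qquad (E_\lambda)$$ (1) If $\int_{0}^{T}a(t)\,dt<0$, then there exists $\lambda_{*}>0$ such that for each $0<\lambda<\lambda_{*}$ equation $(E_\lambda)$ has no positive $T$-periodic solution; moreover, there exists $\lambda^{*}>0$ such that for each $\lambda>\lambda^{*}$ equation $(E_\lambda)$ has at least two positive $T$-periodic solutions. (2) If $g'(s)>0$ for all $s>0$, then the condition $\int_{0}^{T}a(t)\,dt<0$ is also necessary: if $(E_\lambda)$ has a positive $T$-periodic solution for some $\lambda>0$, then $\int_{0}^{T}a(t)\,dt<0$.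
   Context: Solutions are meant in the Carathéodory sense: $u$ is continuously differentiable with $u'$ locally absolutely continuous, and the equation holds for almost every $t$. A positive $T$-periodic solution is a solution $u\colon\mathbb{R}\to\mathbb{R}$ with $u(t+T)=u(t)>0$ for all $t\in\mathbb{R}$. *)

theory Defs
  imports "HOL-Analysis.Analysis"
begin

definition abs_cont_on :: "(real \<Rightarrow> real) \<Rightarrow> real \<Rightarrow> real \<Rightarrow> bool" where
  "abs_cont_on f x y \<longleftrightarrow>
     (\<forall>\<epsilon>>0. \<exists>\<delta>>0. \<forall>(n::nat) p q.
        (\<forall>i<n. x \<le> p i \<and> p i \<le> q i \<and> q i \<le> y) \<longrightarrow>
        disjoint_family_on (\<lambda>i. {p i<..<q i}) {..<n} \<longrightarrow>
        (\<Sum>i<n. q i - p i) < \<delta> \<longrightarrow>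
        (\<Sum>i<n. \<bar>f (q i) - f (p i)\<bar>) < \<epsilon>)"

definition locally_abs_cont :: "(real \<Rightarrow> real) \<Rightarrow> bool" where
  "locally_abs_cont f \<longleftrightarrow> (\<forall>x y. x \<le> y \<longrightarrow> abs_cont_on f x y)"

definition locally_integrable :: "(real \<Rightarrow> real) \<Rightarrow> bool" where
  "locally_integrable a \<longleftrightarrow> (\<forall>K. compact K \<longrightarrow> a absolutely_integrable_on K)"

definition periodic_with :: "real \<Rightarrow> (real \<Rightarrow> real) \<Rightarrow> bool" where
  "periodic_with T f \<longleftrightarrow> (\<forall>t. f (t + T) = f t)"

(* Caratheodory solutions on the whole line of u'' + c u' + lam a(t) g(u) = 0;
   v is the derivative of u, and w is the value of u'' at t, whose existence is part
   of the almost-everywhere condition. *)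
definition caratheodory_solution ::
  "real \<Rightarrow> real \<Rightarrow> (real \<Rightarrow> real) \<Rightarrow> (real \<Rightarrow> real) \<Rightarrow> (real \<Rightarrow> real) \<Rightarrow> bool" where
  "caratheodory_solution c lam a g u \<longleftrightarrow>
     (\<exists>v. (\<forall>t. (u has_real_derivative v t) (at t)) \<and>
          continuous_on UNIV v \<and> locally_abs_cont v \<and>
          (AE t in lebesgue. \<exists>w. (v has_real_derivative w) (at t) \<and>
             w + c * v t + lam * a t * g (u t) = 0))"

(* g is only meaningful on {0..}; positivity of u keeps g (u t) inside that domain. *)
definition positive_periodic_solution ::
  "real \<Rightarrow> real \<Rightarrow> real \<Rightarrow> (real \<Rightarrow> real) \<Rightarrow> (real \<Rightarrow> real) \<Rightarrow> (real \<Rightarrow> real) \<Rightarrow> bool" where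
  "positive_periodic_solution T c lam a g u \<longleftrightarrow>
     caratheodory_solution c lam a g u \<and> periodic_with T u \<and> (\<forall>t. u t > 0)"

end

theory Submission
  imports Defs "HOL-Complex_Analysis.Great_Picard"
begin

text \<open>
  Existence. On a mesh of width h the equation becomes a cyclic system of N equations, cooperative
  because each residual increases in the two neighbouring values; adding a small multiple of the
  residual to a vector is a monotone map K. Since g' vanishes at zero and at infinity and a has
  negative mean, there are strict upper solutions close to every small and every large constant.
  For large lam there is in addition a lower solution: a bump supported where a is nonnegative,
  which stays one when multiplied by 2. Monotone iteration gives a solution above twice the bump.
  The second solution lies on the boundary of the basin of the region below the small upper
  solution: as the basin is closed downwards, its boundary is a Lipschitz graph over the direction
  (1,...,1), hence a Lipschitz retract, and K maps it to itself, so Brouwer's theorem (in the form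
  of Kuhn's combinatorial lemma) applies there. Both discrete solutions
  converge along a subsequence of meshes, and their limits differ because at some point the first is
  at least twice the second.

  Nonexistence and necessity. For a positive periodic solution u put z = u' / (lam g(u)). Then
  z' = - c z - a - lam g'(u) z^2, and z is the derivative of a periodic function, so the mean of a
  is - lam times the mean of g'(u) z^2.
\<close>

section \<open>Monotone maps of a box with two stable regions\<close>

text \<open>The second solution separates two stable regions of the monotone map, so monotone
  iteration is not the means to reach it: it has to be caught by topology. Discretizing keeps that
  topology finite-dimensional, and the order supplies the set to apply it to. The price is that
  discrete information must survive the limit, where strict inequalities degenerate. Hence the
  doubled bump: at some site the second solution is below the bump and the first above twice the
  bump, and the closed inequality \<open>2 * q i \<le> p i\<close> still separates positive limits.
  Approximate zeros are enough if residuals are small against \<open>h\<^sup>2\<close>: a residual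
  is \<open>h\<close> times a slope increment, so the error in the slope accumulated over a period
  tends to 0. The negative mean enters through the upper solutions: the residual of a corrected
  constant r takes the sign of the mean, while the correction has size proportional to
  \<open>lam * g r\<close>. It is dominated by r because g(r)/r is small near zero and near
  infinity. For nonexistence, the Riccati form bounds z independently of small lam, which would
  force the mean of a to be arbitrarily small.\<close>

lemma approx_fixed_point_cube:
  fixes \<Psi> :: "(nat \<Rightarrow> real) \<Rightarrow> nat \<Rightarrow> real"
  assumes C: "C \<ge> 0" and \<Lambda>: "\<Lambda> \<ge> 0" and \<eta>: "\<eta> > 0"
    and range: "\<And>x i. \<forall>i<N. 0 \<le> x i \<and> x i \<le> C \<Longrightarrow> i < N \<Longrightarrow> 0 \<le> \<Psi> x i \<and> \<Psi> x i \<le> C"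
    and lip: "\<And>x y d i. \<forall>i<N. 0 \<le> x i \<and> x i \<le> C \<Longrightarrow> \<forall>i<N. 0 \<le> y i \<and> y i \<le> C \<Longrightarrow>
        \<forall>i<N. \<bar>x i - y i\<bar> \<le> d \<Longrightarrow> i < N \<Longrightarrow> \<bar>\<Psi> x i - \<Psi> y i\<bar> \<le> \<Lambda> * d"
  obtains w where "\<forall>i<N. 0 \<le> w i \<and> w i \<le> C" "\<forall>i<N. \<bar>\<Psi> w i - w i\<bar> \<le> \<eta>"
proof -
  \<comment> \<open>Grid fineness. Within a grid cell a point moves by at most C/p and
    \<open>\<Psi>\<close> by at most \<Lambda> C/p in each coordinate; the sum of the two is then at
    most \<eta>.\<close>
  obtain p :: nat where p: "real p > (\<Lambda> + 1) * C / \<eta>" "p > 0"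
    by (metis reals_Archimedean2 gr0I less_trans of_nat_0 of_nat_less_iff zero_less_one
        max_less_iff_conj of_nat_0_less_iff)
  define sc where "sc = (\<lambda>(x::nat \<Rightarrow> nat) i. real (x i) * C / real p)"
  have sc_cube: "0 \<le> sc x i \<and> sc x i \<le> C" if "x i \<le> p" for x i
  proof -
    have "real (x i) * C \<le> real p * C"
      using that C by (intro mult_right_mono) auto
    then show ?thesis
      using p C by (simp add: sc_def field_simps)
  qed
  \<comment> \<open>The label records the sign of \<open>\<Psi> x i - x i\<close>, with 0 forced on
    the face \<open>x i = 0\<close>; on the opposite face it is 1 because \<open>\<Psi>\<close> does
    not exceed C. A cell with both labels in coordinate i contains a weak sign change, so the
    difference is small throughout the cell.\<close>
  define label where
    "label = (\<lambda>x i. if x i \<noteq> 0 \<and> \<Psi> (sc x) i \<le> sc x i then 1 else (0::nat))"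
  have sc0: "sc x i = 0" if "x i = 0" for x i
    using that by (simp add: sc_def)
  have scp: "sc x i = C" if "x i = p" for x i
    using that p by (simp add: sc_def)
  obtain q where q: "\<forall>i<N. q i < p"
    and q2: "\<forall>i<N. \<exists>r s. (\<forall>j<N. q j \<le> r j \<and> r j \<le> q j + 1) \<and>
        (\<forall>j<N. q j \<le> s j \<and> s j \<le> q j + 1) \<and> label r i \<noteq> label s i"
  proof (rule kuhn_lemma[of p N label])
    show "\<forall>x. (\<forall>i<N. x i \<le> p) \<longrightarrow> (\<forall>i<N. x i = p \<longrightarrow> label x i = 1)"
      using range sc_cube scp p(2) unfolding label_def by (metis less_numeral_extra(3))
  qed (use p in \<open>auto simp: label_def\<close>)
  define w where "w = sc q"
  have w: "\<forall>i<N. 0 \<le> w i \<and> w i \<le> C"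
    using q sc_cube by (auto simp: w_def less_imp_le)
  have "\<bar>\<Psi> w i - w i\<bar> \<le> (\<Lambda> + 1) * (C / p)" if i: "i < N" for i
  proof -
    have near: "\<bar>\<Psi> w i - \<Psi> (sc r) i\<bar> \<le> \<Lambda> * (C / p) \<and> \<bar>w i - sc r i\<bar> \<le> C / p
        \<and> (label r i = 0 \<longrightarrow> \<Psi> (sc r) i \<ge> sc r i) \<and> (label r i \<noteq> 0 \<longrightarrow> \<Psi> (sc r) i \<le> sc r i)"
      if r: "\<forall>j<N. q j \<le> r j \<and> r j \<le> q j + 1" for r
    proof -
      have cube: "\<forall>j<N. 0 \<le> sc r j \<and> sc r j \<le> C"
        using r q sc_cube by (metis Suc_eq_plus1 Suc_leI le_trans)
      have d: "\<bar>w j - sc r j\<bar> \<le> C / p" if "j < N" for j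
      proof -
        have "w j - sc r j = - ((real (r j) - real (q j)) * (C / p))"
          by (simp add: w_def sc_def algebra_simps)
        moreover have "0 \<le> real (r j) - real (q j)" "real (r j) - real (q j) \<le> 1"
          using r that by (auto simp: of_nat_le_iff[symmetric] simp del: of_nat_le_iff)
        ultimately show ?thesis
          using C mult_right_mono[of "real (r j) - real (q j)" 1 "C / p"] by (simp add: abs_mult)
      qed
      show ?thesis
        using lip[OF w cube _ i, of "C / p"] d i range[OF cube i] sc0[of r i]
        by (auto simp: label_def)
    qed
    obtain r s where r: "\<forall>j<N. q j \<le> r j \<and> r j \<le> q j + 1"
      and s: "\<forall>j<N. q j \<le> s j \<and> s j \<le> q j + 1" and "label r i \<noteq> label s i"
      using q2 i by blast
    then have "label r i = 0 \<and> label s i \<noteq> 0 \<or> label s i = 0 \<and> label r i \<noteq> 0"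
      by (auto simp: label_def split: if_splits)
    moreover have "(\<Lambda> + 1) * (C / p) = \<Lambda> * (C / p) + C / p"
      by (simp add: distrib_right add_divide_distrib)
    ultimately show ?thesis
      using near[OF r] near[OF s] by linarith
  qed
  moreover have "(\<Lambda> + 1) * (C / p) \<le> \<eta>"
    using p \<eta> by (simp add: field_simps)
  ultimately show ?thesis
    using that w by (meson order_trans)
qed

text \<open>The box from 0 to \<open>hi\<close> is invariant, and so are the part below the strict
  upper solution \<open>b\<close> and the part above the strict lower solution \<open>al\<close>. By
  \<open>al_b\<close> these two parts are disjoint, so a boundary must lie between them.
  \<open>C\<close> only serves as the side of a cube containing the box.\<close>

locale monotone_box_map =
  fixes N :: nat and K :: "(nat \<Rightarrow> real) \<Rightarrow> nat \<Rightarrow> real" and hi b al :: "nat \<Rightarrow> real" and \<Lambda> C :: real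
  assumes hi: "\<And>i. i < N \<Longrightarrow> 0 \<le> hi i \<and> hi i \<le> C"
    and \<Lambda>: "\<Lambda> > 0"
    and mono: "\<And>x y i. \<forall>i<N. 0 \<le> x i \<and> x i \<le> y i \<and> y i \<le> hi i \<Longrightarrow> i < N \<Longrightarrow> K x i \<le> K y i"
    and lip: "\<And>x y d i. \<forall>i<N. 0 \<le> x i \<and> x i \<le> hi i \<Longrightarrow> \<forall>i<N. 0 \<le> y i \<and> y i \<le> hi i \<Longrightarrow>
        \<forall>i<N. \<bar>x i - y i\<bar> \<le> d \<Longrightarrow> i < N \<Longrightarrow> \<bar>K x i - K y i\<bar> \<le> \<Lambda> * d"
    and K0: "\<And>i. i < N \<Longrightarrow> 0 \<le> K (\<lambda>_. 0) i"
    and Khi: "\<And>i. i < N \<Longrightarrow> K hi i \<le> hi i"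
    and b: "\<And>i. i < N \<Longrightarrow> 0 \<le> b i \<and> b i \<le> hi i"
    and Kb: "\<And>i. i < N \<Longrightarrow> K b i < b i"
    and al: "\<And>i. i < N \<Longrightarrow> 0 \<le> al i \<and> al i \<le> hi i"
    and Kal: "\<And>i. i < N \<Longrightarrow> al i < K al i"
    and al_b: "\<exists>i<N. b i < al i"
begin

text \<open>Projection onto the box. It extends \<open>K\<close> to all vectors, so that constants
  can be added to a vector without leaving the domain.\<close>

definition clamp where "clamp x i = max 0 (min (x i) (hi i))"

definition K' where "K' x = K (clamp x)"

text \<open>Strict inequality makes the basin open; a single time n is enough, because the region
  below \<open>b\<close> is never left again.\<close>

definition basin where "basin x \<longleftrightarrow> (\<exists>n. \<forall>i<N. (K' ^^ n) x i < b i)"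

lemma clamp_box: "i < N \<Longrightarrow> 0 \<le> clamp x i \<and> clamp x i \<le> hi i"
  using hi by (auto simp: clamp_def)

lemma clamp_id: "0 \<le> x i \<Longrightarrow> x i \<le> hi i \<Longrightarrow> clamp x i = x i"
  by (auto simp: clamp_def)

text \<open>The Lipschitz bound at distance 0 says that \<open>K\<close> ignores the coordinates
  outside \<open>{..<N}\<close>.\<close>

lemma K_cong:
  assumes "\<forall>i<N. 0 \<le> x i \<and> x i \<le> hi i" "\<forall>i<N. x i = y i" "i < N"
  shows "K x i = K y i"
  using lip[of x y 0 i] assms by auto

lemma K'_eq: "\<forall>i<N. 0 \<le> x i \<and> x i \<le> hi i \<Longrightarrow> i < N \<Longrightarrow> K' x i = K x i"
  unfolding K'_def by (rule K_cong[of x "clamp x", symmetric]) (simp_all add: clamp_id)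

lemma K'_mono: "\<forall>i<N. x i \<le> y i \<Longrightarrow> i < N \<Longrightarrow> K' x i \<le> K' y i"
  unfolding K'_def using clamp_box
  by (intro mono) (auto simp: clamp_def intro!: min.mono max.mono)

lemma K'_lip: "\<forall>i<N. \<bar>x i - y i\<bar> \<le> d \<Longrightarrow> i < N \<Longrightarrow> \<bar>K' x i - K' y i\<bar> \<le> \<Lambda> * d"
  unfolding K'_def
proof (rule lip)
  assume "\<forall>i<N. \<bar>x i - y i\<bar> \<le> d"
  then show "\<forall>i<N. \<bar>clamp x i - clamp y i\<bar> \<le> d"
    by (fastforce simp: clamp_def)
qed (use clamp_box in auto)

lemma K'_box: "i < N \<Longrightarrow> 0 \<le> K' x i \<and> K' x i \<le> hi i"
proof -
  assume i: "i < N"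
  have "K (\<lambda>_. 0) i \<le> K' x i" "K' x i \<le> K hi i"
    unfolding K'_def using clamp_box i by (intro mono; simp)+
  then show ?thesis
    using K0[OF i] Khi[OF i] by linarith
qed

lemma iter_mono: "\<forall>i<N. x i \<le> y i \<Longrightarrow> i < N \<Longrightarrow> (K' ^^ n) x i \<le> (K' ^^ n) y i"
  by (induction n arbitrary: i) (auto intro: K'_mono)

lemma iter_lip: "\<forall>i<N. \<bar>x i - y i\<bar> \<le> d \<Longrightarrow> i < N \<Longrightarrow> \<bar>(K' ^^ n) x i - (K' ^^ n) y i\<bar> \<le> \<Lambda> ^ n * d"
proof (induction n arbitrary: i)
  case (Suc n)
  then show ?case
    using K'_lip[of "(K' ^^ n) x" "(K' ^^ n) y" "\<Lambda> ^ n * d" i] by (auto simp: mult.assoc)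
qed auto

lemma basin_lower: "\<forall>i<N. x i \<le> y i \<Longrightarrow> basin y \<Longrightarrow> basin x"
proof -
  assume xy: "\<forall>i<N. x i \<le> y i" and "basin y"
  then obtain n where "\<forall>i<N. (K' ^^ n) y i < b i"
    by (auto simp: basin_def)
  then have "\<forall>i<N. (K' ^^ n) x i < b i"
    using iter_mono[OF xy] by (blast intro: le_less_trans)
  then show "basin x"
    by (auto simp: basin_def)
qed

lemma K'_b: "i < N \<Longrightarrow> K' b i < b i"
proof -
  assume i: "i < N"
  have box: "\<forall>i<N. 0 \<le> b i \<and> b i \<le> hi i"
    using b by blast
  show ?thesis
    unfolding K'_eq[OF box i] by (rule Kb[OF i])
qed

lemma K'_al: "i < N \<Longrightarrow> K' al i = K al i"
proof -
  assume i: "i < N"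
  have box: "\<forall>i<N. 0 \<le> al i \<and> al i \<le> hi i"
    using al by blast
  show ?thesis
    by (rule K'_eq[OF box i])
qed

text \<open>One direction shifts the time by one; the other uses \<open>K' b < b\<close>, which
  keeps an iterate below \<open>b\<close> once it is there. The equivalence makes both the basin and
  its complement invariant, hence also the boundary.\<close>

lemma basin_K': "basin (K' x) \<longleftrightarrow> basin x"
proof
  assume "basin (K' x)"
  then obtain n where "\<forall>i<N. (K' ^^ n) (K' x) i < b i"
    by (auto simp: basin_def)
  then show "basin x"
    unfolding basin_def by (intro exI[of _ "Suc n"]) (simp add: funpow_swap1)
next
  assume "basin x"
  then obtain n where n: "\<forall>i<N. (K' ^^ n) x i < b i"
    by (auto simp: basin_def)
  have "(K' ^^ n) (K' x) i < b i" if "i < N" for i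
  proof -
    have "K' ((K' ^^ n) x) i \<le> K' b i"
      using n that by (intro K'_mono) (auto simp: less_imp_le)
    then show ?thesis
      using K'_b[OF that] unfolding funpow_swap1[symmetric] by linarith
  qed
  then show "basin (K' x)"
    by (auto simp: basin_def)
qed

lemma basin_open:
  assumes "basin x"
  obtains \<delta> where "\<delta> > 0" "basin (\<lambda>i. x i + \<delta>)"
proof -
  obtain n where n: "\<forall>i<N. (K' ^^ n) x i < b i"
    using assms by (auto simp: basin_def)
  obtain m where m: "m > 0" "\<forall>i<N. (K' ^^ n) x i + m \<le> b i"
  proof (cases "N = 0")
    case False
    define m where "m = Min ((\<lambda>i. b i - (K' ^^ n) x i) ` {..<N})"
    have "m > 0"
      unfolding m_def using False n by (subst Min_gr_iff) auto
    moreover have "m \<le> b i - (K' ^^ n) x i" if "i < N" for i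
      unfolding m_def using that by (intro Min_le) auto
    ultimately show ?thesis
      using that[of m] by (simp add: algebra_simps le_diff_eq)
  qed (use that[of 1] in auto)
  \<comment> \<open>n steps amplify a displacement by at most \<Lambda>^n; half of the gap
    \<open>m\<close> is kept in reserve.\<close>
  define \<delta> where "\<delta> = m / (2 * \<Lambda> ^ n)"
  have \<delta>: "\<delta> > 0"
    using m \<Lambda> by (simp add: \<delta>_def)
  have "(K' ^^ n) (\<lambda>i. x i + \<delta>) i < b i" if "i < N" for i
  proof -
    have "\<bar>(K' ^^ n) (\<lambda>i. x i + \<delta>) i - (K' ^^ n) x i\<bar> \<le> \<Lambda> ^ n * \<delta>"
      using \<delta> that by (intro iter_lip) auto
    moreover have "\<Lambda> ^ n * \<delta> = m / 2"
      using \<Lambda> by (simp add: \<delta>_def)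
    moreover have "(K' ^^ n) x i + m \<le> b i"
      using m(2) that by blast
    ultimately show ?thesis
      using m(1) by linarith
  qed
  then show ?thesis
    using that \<delta> by (auto simp: basin_def)
qed

text \<open>The region above \<open>al\<close> is invariant, and at a site with
  \<open>b i < al i\<close> no vector of it is below \<open>b\<close>.\<close>

lemma not_basin_above_al:
  assumes "\<forall>i<N. al i \<le> x i"
  shows "\<not> basin x"
proof -
  have "\<forall>i<N. al i \<le> (K' ^^ n) x i" for n
  proof (induction n)
    case (Suc n)
    show ?case
    proof (intro allI impI)
      fix i assume i: "i < N"
      show "al i \<le> (K' ^^ Suc n) x i"
        using K'_mono[OF Suc i] K'_al[OF i] Kal[OF i] by simp
    qed
  qed (use assms in auto)
  then show ?thesis
    using al_b unfolding basin_def by (meson less_le_trans not_less_iff_gr_or_eq)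
qed

lemma basin_below: "\<forall>i<N. x i \<le> b i \<Longrightarrow> basin x"
proof -
  assume x: "\<forall>i<N. x i \<le> b i"
  have "K' x i < b i" if "i < N" for i
    using K'_mono[OF x that] K'_b[OF that] by linarith
  then have "\<forall>i<N. (K' ^^ 1) x i < b i"
    by simp
  then show "basin x"
    unfolding basin_def by blast
qed

text \<open>Signed height of the basin's boundary above \<open>w\<close> in the direction
  (1,...,1).\<close>

definition \<sigma> where "\<sigma> w = Sup {s. basin (\<lambda>i. w i + s)}"

text \<open>The basin is open and closed downwards, so its boundary can be tested along the diagonal
  alone, and from below only.\<close>

definition edge where "edge z \<longleftrightarrow> \<not> basin z \<and> (\<forall>\<delta>>0. basin (\<lambda>i. z i - \<delta>))"

definition retr where "retr w i = w i + \<sigma> w"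

lemma \<sigma>_set: "{s. basin (\<lambda>i. w i + s)} \<noteq> {}" "bdd_above {s. basin (\<lambda>i. w i + s)}"
proof -
  define S where "S = (\<Sum>i<N. \<bar>w i\<bar>) + \<bar>C\<bar>"
  have S: "\<bar>w i\<bar> + C \<le> S" if "i < N" for i
    using member_le_sum[of i "{..<N}" "\<lambda>i. \<bar>w i\<bar>"] that by (auto simp: S_def)
  have "basin (\<lambda>i. w i - S)"
  proof (rule basin_below, intro allI impI)
    fix i assume i: "i < N"
    show "w i - S \<le> b i"
      using S[OF i] b[OF i] hi[OF i] by linarith
  qed
  then have "- S \<in> {s. basin (\<lambda>i. w i + s)}"
    by simp
  then show "{s. basin (\<lambda>i. w i + s)} \<noteq> {}"
    by blast
  have "s \<le> S" if "basin (\<lambda>i. w i + s)" for s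
  proof (rule ccontr)
    assume "\<not> s \<le> S"
    have "al i \<le> w i + s" if "i < N" for i
      using S[OF that] al[OF that] hi[OF that] \<open>\<not> s \<le> S\<close> by linarith
    then have "\<forall>i<N. al i \<le> w i + s"
      by blast
    then show False
      using not_basin_above_al[of "\<lambda>i. w i + s"] that by simp
  qed
  then show "bdd_above {s. basin (\<lambda>i. w i + s)}"
    by (intro bdd_aboveI[of _ S]) auto
qed

lemma edge_retr: "edge (retr w)"
  unfolding edge_def
proof (intro conjI allI impI)
  show "\<not> basin (retr w)"
  proof
    assume "basin (retr w)"
    then obtain \<delta> where \<delta>: "\<delta> > 0" "basin (\<lambda>i. retr w i + \<delta>)"
      by (rule basin_open)
    then have "\<sigma> w + \<delta> \<in> {s. basin (\<lambda>i. w i + s)}"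
      by (simp add: retr_def add.assoc)
    then have "\<sigma> w + \<delta> \<le> \<sigma> w"
      unfolding \<sigma>_def using \<sigma>_set(2) by (rule cSup_upper)
    then show False
      using \<delta> by simp
  qed
  fix \<delta> :: real assume "\<delta> > 0"
  then obtain s where "basin (\<lambda>i. w i + s)" "\<sigma> w - \<delta> < s"
    using less_cSupD[OF \<sigma>_set(1), of "\<sigma> w - \<delta>" w] unfolding \<sigma>_def by auto
  then show "basin (\<lambda>i. retr w i - \<delta>)"
    by (elim basin_lower[rotated]) (auto simp: retr_def)
qed

lemma edge_\<sigma>: "edge z \<Longrightarrow> \<sigma> z = 0"
  unfolding \<sigma>_def
proof (rule cSup_eq_non_empty[OF \<sigma>_set(1)])
  assume z: "edge z"
  show "s \<le> 0" if "s \<in> {s. basin (\<lambda>i. z i + s)}" for s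
  proof (rule ccontr)
    assume "\<not> s \<le> 0"
    then have "basin z"
      using that by (elim basin_lower[rotated] CollectE) auto
    then show False
      using z by (auto simp: edge_def)
  qed
  show "0 \<le> y" if "\<And>s. s \<in> {s. basin (\<lambda>i. z i + s)} \<Longrightarrow> s \<le> y" for y
  proof (rule ccontr)
    assume "\<not> 0 \<le> y"
    then have "- y / 2 > 0"
      by simp
    moreover have "basin (\<lambda>i. z i - \<delta>)" if "\<delta> > 0" for \<delta>
      using z that by (simp add: edge_def)
    ultimately have "basin (\<lambda>i. z i - (- y / 2))"
      by blast
    then have "y / 2 \<le> y"
      using that[of "y / 2"] by simp
    then show False
      using \<open>\<not> 0 \<le> y\<close> by simp
  qed
qed

lemma retr_edge: "edge z \<Longrightarrow> retr z = z"
  by (auto simp: retr_def edge_\<sigma>)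

lemma edge_K': "edge z \<Longrightarrow> edge (K' z)"
  unfolding edge_def
proof (intro conjI allI impI)
  assume z: "\<not> basin z \<and> (\<forall>\<delta>>0. basin (\<lambda>i. z i - \<delta>))"
  then show "\<not> basin (K' z)"
    by (simp add: basin_K')
  fix \<delta> :: real assume \<delta>: "\<delta> > 0"
  \<comment> \<open>A diagonal shift by \<delta>/\<Lambda> changes \<open>K'\<close> by at most
    \<delta>, so \<open>K' z - \<delta>\<close> lies below the image of a basin vector.\<close>
  have "basin (K' (\<lambda>i. z i - \<delta> / \<Lambda>))"
    using z \<delta> \<Lambda> by (simp add: basin_K')
  then show "basin (\<lambda>i. K' z i - \<delta>)"
  proof (rule basin_lower[rotated], intro allI impI)
    fix i assume i: "i < N"
    have "\<bar>K' z i - K' (\<lambda>i. z i - \<delta> / \<Lambda>) i\<bar> \<le> \<Lambda> * (\<delta> / \<Lambda>)"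
      using \<Lambda> \<delta> i by (intro K'_lip) auto
    then show "K' z i - \<delta> \<le> K' (\<lambda>i. z i - \<delta> / \<Lambda>) i"
      using \<Lambda> by auto
  qed
qed

text \<open>If w' - d \<le> w, every shift that keeps w in the basin keeps w' there after lowering
  it by d. This needs only downward closure, so the constant is 1 whatever \<Lambda> is.\<close>

lemma \<sigma>_lip:
  assumes "\<forall>i<N. \<bar>w i - w' i\<bar> \<le> d"
  shows "\<bar>\<sigma> w - \<sigma> w'\<bar> \<le> d"
proof -
  have le: "\<sigma> w \<le> \<sigma> w' + d" if d: "\<forall>i<N. \<bar>w i - w' i\<bar> \<le> d" for w w'
    unfolding \<sigma>_def[of w]
  proof (rule cSup_least[OF \<sigma>_set(1)])
    fix s assume "s \<in> {s. basin (\<lambda>i. w i + s)}"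
    then have "basin (\<lambda>i. w i + s)" by simp
    then have "basin (\<lambda>i. w' i + (s - d))"
      using d by (elim basin_lower[rotated]) (fastforce simp: abs_le_iff)
    then have "s - d \<le> \<sigma> w'"
      unfolding \<sigma>_def using \<sigma>_set(2) by (intro cSup_upper) auto
    then show "s \<le> \<sigma> w' + d" by simp
  qed
  show ?thesis
    using le[OF assms] le[of w' w] assms by (auto simp: abs_minus_commute abs_le_iff)
qed

text \<open>The boundary of the basin is the range of the Lipschitz retraction \<^term>\<open>retr\<close> and is invariant
  under \<^term>\<open>K'\<close>, so a Brouwer fixed point of \<^term>\<open>\<lambda>w. K' (retr w)\<close> lies on it.\<close>

theorem saddle:
  assumes \<eta>: "\<eta> > 0"
  obtains z where "\<forall>i<N. 0 \<le> z i \<and> z i \<le> hi i" "\<forall>i<N. \<bar>K z i - z i\<bar> \<le> \<eta>"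
    "\<exists>i<N. b i < z i" "\<exists>i<N. z i < al i"
proof -
  define \<Psi> where "\<Psi> w = K' (retr w)" for w
  have lip\<Psi>: "\<bar>\<Psi> x i - \<Psi> y i\<bar> \<le> (2 * \<Lambda>) * d" if "\<forall>i<N. \<bar>x i - y i\<bar> \<le> d" "i < N" for x y d i
  proof -
    have "\<bar>retr x i - retr y i\<bar> \<le> 2 * d" if i: "i < N" for i
    proof -
      have "\<bar>x i - y i\<bar> \<le> d"
        using \<open>\<forall>i<N. \<bar>x i - y i\<bar> \<le> d\<close> i by blast
      then show ?thesis
        using \<sigma>_lip[OF \<open>\<forall>i<N. \<bar>x i - y i\<bar> \<le> d\<close>] unfolding retr_def by linarith
    qed
    then have "\<forall>i<N. \<bar>retr x i - retr y i\<bar> \<le> 2 * d"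
      by blast
    from K'_lip[OF this that(2)] show ?thesis
      by (simp add: \<Psi>_def algebra_simps)
  qed
  have "N > 0" using al_b by auto
  then have C: "C \<ge> 0" using hi[of 0] by linarith
  obtain w where w: "\<forall>i<N. \<bar>\<Psi> w i - w i\<bar> \<le> \<eta> / (2 * \<Lambda>)"
  proof (rule approx_fixed_point_cube[of C "2 * \<Lambda>" "\<eta> / (2 * \<Lambda>)" N \<Psi>])
    fix x i assume i: "i < N"
    show "0 \<le> \<Psi> x i \<and> \<Psi> x i \<le> C"
      using K'_box[OF i, of "retr x"] hi[OF i] by (auto simp: \<Psi>_def)
  qed (use C \<Lambda> \<eta> lip\<Psi> in auto)
  \<comment> \<open>The approximate fixed point \<open>w\<close> need not lie on the boundary, but
    its image does. Passing to the image costs a factor 2 \<Lambda>, which is why the tolerance for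
    \<open>w\<close> was \<eta>/(2 \<Lambda>).\<close>
  define z where "z = \<Psi> w"
  have z: "edge z"
    unfolding z_def \<Psi>_def by (intro edge_K' edge_retr)
  have box: "\<forall>i<N. 0 \<le> z i \<and> z i \<le> hi i"
    using K'_box by (auto simp: z_def \<Psi>_def)
  have "\<bar>K z i - z i\<bar> \<le> \<eta>" if i: "i < N" for i
  proof -
    have "K z i = \<Psi> z i"
      using K'_eq[OF box i] retr_edge[OF z] by (simp add: \<Psi>_def)
    moreover have "\<bar>\<Psi> z i - \<Psi> w i\<bar> \<le> 2 * \<Lambda> * (\<eta> / (2 * \<Lambda>))"
      using w i by (intro lip\<Psi>) (auto simp: z_def)
    ultimately show ?thesis
      using \<Lambda> by (simp add: z_def)
  qed
  moreover have "\<exists>i<N. b i < z i"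
    using z basin_below[of z] by (force simp: edge_def)
  moreover have "\<exists>i<N. z i < al i"
  proof (rule ccontr)
    assume "\<not> ?thesis"
    then have al_z: "\<forall>i<N. al i \<le> z i" by force
    \<comment> \<open>If z were above \<open>al\<close>, its image would exceed \<open>al\<close> by
      the positive margin m. Then even the image of z - m/\<Lambda> would be above
      \<open>al\<close>, hence outside the basin, although points diagonally below an edge point
      belong to it.\<close>
    define m where "m = Min ((\<lambda>i. K al i - al i) ` {..<N})"
    have m: "m > 0"
      unfolding m_def using \<open>N > 0\<close> Kal by (subst Min_gr_iff) auto
    have m_le: "m \<le> K al i - al i" if "i < N" for i
      unfolding m_def using that by (intro Min_le) auto
    have "\<forall>i<N. al i \<le> K' (\<lambda>i. z i - m / \<Lambda>) i"
    proof (intro allI impI)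
      fix i assume i: "i < N"
      have "\<bar>K' z i - K' (\<lambda>i. z i - m / \<Lambda>) i\<bar> \<le> \<Lambda> * (m / \<Lambda>)"
        using \<Lambda> m i by (intro K'_lip) auto
      moreover have "K al i \<le> K' z i"
        using K'_mono[OF al_z i] K'_al[OF i] by simp
      ultimately show "al i \<le> K' (\<lambda>i. z i - m / \<Lambda>) i"
        using m_le[OF i] \<Lambda> by auto
    qed
    then have "\<not> basin (\<lambda>i. z i - m / \<Lambda>)"
      using not_basin_above_al basin_K' by blast
    then show False
      using z m \<Lambda> by (auto simp: edge_def)
  qed
  ultimately show ?thesis
    using that box by blast
qed

text \<open>The increments of the monotone bounded iteration are summable, so some increment is small.\<close>

lemma increasing_iteration:
  assumes \<eta>: "\<eta> > 0"
  obtains z where "\<forall>i<N. al i \<le> z i \<and> z i \<le> hi i" "\<forall>i<N. \<bar>K z i - z i\<bar> \<le> \<eta>"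
proof -
  define x where "x n = (K' ^^ n) al" for n
  have up: "\<forall>i<N. x n i \<le> x (Suc n) i" for n
  proof -
    have "\<forall>i<N. al i \<le> K' al i"
      using K'_al Kal by (simp add: less_imp_le)
    then have "\<forall>i<N. (K' ^^ n) al i \<le> (K' ^^ n) (K' al) i"
      using iter_mono by blast
    then show ?thesis
      unfolding x_def funpow_swap1[symmetric] by simp
  qed
  have al_x: "\<forall>i<N. al i \<le> x n i" for n
    by (induction n) (use up in \<open>force simp: x_def intro: order_trans\<close>)+
  have x_hi: "\<forall>i<N. 0 \<le> x n i \<and> x n i \<le> hi i" for n
    by (cases n) (use al K'_box in \<open>auto simp: x_def\<close>)
  define s where "s n = (\<Sum>i<N. x n i)" for n
  have "incseq s"
    using up by (intro incseq_SucI) (auto simp: s_def intro: sum_mono)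
  moreover have "s n \<le> (\<Sum>i<N. hi i)" for n
    using x_hi by (auto simp: s_def intro: sum_mono)
  ultimately obtain L where "s \<longlonglongrightarrow> L"
    using incseq_convergent by blast
  then have "(\<lambda>n. s (Suc n) - s n) \<longlonglongrightarrow> L - L"
    by (intro tendsto_diff LIMSEQ_Suc)
  then obtain n where n: "s (Suc n) - s n < \<eta>"
    using order_tendstoD(2)[of _ "L - L" _ \<eta>] \<eta> by (force simp: eventually_sequentially)
  have "\<bar>K (x n) i - x n i\<bar> \<le> \<eta>" if i: "i < N" for i
  proof -
    have "x (Suc n) i - x n i \<le> (\<Sum>i<N. x (Suc n) i - x n i)"
      using up i by (intro member_le_sum[where f = "\<lambda>i. x (Suc n) i - x n i"]) auto
    also have "\<dots> = s (Suc n) - s n"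
      by (simp add: s_def sum_subtractf)
    finally have "x (Suc n) i - x n i \<le> \<eta>"
      using n by simp
    moreover have "K (x n) i = x (Suc n) i"
      using K'_eq[OF x_hi i] by (simp add: x_def)
    ultimately show ?thesis
      using up[of n] i \<eta> by auto
  qed
  then show ?thesis
    using that al_x x_hi by blast
qed

end

section \<open>The discretized equation\<close>

text \<open>The initial value is the fixed point of the affine map over one period. The bound comes
  from an index where |w| is maximal: for \<rho> < 1 the step into it is used, for \<rho> > 1 the
  step out of it. It does not deteriorate with N.\<close>

lemma first_order_periodic:
  fixes \<rho> D :: real and d :: "nat \<Rightarrow> real"
  assumes \<rho>: "\<rho> > 0" "\<rho> \<noteq> 1" and N: "N > 0" and d: "\<And>i. i < N \<Longrightarrow> \<bar>d i\<bar> \<le> D"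
  obtains w where "w N = w 0" "\<And>i. w (Suc i) = \<rho> * w i + d i"
    "\<And>i. i \<le> N \<Longrightarrow> \<bar>w i\<bar> * \<bar>1 - \<rho>\<bar> \<le> D"
proof -
  define r where "r = rec_nat 0 (\<lambda>i x. \<rho> * x + d i)"
  have r: "r 0 = 0" "r (Suc i) = \<rho> * r i + d i" for i
    by (auto simp: r_def)
  have \<rho>N: "\<rho> ^ N \<noteq> 1"
    using \<rho> N power_eq_iff_eq_base[of N \<rho> 1] by auto
  define w where "w i = \<rho> ^ i * (r N / (1 - \<rho> ^ N)) + r i" for i
  have wN: "w N = w 0"
    using \<rho>N r by (simp add: w_def field_simps)
  have wS: "w (Suc i) = \<rho> * w i + d i" for i
    by (simp add: w_def r algebra_simps)
  obtain m where m: "m \<le> N" "\<And>i. i \<le> N \<Longrightarrow> \<bar>w i\<bar> \<le> \<bar>w m\<bar>"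
  proof -
    have "Max ((\<lambda>i. \<bar>w i\<bar>) ` {..N}) \<in> (\<lambda>i. \<bar>w i\<bar>) ` {..N}"
      by (intro Max_in) auto
    then obtain m where m: "Max ((\<lambda>i. \<bar>w i\<bar>) ` {..N}) = \<bar>w m\<bar>" "m \<in> {..N}"
      by (rule imageE)
    have "\<bar>w i\<bar> \<le> \<bar>w m\<bar>" if "i \<le> N" for i
      unfolding m(1)[symmetric] using that by (intro Max_ge) auto
    then show ?thesis
      using that[of m] m(2) by simp
  qed
  have "\<bar>w m\<bar> * \<bar>1 - \<rho>\<bar> \<le> D"
  proof (cases "\<rho> < 1")
    case True
    obtain k where k: "k < N" "\<bar>w (Suc k)\<bar> = \<bar>w m\<bar>"
    proof (cases m)
      case 0
      then show ?thesis
        using that[of "N - 1"] N wN by simp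
    next
      case (Suc j)
      then show ?thesis
        using that[of j] m(1) by simp
    qed
    have "\<bar>w (Suc k)\<bar> \<le> \<bar>\<rho> * w k\<bar> + \<bar>d k\<bar>"
      unfolding wS by (rule abs_triangle_ineq)
    then have "\<bar>w m\<bar> \<le> \<rho> * \<bar>w k\<bar> + D"
      using d[OF k(1)] k(2) \<rho>(1) by (simp add: abs_mult)
    also have "\<dots> \<le> \<rho> * \<bar>w m\<bar> + D"
      using m(2)[of k] k \<rho> by simp
    finally show ?thesis
      using True by (simp add: algebra_simps)
  next
    case False
    obtain k where k: "k < N" "\<bar>w k\<bar> = \<bar>w m\<bar>"
    proof (cases "m = N")
      case True
      then show ?thesis
        using that[of 0] N wN by simp
    next
      case False
      then show ?thesis
        using that[of m] m(1) by simp
    qed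
    have "w (Suc k) - d k = \<rho> * w k"
      unfolding wS by simp
    then have "\<rho> * \<bar>w m\<bar> = \<bar>w (Suc k) - d k\<bar>"
      using \<rho>(1) k(2) by (simp add: abs_mult)
    also have "\<dots> \<le> \<bar>w m\<bar> + D"
      using m(2)[of "Suc k"] k d[OF k(1)] by linarith
    finally show ?thesis
      using False by (simp add: algebra_simps)
  qed
  then have "\<bar>w i\<bar> * \<bar>1 - \<rho>\<bar> \<le> D" if "i \<le> N" for i
    using m(2)[OF that] mult_right_mono[of "\<bar>w i\<bar>" "\<bar>w m\<bar>" "\<bar>1 - \<rho>\<bar>"] by linarith
  then show ?thesis
    using that wN wS by blast
qed

section \<open>Cyclic indices and the periodic linear problem\<close>

definition nxt :: "nat \<Rightarrow> nat \<Rightarrow> nat" where "nxt N i = Suc i mod N"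

text \<open>Adding N before subtracting avoids truncation of natural-number subtraction at
  \<open>i = 0\<close>.\<close>

definition prv :: "nat \<Rightarrow> nat \<Rightarrow> nat" where "prv N i = (i + N - 1) mod N"

lemma nxt_less [simp]: "i < N \<Longrightarrow> nxt N i < N"
  by (auto simp: nxt_def)

lemma prv_less [simp]: "i < N \<Longrightarrow> prv N i < N"
  by (auto simp: prv_def)

lemma nxt_Suc: "Suc i < N \<Longrightarrow> nxt N i = Suc i"
  by (auto simp: nxt_def)

lemma prv_pos: "i < N \<Longrightarrow> 0 < i \<Longrightarrow> prv N i = i - 1"
proof -
  assume "i < N" "0 < i"
  then have eq: "i + N - 1 = (i - 1) + N" by simp
  show ?thesis
    unfolding prv_def eq mod_add_self2 by (rule mod_less) (use \<open>i < N\<close> in linarith)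
qed

lemma prv_0: "0 < N \<Longrightarrow> prv N 0 = N - 1"
  by (simp add: prv_def)

lemma apply_nxt: "i < N \<Longrightarrow> x N = x 0 \<Longrightarrow> x (nxt N i) = x (Suc i)"
  by (cases "Suc i = N") (auto simp: nxt_def)

text \<open>Summed once, the equation is of first order, with the partial sums of B minus a free
  constant \<kappa> on the right; these sums are periodic because B sums to 0. For
  \<open>c = 0\<close> the constant makes the new right-hand side sum to 0; for
  \<open>c \<noteq> 0\<close> it is 0 and the drift gives the factor 1/|c|. Since 1/0 = 0 in HOL,
  one bound covers both cases.\<close>

lemma discrete_periodic_linear:
  fixes c T V h :: real and B :: "nat \<Rightarrow> real"
  assumes N: "N > 0" and T: "T > 0" and h: "h = T / N" and ch: "\<bar>c\<bar> * h \<le> 1/2"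
    and B0: "(\<Sum>i<N. B i) = 0" and V: "(\<Sum>i<N. \<bar>B i\<bar>) \<le> V"
  obtains w where
    "\<And>i. i < N \<Longrightarrow> (1 + c * h) * (w (nxt N i) - w i) - (w i - w (prv N i)) = - h * B i"
    "\<And>i. i < N \<Longrightarrow> \<bar>w i\<bar> \<le> (2 * T + 1 / \<bar>c\<bar>) * V"
proof -
  define S where "S i = (\<Sum>j<i. B j)" for i
  have S: "S 0 = 0" "S N = 0" "S (Suc i) = S i + B i" for i
    using B0 by (auto simp: S_def)
  have hp: "h > 0"
    using N T h by simp
  have pos: "1 + c * h > 0"
    using ch hp abs_ge_minus_self[of "c * h"] by (simp add: abs_mult)
  have SV: "\<bar>S i\<bar> \<le> V" if "i \<le> N" for i
  proof -
    have "\<bar>S i\<bar> \<le> (\<Sum>j<i. \<bar>B j\<bar>)"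
      unfolding S_def by (rule sum_abs)
    also have "\<dots> \<le> (\<Sum>j<N. \<bar>B j\<bar>)"
      using that by (intro sum_mono2) auto
    finally show ?thesis
      using V by simp
  qed
  have V0: "V \<ge> 0"
    using SV[of 0] by (simp add: S)
  obtain w \<kappa> where w: "w N = w 0" "\<And>i. (1 + c * h) * w (Suc i) = w i - h * (S (Suc i) - \<kappa>)"
    and wV: "\<And>i. i < N \<Longrightarrow> \<bar>w i\<bar> \<le> (2 * T + 1 / \<bar>c\<bar>) * V"
  proof (cases "c = 0")
    case True
    define \<kappa> where "\<kappa> = (\<Sum>j<N. S (Suc j)) / N"
    have "\<bar>\<Sum>j<N. S (Suc j)\<bar> \<le> (\<Sum>j<N. \<bar>S (Suc j)\<bar>)"
      by (rule sum_abs)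
    also have "\<dots> \<le> (\<Sum>j<N. V)"
      by (intro sum_mono SV) auto
    finally have \<kappa>: "\<bar>\<kappa>\<bar> \<le> V"
      using N by (simp add: \<kappa>_def field_simps)
    define w where "w i = - h * (\<Sum>j<i. S (Suc j) - \<kappa>)" for i
    show ?thesis
    proof
      show "w N = w 0"
        using N by (simp add: w_def sum_subtractf \<kappa>_def)
      show "(1 + c * h) * w (Suc i) = w i - h * (S (Suc i) - \<kappa>)" for i
        using True by (simp add: w_def algebra_simps)
      show "\<bar>w i\<bar> \<le> (2 * T + 1 / \<bar>c\<bar>) * V" if "i < N" for i
      proof -
        have "\<bar>\<Sum>j<i. S (Suc j) - \<kappa>\<bar> \<le> (\<Sum>j<i. \<bar>S (Suc j) - \<kappa>\<bar>)"
          by (rule sum_abs)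
        also have "\<dots> \<le> (\<Sum>j<i. 2 * V)"
        proof (rule sum_mono)
          fix j assume "j \<in> {..<i}"
          then show "\<bar>S (Suc j) - \<kappa>\<bar> \<le> 2 * V"
            using SV[of "Suc j"] \<kappa> that by simp
        qed
        also have "\<dots> \<le> N * (2 * V)"
          using that V0 by (simp add: mult_right_mono)
        finally have "h * \<bar>\<Sum>j<i. S (Suc j) - \<kappa>\<bar> \<le> h * (N * (2 * V))"
          using hp by (intro mult_left_mono) auto
        then show ?thesis
          using hp True N T by (simp add: w_def abs_mult h)
      qed
    qed
  next
    case False
    have c0: "c * h \<noteq> 0"
      using False hp by auto
    obtain w where w: "w N = w 0" "\<And>i. w (Suc i) = 1 / (1 + c * h) * w i + (- h * S (Suc i) / (1 + c * h))"
      "\<And>i. i \<le> N \<Longrightarrow> \<bar>w i\<bar> * \<bar>1 - 1 / (1 + c * h)\<bar> \<le> h * V / (1 + c * h)"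
    proof (rule first_order_periodic[of "1 / (1 + c * h)" N "\<lambda>i. - h * S (Suc i) / (1 + c * h)" "h * V / (1 + c * h)"])
      fix i assume "i < N"
      then show "\<bar>- h * S (Suc i) / (1 + c * h)\<bar> \<le> h * V / (1 + c * h)"
        using pos hp SV[of "Suc i"] by (simp add: abs_mult divide_right_mono)
    qed (use pos c0 N in auto)
    show ?thesis
    proof
      show "w N = w 0" by fact
      show "(1 + c * h) * w (Suc i) = w i - h * (S (Suc i) - 0)" for i
      proof -
        have "K * (1 / K * x + - y / K) = x - y" if "K \<noteq> 0" for K x y :: real
          using that by (simp add: field_simps)
        from this[of "1 + c * h" "w i" "h * S (Suc i)"] show ?thesis
          using pos unfolding w(2) by simp
      qed
      show "\<bar>w i\<bar> \<le> (2 * T + 1 / \<bar>c\<bar>) * V" if "i < N" for i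
      proof -
        have "1 - 1 / (1 + c * h) = c * h / (1 + c * h)"
          using pos by (simp add: field_simps)
        then have "\<bar>1 - 1 / (1 + c * h)\<bar> = \<bar>c\<bar> * h / (1 + c * h)"
          using pos hp by (simp add: abs_mult)
        then have "\<bar>w i\<bar> * (\<bar>c\<bar> * h / (1 + c * h)) \<le> h * V / (1 + c * h)"
          using w(3)[of i] that by simp
        then have "(\<bar>w i\<bar> * \<bar>c\<bar>) * (h / (1 + c * h)) \<le> V * (h / (1 + c * h))"
          by (simp add: mult_ac)
        then have "\<bar>w i\<bar> * \<bar>c\<bar> \<le> V"
          by (rule mult_right_le_imp_le) (use pos hp in simp)
        then have "\<bar>w i\<bar> \<le> 1 / \<bar>c\<bar> * V"
          using False by (simp add: field_simps)
        also have "\<dots> \<le> (2 * T + 1 / \<bar>c\<bar>) * V"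
          using T V0 by (intro mult_right_mono) auto
        finally show ?thesis .
      qed
    qed
  qed
  show ?thesis
  proof (rule that[of w])
    fix i assume i: "i < N"
    show "(1 + c * h) * (w (nxt N i) - w i) - (w i - w (prv N i)) = - h * B i"
    proof (cases i)
      case 0
      have "(1 + c * h) * w 0 = w (N - 1) + h * \<kappa>"
        using w(2)[of "N - 1"] N w(1) S(2) by simp
      then show ?thesis
        using 0 w(2)[of 0] S(1,3) N apply_nxt[OF i, of w] w(1) by (simp add: prv_0 algebra_simps)
    next
      case (Suc j)
      then show ?thesis
        using w(2)[of i] w(2)[of j] S(3)[of i] apply_nxt[OF i, of w] w(1) i
        by (simp add: prv_pos algebra_simps)
    qed
  qed (use wV in auto)
qed

text \<open>Residual, multiplied by the mesh width h, of the difference scheme with a forward difference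
  for the drift term; A i plays the role of the integral of the weight over the i-th cell.\<close>

definition resid :: "real \<Rightarrow> real \<Rightarrow> real \<Rightarrow> (nat \<Rightarrow> real) \<Rightarrow> (real \<Rightarrow> real) \<Rightarrow> nat \<Rightarrow> (nat \<Rightarrow> real) \<Rightarrow> nat \<Rightarrow> real"
  where "resid c h lam A g N x i =
    (1 + c * h) * (x (nxt N i) - x i) - (x i - x (prv N i)) + h * lam * A i * g (x i)"

text \<open>The upper solution is r + lam g(r) w, where w solves the linear problem with A replaced by its
  deviation from the mean; the summand e Ab absorbs the variation of g near r.\<close>

lemma discrete_upper_solution:
  fixes c T h lam e r :: real and A Ab :: "nat \<Rightarrow> real" and g :: "real \<Rightarrow> real"
  assumes N: "N > 0" and T: "T > 0" and h: "h = T / N" and ch: "\<bar>c\<bar> * h \<le> 1/2"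
    and A: "\<And>i. i < N \<Longrightarrow> \<bar>A i\<bar> \<le> Ab i"
    and a1: "(\<Sum>i<N. A i) = a1" and a2: "(\<Sum>i<N. Ab i) = a2" and e: "0 \<le> e" "e \<le> 1"
    and lam: "lam > 0" and gr: "g r \<ge> 0"
    and small: "lam * g r * ((2 * T + 1 / \<bar>c\<bar>) * (4 * a2)) \<le> r / 2"
    and osc: "\<And>s. \<bar>s - r\<bar> \<le> lam * g r * ((2 * T + 1 / \<bar>c\<bar>) * (4 * a2)) \<Longrightarrow> \<bar>g s - g r\<bar> \<le> e * g r"
  obtains b where "\<forall>i<N. \<bar>b i - r\<bar> \<le> r / 2"
    "\<forall>i<N. resid c h lam A g N b i \<le> h\<^sup>2 * (lam * g r * (a1 + e * a2) / T)"
proof -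
  have hp: "h > 0"
    using N T h by simp
  \<comment> \<open>The last term makes B sum to 0, as solvability requires. Its counterpart
    \<open>(a1 + e * a2) / N\<close> is what remains in the residual and decides its sign.\<close>
  define B where "B i = A i + e * Ab i - (a1 + e * a2) / N" for i
  have "(\<Sum>i<N. B i) = 0"
    using N by (simp add: B_def sum_subtractf sum.distrib a1 a2 flip: sum_distrib_left)
  moreover have "(\<Sum>i<N. \<bar>B i\<bar>) \<le> 4 * a2"
  proof -
    have "\<bar>a1\<bar> \<le> a2"
      unfolding a1[symmetric] a2[symmetric] using A by (intro order_trans[OF sum_abs] sum_mono) auto
    moreover from this have "\<bar>e * a2\<bar> \<le> a2"
      using e by (simp add: abs_mult mult_left_le_one_le)
    ultimately have "\<bar>a1 + e * a2\<bar> \<le> 2 * a2"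
      by linarith
    have "(\<Sum>i<N. \<bar>B i\<bar>) \<le> (\<Sum>i<N. 2 * Ab i + \<bar>a1 + e * a2\<bar> / N)"
    proof (rule sum_mono)
      fix i assume "i \<in> {..<N}"
      then have "\<bar>A i\<bar> \<le> Ab i" "Ab i \<ge> 0"
        using A[of i] by auto
      then have "\<bar>e * Ab i\<bar> \<le> Ab i"
        using e by (simp add: abs_mult mult_left_le_one_le)
      moreover have tri: "\<bar>x + y - z\<bar> \<le> 2 * m + n" if "\<bar>x\<bar> \<le> m" "\<bar>y\<bar> \<le> m" "\<bar>z\<bar> = n"
        for x y z m n :: real
        using that by linarith
      ultimately show "\<bar>B i\<bar> \<le> 2 * Ab i + \<bar>a1 + e * a2\<bar> / N"
        using \<open>\<bar>A i\<bar> \<le> Ab i\<close> unfolding B_def by (intro tri) simp_all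
    qed
    also have "\<dots> = 2 * a2 + \<bar>a1 + e * a2\<bar>"
      using N by (simp add: sum.distrib a2 flip: sum_distrib_left)
    finally show ?thesis
      using \<open>\<bar>a1 + e * a2\<bar> \<le> 2 * a2\<close> by linarith
  qed
  ultimately obtain w where
    w: "\<And>i. i < N \<Longrightarrow> (1 + c * h) * (w (nxt N i) - w i) - (w i - w (prv N i)) = - h * B i"
    and wV: "\<And>i. i < N \<Longrightarrow> \<bar>w i\<bar> \<le> (2 * T + 1 / \<bar>c\<bar>) * (4 * a2)"
    using discrete_periodic_linear[OF N T h ch] by blast
  define b where "b i = r + lam * g r * w i" for i
  have br: "\<bar>b i - r\<bar> \<le> lam * g r * ((2 * T + 1 / \<bar>c\<bar>) * (4 * a2))" if "i < N" for i
    using wV[OF that] lam gr by (simp add: b_def abs_mult mult_left_mono)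
  show ?thesis
  proof (rule that[of b]; intro allI impI)
    fix i assume i: "i < N"
    show "\<bar>b i - r\<bar> \<le> r / 2"
      using br[OF i] small by linarith
    have "(1 + c * h) * (b (nxt N i) - b i) - (b i - b (prv N i)) = lam * g r * (- h * B i)"
      unfolding w[OF i, symmetric] by (simp add: b_def algebra_simps)
    then have "resid c h lam A g N b i = h * lam * (g r * - B i + A i * g (b i))"
      by (simp add: resid_def algebra_simps)
    also have "\<dots> \<le> h * lam * (g r * ((a1 + e * a2) / N))"
    proof (rule mult_left_mono)
      have "\<bar>A i * (g (b i) - g r)\<bar> \<le> Ab i * (e * g r)"
        unfolding abs_mult using A[OF i] osc[OF br[OF i]] by (intro mult_mono) auto
      then show "g r * - B i + A i * g (b i) \<le> g r * ((a1 + e * a2) / N)"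
        by (simp add: B_def algebra_simps abs_le_iff)
    qed (use hp lam in auto)
    also have "\<dots> = h\<^sup>2 * (lam * g r * (a1 + e * a2) / T)"
      using T N by (simp add: h power2_eq_square)
    finally show "resid c h lam A g N b i \<le> h\<^sup>2 * (lam * g r * (a1 + e * a2) / T)" .
  qed
qed

text \<open>With (1 + c h)^k as discrete integrating factor, the weighted slope of the bump falls from 1 to
  -1 at a rate proportional to the weighted mass of A on the cells m0, ..., m1 and is constant elsewhere.\<close>

lemma discrete_lower_solution:
  fixes c h e \<rho> \<mu> :: real and A :: "nat \<Rightarrow> real"
  assumes h: "h > 0" and ch: "\<bar>c\<bar> * h \<le> 1/2"
    and e: "\<And>k. k \<le> N \<Longrightarrow> 1 / e \<le> (1 + c * h) ^ k \<and> (1 + c * h) ^ k \<le> e" "e > 0"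
    and m: "m0 \<le> m1" "m1 < r" "r < N" "l \<le> m0"
    and \<rho>: "\<rho> > 0" and width: "h * e * (real m1 - real m0) \<le> \<rho> / 2"
    and left: "h * (real m0 - real l) \<ge> \<rho> * e"
    and right: "h * (real r - real m1) \<ge> 3 * \<rho> / 2 * e"
    and A: "\<And>j. l < j \<Longrightarrow> j < r \<Longrightarrow> A j \<ge> 0"
    and \<mu>: "(\<Sum>j=m0..m1. A j) \<ge> \<mu>" "\<mu> > 0"
  obtains al where "\<forall>i. 0 \<le> al i \<and> al i \<le> 3 * \<rho> / 2" "al m0 = \<rho>"
    "\<forall>s lam g i. s > 0 \<longrightarrow> g 0 = 0 \<longrightarrow> (\<forall>x\<ge>0. g x \<ge> 0) \<longrightarrow> lam \<ge> 0 \<longrightarrow>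
       (\<forall>x. \<rho> / 2 \<le> x \<and> x \<le> 3 * \<rho> / 2 \<longrightarrow> lam * g (s * x) \<ge> s * (2 * e / \<mu>)) \<longrightarrow> i < N \<longrightarrow>
       resid c h lam A g N (\<lambda>i. s * al i) i \<ge> 0"
proof -
  define om where "om k = (1 + c * h) ^ k" for k :: nat
  have pos: "1 + c * h > 0"
    using ch h abs_ge_minus_self[of "c * h"] by (simp add: abs_mult)
  have om: "om k > 0" for k
    using pos by (simp add: om_def)
  have inv_om: "1 / e \<le> 1 / om k" "1 / om k \<le> e" if "k \<le> N" for k
    using e(1)[OF that] e(2) om[of k] unfolding om_def[symmetric] by (auto simp: field_simps)
  have l_m0: "l < m0"
    using left \<rho> e(2) h by (cases "l = m0") (use m in \<open>auto simp: mult_le_0_iff\<close>)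
  \<comment> \<open>Cells of (l, r) outside m0, ..., m1 carry nonnegative mass, which can only raise
    the residual, so the profile ignores it.\<close>
  define a where "a j = (if m0 \<le> j \<and> j \<le> m1 then om j * A j else 0)" for j
  have a_nonneg: "a j \<ge> 0" for j
    using om[of j] A[of j] m l_m0 by (auto simp: a_def)
  define E where "E k = (\<Sum>j<k. a j)" for k
  have E_mono: "E i \<le> E k" if "i \<le> k" for i k
    unfolding E_def using that a_nonneg by (intro sum_mono2) auto
  have E_left: "E k = 0" if "k \<le> m0" for k
    unfolding E_def using that by (intro sum.neutral) (auto simp: a_def)
  have E_right: "E k = E (Suc m1)" if "k > m1" for k
    unfolding E_def using that by (intro sum.mono_neutral_right) (auto simp: a_def)
  \<comment> \<open>Half of the total weighted mass, so that \<open>q\<close> drops by exactly 2.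
    Its lower bound is the origin of the threshold \<open>2 * e / \<mu>\<close>, which dominates
    1/\<theta>.\<close>
  define \<theta> where "\<theta> = E (Suc m1) / 2"
  have \<theta>: "\<theta> \<ge> \<mu> / (2 * e)"
  proof -
    have "\<mu> / e \<le> (\<Sum>j=m0..m1. A j / e)"
      using \<mu> e(2) by (simp add: sum_divide_distrib[symmetric] divide_right_mono)
    also have "\<dots> \<le> (\<Sum>j=m0..m1. a j)"
    proof (rule sum_mono)
      fix j assume j: "j \<in> {m0..m1}"
      have "A j \<ge> 0" "1 / e \<le> om j"
        using j m l_m0 A e(1)[of j] by (auto simp: om_def)
      then show "A j / e \<le> a j"
        using j mult_right_mono[of "1 / e" "om j" "A j"] by (simp add: a_def)
    qed
    also have "\<dots> = E (Suc m1)"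
      unfolding E_def by (intro sum.mono_neutral_left) (auto simp: a_def)
    finally show ?thesis
      by (simp add: \<theta>_def)
  qed
  have \<theta>_pos: "\<theta> > 0"
    by (rule less_le_trans[OF _ \<theta>]) (use \<mu>(2) e(2) in simp)
  define q where "q k = 1 - E k / \<theta>" for k
  have q_left: "q k = 1" if "k \<le> m0" for k
    using E_left[OF that] by (simp add: q_def)
  have q_right: "q k = -1" if "k > m1" for k
    using E_right[OF that] \<theta>_pos by (simp add: q_def \<theta>_def)
  have q_abs: "\<bar>q k\<bar> \<le> 1" for k
  proof -
    have "0 \<le> E k" "E k \<le> E (Suc m1)"
      using E_mono[of 0 k] E_mono[of k "Suc m1"] E_right[of k]
      by (auto simp: E_def[of 0]) (cases "k \<le> Suc m1"; simp)
    then have "0 \<le> E k / \<theta>" "E k / \<theta> \<le> 2"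
      using \<theta>_pos by (auto simp: \<theta>_def field_simps)
    then show ?thesis
      by (simp add: q_def)
  qed
  \<comment> \<open>Dividing by \<open>om\<close> undoes the integrating factor: the actual slopes
    have size at most e, and at least 1/e where q is 1 or -1.\<close>
  define \<Phi> where "\<Phi> i = (\<Sum>k<i. h * q (Suc k) / om (Suc k))" for i
  define \<phi> where "\<phi> i = \<rho> + \<Phi> i - \<Phi> m0" for i
  have \<Phi>_Suc: "\<Phi> (Suc i) = \<Phi> i + h * q (Suc i) / om (Suc i)" for i
    by (simp add: \<Phi>_def)
  have \<phi>_m0: "\<phi> m0 = \<rho>"
    by (simp add: \<phi>_def)
  have step: "\<bar>h * q k / om k\<bar> \<le> h * e" if "k \<le> N" for k
    unfolding abs_mult abs_divide using inv_om[OF that] q_abs[of k] h om[of k] e(2)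
      mult_mono[of "\<bar>q k\<bar>" 1 "1 / om k" e] by (simp add: field_simps)
  have mid: "\<bar>\<phi> (m0 + j) - \<rho>\<bar> \<le> h * e * j" if "m0 + j \<le> N" for j
    using that
  proof (induction j)
    case (Suc j)
    have eqs: "\<phi> (m0 + Suc j) = \<phi> (m0 + j) + h * q (Suc (m0 + j)) / om (Suc (m0 + j))"
      "h * e * real (Suc j) = h * e * real j + h * e"
      using \<Phi>_Suc[of "m0 + j"] by (simp_all add: \<phi>_def algebra_simps)
    have tri: "\<bar>x + y - z\<bar> \<le> m + n" if "\<bar>x - z\<bar> \<le> m" "\<bar>y\<bar> \<le> n" for x y z m n :: real
      using that by linarith
    show ?case
      unfolding eqs using Suc.IH Suc.prems step[of "Suc (m0 + j)"] by (intro tri) simp_all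
  qed (simp add: \<phi>_m0)
  have mid': "\<bar>\<phi> i - \<rho>\<bar> \<le> \<rho> / 2" if i: "m0 \<le> i" "i \<le> m1" for i
  proof -
    have "\<bar>\<phi> i - \<rho>\<bar> \<le> h * e * real (i - m0)"
      using mid[of "i - m0"] i m by simp
    also have "\<dots> \<le> h * e * (real m1 - real m0)"
      using i h e(2) by (intro mult_left_mono) auto
    finally show ?thesis
      using width by linarith
  qed
  have left_le: "\<phi> (m0 - j) \<le> \<rho> - h * j / e" if "j \<le> m0" for j
    using that
  proof (induction j)
    case (Suc j)
    define k where "k = m0 - Suc j"
    have k: "m0 - j = Suc k" "Suc k \<le> m0" "Suc k \<le> N"
      using Suc.prems m by (auto simp: k_def)
    have "h / e \<le> h * q (Suc k) / om (Suc k)"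
      using q_left[OF k(2)] inv_om[OF k(3)] h mult_left_mono[of "1 / e" "1 / om (Suc k)" h] by simp
    then have "\<phi> k + h / e \<le> \<phi> (m0 - j)"
      using k(1) \<Phi>_Suc[of k] by (simp add: \<phi>_def)
    then show ?case
      using Suc by (simp add: k_def algebra_simps add_divide_distrib)
  qed (simp add: \<phi>_m0)
  have right_le: "\<phi> (m1 + j) \<le> 3 * \<rho> / 2 - h * j / e" if "m1 + j \<le> N" for j
    using that
  proof (induction j)
    case 0
    have "\<phi> m1 - \<rho> \<le> \<rho> / 2"
      using m(1) by (intro abs_le_D1[OF mid']) simp_all
    then show ?case
      by simp
  next
    case (Suc j)
    have k: "Suc (m1 + j) \<le> N" "m1 < Suc (m1 + j)"
      using Suc.prems by auto
    have "h / e \<le> - (h * q (Suc (m1 + j)) / om (Suc (m1 + j)))"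
      using q_right[OF k(2)] inv_om[OF k(1)] h mult_left_mono[of "1 / e" "1 / om (Suc (m1 + j))" h] by simp
    then have "\<phi> (m1 + Suc j) + h / e \<le> \<phi> (m1 + j)"
      using \<Phi>_Suc[of "m1 + j"] by (simp add: \<phi>_def)
    moreover have "\<phi> (m1 + j) \<le> 3 * \<rho> / 2 - h * real j / e"
      using Suc by simp
    moreover have "h * real (Suc j) / e = h * real j / e + h / e"
      by (simp add: algebra_simps add_divide_distrib)
    ultimately show ?case
      by linarith
  qed
  \<comment> \<open>With slopes of size at least 1/e, the distances assumed in \<open>left\<close>
    and \<open>right\<close> suffice to descend to 0 from the height \<rho> at m0 and from a height
    of at most 3 \<rho>/2 at m1.\<close>
  have outside: "\<phi> i \<le> 0" if "i \<le> l \<or> r \<le> i" "i \<le> N" for i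
    using that(1)
  proof
    assume i: "i \<le> l"
    have "\<phi> i \<le> \<rho> - h * (real m0 - real i) / e"
      using left_le[of "m0 - i"] i m by (simp add: of_nat_diff)
    also have "\<dots> \<le> \<rho> - h * (real m0 - real l) / e"
      using i h e(2) by (simp add: divide_right_mono mult_left_mono)
    also have "\<dots> \<le> 0"
      using left e(2) by (simp add: field_simps)
    finally show ?thesis .
  next
    assume i: "r \<le> i"
    have "\<phi> i \<le> 3 * \<rho> / 2 - h * (real i - real m1) / e"
      using right_le[of "i - m1"] i m that(2) by (simp add: of_nat_diff)
    also have "\<dots> \<le> 3 * \<rho> / 2 - h * (real r - real m1) / e"
      using i h e(2) by (simp add: divide_right_mono mult_left_mono)
    also have "\<dots> \<le> 0"
      using right e(2) by (simp add: field_simps)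
    finally show ?thesis .
  qed
  have upper: "\<phi> i \<le> 3 * \<rho> / 2" if "i \<le> N" for i
  proof -
    consider "i \<le> m0" | "m0 \<le> i" "i \<le> m1" | "m1 \<le> i" by linarith
    then show ?thesis
    proof cases
      case 1
      have "h * real (m0 - i) / e \<ge> 0"
        using h e(2) by simp
      then show ?thesis
        using left_le[of "m0 - i"] 1 \<rho> by simp
    next
      case 2
      have "\<phi> i - \<rho> \<le> \<rho> / 2"
        using mid'[OF 2] by (rule abs_le_D1)
      then show ?thesis
        by simp
    next
      case 3
      have "h * real (i - m1) / e \<ge> 0"
        using h e(2) by simp
      then show ?thesis
        using right_le[of "i - m1"] 3 that by simp
    qed
  qed
  \<comment> \<open>The maximum of the lower solutions 0 and \<open>\<phi>\<close> is again a lower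
    solution: at a positive site truncation only raises the neighbours. The profile is nonpositive
    up to l and from r to N, so the cyclic wrap occurs where \<open>al\<close> vanishes.\<close>
  define al where "al i = (if i \<le> N then max 0 (\<phi> i) else 0)" for i
  \<comment> \<open>The factor 1 + c h turns \<open>1 / om (Suc i)\<close> into
    \<open>1 / om i\<close>; both difference quotients then carry the same weight, and only the drop
    of \<open>q\<close> remains.\<close>
  have lap: "(1 + c * h) * (\<phi> (Suc i) - \<phi> i) - (\<phi> i - \<phi> (i - 1)) =
      - (h * (if m0 \<le> i \<and> i \<le> m1 then A i else 0) / \<theta>)" if i: "0 < i" for i
  proof -
    obtain j where j: "i = Suc j"
      using i by (cases i) auto
    have "\<phi> (Suc i) - \<phi> i = h * q (Suc i) / om (Suc i)" "\<phi> i - \<phi> (i - 1) = h * q i / om i"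
      using \<Phi>_Suc[of i] \<Phi>_Suc[of j] by (auto simp: \<phi>_def j)
    moreover have "(1 + c * h) * (h * q (Suc i) / om (Suc i)) = h * q (Suc i) / om i"
      using pos by (simp add: om_def)
    moreover have "q (Suc i) = q i - a i / \<theta>"
      by (simp add: q_def E_def add_divide_distrib)
    ultimately have "(1 + c * h) * (\<phi> (Suc i) - \<phi> i) - (\<phi> i - \<phi> (i - 1)) = - (h * (a i / om i) / \<theta>)"
      using om[of i] \<theta>_pos by (simp add: field_simps)
    then show ?thesis
      using om[of i] by (auto simp: a_def)
  qed
  show ?thesis
  proof (rule that[of al]; (intro allI impI)?)
    show "0 \<le> al i \<and> al i \<le> 3 * \<rho> / 2" for i
      using upper[of i] \<rho> by (auto simp: al_def max_def)
    show "al m0 = \<rho>"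
      using m \<rho> by (simp add: al_def \<phi>_m0)
    fix s lam :: real and g :: "real \<Rightarrow> real" and i
    assume s: "s > 0" and g0: "g 0 = 0" and g: "\<forall>x\<ge>0. g x \<ge> 0" and lam: "lam \<ge> 0"
      and big: "\<forall>x. \<rho> / 2 \<le> x \<and> x \<le> 3 * \<rho> / 2 \<longrightarrow> lam * g (s * x) \<ge> s * (2 * e / \<mu>)" and i: "i < N"
    have al_nonneg: "al j \<ge> 0" for j
      by (simp add: al_def)
    show "resid c h lam A g N (\<lambda>i. s * al i) i \<ge> 0"
    proof (cases "\<phi> i \<le> 0")
      case True
      then have "al i = 0"
        using i by (simp add: al_def)
      then show ?thesis
        using al_nonneg pos s g0 by (simp add: resid_def)
    next
      case False
      then have ir: "l < i" "i < r"
        using outside[of i] i by (meson less_imp_le not_le)+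
      then have ni: "nxt N i = Suc i" "prv N i = i - 1" "0 < i"
        using m i by (auto simp: nxt_Suc prv_pos)
      have al_i: "al i = \<phi> i" "al (Suc i) \<ge> \<phi> (Suc i)" "al (i - 1) \<ge> \<phi> (i - 1)"
        using False i ir m by (auto simp: al_def)
      have "0 \<le> h * (lam * A i * g (s * \<phi> i) - s * ((if m0 \<le> i \<and> i \<le> m1 then A i else 0) / \<theta>))"
      proof (cases "m0 \<le> i \<and> i \<le> m1")
        case True
        have "s / \<theta> \<le> s * (2 * e / \<mu>)"
          using \<theta> \<theta>_pos s \<mu>(2) e(2) by (simp add: field_simps)
        also have "\<dots> \<le> lam * g (s * \<phi> i)"
        proof -
          have "\<bar>\<phi> i - \<rho>\<bar> \<le> \<rho> / 2"
            using mid' True by blast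
          then have "\<rho> / 2 \<le> \<phi> i \<and> \<phi> i \<le> 3 * \<rho> / 2"
            by linarith
          then show ?thesis
            using big by blast
        qed
        finally have "A i * (s / \<theta>) \<le> A i * (lam * g (s * \<phi> i))"
          using A ir by (intro mult_left_mono) auto
        then have "0 \<le> h * (A i * (lam * g (s * \<phi> i)) - A i * (s / \<theta>))"
          using h by (intro mult_nonneg_nonneg) auto
        then show ?thesis
          using True by (simp add: mult_ac)
      next
        case False
        have "g (s * \<phi> i) \<ge> 0"
          using g s \<open>\<not> \<phi> i \<le> 0\<close> by simp
        then show ?thesis
          using False h A ir lam by auto
      qed
      also have "\<dots> = s * ((1 + c * h) * (\<phi> (Suc i) - \<phi> i) - (\<phi> i - \<phi> (i - 1))) + h * lam * A i * g (s * \<phi> i)"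
        unfolding lap[OF ni(3)] by (simp add: algebra_simps)
      also have "\<dots> \<le> s * ((1 + c * h) * (al (Suc i) - al i) - (al i - al (i - 1))) + h * lam * A i * g (s * \<phi> i)"
        using al_i pos s by (intro add_mono mult_left_mono diff_mono order_refl) auto
      also have "\<dots> = resid c h lam A g N (\<lambda>i. s * al i) i"
        by (simp add: resid_def ni al_i algebra_simps)
      finally show ?thesis .
    qed
  qed
qed

text \<open>The shift by \<open>eps * h\<^sup>2\<close> makes 0, the bump and its double strict
  lower solutions, while the margin m > eps keeps \<open>b\<close> and \<open>hi\<close> strict
  upper solutions. Zeros of the shifted residual, up to another \<open>eps * h\<^sup>2\<close>, are
  what the locale yields; hence the factor 2 in the conclusion.\<close>

lemma discrete_two_solutions:
  fixes c h lam Lg C eps m :: real and A b hi al :: "nat \<Rightarrow> real" and g :: "real \<Rightarrow> real"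
  assumes N: "N > 0" and h: "h > 0" and ch: "\<bar>c\<bar> * h \<le> 1/2" and lam: "lam > 0"
    and g0: "g 0 = 0"
    and glip: "\<And>x y. 0 \<le> x \<Longrightarrow> 0 \<le> y \<Longrightarrow> \<bar>g x - g y\<bar> \<le> Lg * \<bar>x - y\<bar>"
    and b: "\<And>i. i < N \<Longrightarrow> 0 \<le> b i \<and> b i \<le> hi i"
    and hi: "\<And>i. i < N \<Longrightarrow> hi i \<le> C"
    and rb: "\<And>i. i < N \<Longrightarrow> resid c h lam A g N b i \<le> - (m * h\<^sup>2)"
    and rhi: "\<And>i. i < N \<Longrightarrow> resid c h lam A g N hi i \<le> - (m * h\<^sup>2)"
    and eps: "0 < eps" "eps < m"
    and al: "\<And>i. i < N \<Longrightarrow> 0 \<le> al i \<and> 2 * al i \<le> hi i"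
    and ral: "\<And>i. i < N \<Longrightarrow> 0 \<le> resid c h lam A g N al i"
    and ral2: "\<And>i. i < N \<Longrightarrow> 0 \<le> resid c h lam A g N (\<lambda>i. 2 * al i) i"
    and al_b: "\<exists>i<N. b i < al i"
  obtains x y where
    "\<forall>i<N. 0 \<le> x i \<and> x i \<le> C" "\<forall>i<N. 0 \<le> y i \<and> y i \<le> C"
    "\<forall>i<N. \<bar>resid c h lam A g N x i\<bar> \<le> 2 * eps * h\<^sup>2"
    "\<forall>i<N. \<bar>resid c h lam A g N y i\<bar> \<le> 2 * eps * h\<^sup>2"
    "\<forall>i<N. 2 * al i \<le> x i" "\<exists>i<N. b i < y i" "\<exists>i<N. y i < al i"
proof -
  have Lg: "Lg \<ge> 0"
    using order_trans[OF abs_ge_zero glip[of 1 0]] by simp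
  define a where "a = (\<Sum>i<N. \<bar>A i\<bar>)"
  have a: "\<bar>A i\<bar> \<le> a" if "i < N" for i
    unfolding a_def using that by (intro member_le_sum[where f = "\<lambda>i. \<bar>A i\<bar>"]) auto
  have a0: "a \<ge> 0"
    by (simp add: a_def sum_nonneg)
  define M where "M = h * lam * a * Lg"
  have M: "M \<ge> 0"
    using h lam a0 Lg by (simp add: M_def)
  \<comment> \<open>M is a Lipschitz constant of the reaction term, and 5 bounds the sum 3/2 + 5/2 +
    1 of the linear coefficients when |c h| \<le> 1/2. This relaxation makes \<open>K\<close>
    monotone, since the diagonal decrease is at most 5 + M, and 2-Lipschitz.\<close>
  define \<tau> where "\<tau> = 1 / (5 + M)"
  have \<tau>: "\<tau> > 0" "\<tau> * (5 + M) = 1"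
    using M by (auto simp: \<tau>_def)
  have chb: "\<bar>c * h\<bar> \<le> 1/2"
    using ch h by (simp add: abs_mult)
  have nonlin: "\<bar>h * lam * A i * g s - h * lam * A i * g t\<bar> \<le> M * \<bar>s - t\<bar>"
    if "i < N" "0 \<le> s" "0 \<le> t" for i s t
  proof -
    have "\<bar>A i * (g s - g t)\<bar> \<le> a * (Lg * \<bar>s - t\<bar>)"
      unfolding abs_mult using a[OF that(1)] glip[OF that(2,3)] a0 by (intro mult_mono) auto
    then have "h * lam * \<bar>A i * (g s - g t)\<bar> \<le> h * lam * (a * (Lg * \<bar>s - t\<bar>))"
      using h lam by (intro mult_left_mono) auto
    moreover have "\<bar>h * lam * A i * g s - h * lam * A i * g t\<bar> = h * lam * \<bar>A i * (g s - g t)\<bar>"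
    proof -
      have "h * lam * A i * g s - h * lam * A i * g t = (h * lam) * (A i * (g s - g t))"
        by (simp add: algebra_simps)
      then show ?thesis
        using h lam by (simp add: abs_mult)
    qed
    ultimately show ?thesis
      by (simp add: M_def mult_ac)
  qed
  define F where "F x i = resid c h lam A g N x i + eps * h\<^sup>2" for x i
  define K where "K x i = x i + \<tau> * F x i" for x i
  have F_diff: "F y i - F x i = (1 + c * h) * (y (nxt N i) - x (nxt N i)) - (2 + c * h) * (y i - x i)
      + (y (prv N i) - x (prv N i)) + (h * lam * A i * g (y i) - h * lam * A i * g (x i))" for x y i
    by (simp add: F_def resid_def algebra_simps)
  have K_mono: "K x i \<le> K y i" if xy: "\<forall>i<N. 0 \<le> x i \<and> x i \<le> y i \<and> y i \<le> hi i" and i: "i < N" for x y i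
  proof -
    have ge: "y i - x i \<ge> 0" "y (nxt N i) - x (nxt N i) \<ge> 0" "y (prv N i) - x (prv N i) \<ge> 0"
      "0 \<le> x i" "0 \<le> y i"
      using xy i by (force intro: order_trans)+
    have "(1 + c * h) * (y (nxt N i) - x (nxt N i)) \<ge> 0"
      using ge(2) chb by (intro mult_nonneg_nonneg) (auto simp: abs_le_iff)
    moreover have "(2 + c * h) * (y i - x i) \<le> 5 * (y i - x i)"
      using ge(1) chb by (intro mult_right_mono) (auto simp: abs_le_iff)
    moreover have "- (M * (y i - x i)) \<le> h * lam * A i * g (y i) - h * lam * A i * g (x i)"
      using nonlin[OF i ge(5,4)] ge(1) by (simp add: abs_le_iff)
    ultimately have "F y i - F x i \<ge> - ((5 + M) * (y i - x i))"
      unfolding F_diff using ge(3) by (simp add: distrib_right)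
    then have "\<tau> * (F y i - F x i) \<ge> \<tau> * - ((5 + M) * (y i - x i))"
      using \<tau> by (intro mult_left_mono) auto
    moreover have "\<tau> * - ((5 + M) * (y i - x i)) = - ((\<tau> * (5 + M)) * (y i - x i))"
      by simp
    ultimately have "- (y i - x i) \<le> \<tau> * (F y i - F x i)"
      unfolding \<tau>(2) by simp
    moreover have "K y i - K x i = (y i - x i) + \<tau> * (F y i - F x i)"
      by (simp add: K_def algebra_simps)
    ultimately show ?thesis
      by linarith
  qed
  have K_lip: "\<bar>K x i - K y i\<bar> \<le> 2 * d"
    if x: "\<forall>i<N. 0 \<le> x i \<and> x i \<le> hi i" and y: "\<forall>i<N. 0 \<le> y i \<and> y i \<le> hi i"
      and d: "\<forall>i<N. \<bar>x i - y i\<bar> \<le> d" and i: "i < N" for x y d i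
  proof -
    have "\<bar>(1 + c * h) * (x (nxt N i) - y (nxt N i))\<bar> \<le> 3/2 * d"
      unfolding abs_mult using chb d i by (intro mult_mono) (auto simp: abs_le_iff)
    moreover have "\<bar>(2 + c * h) * (x i - y i)\<bar> \<le> 5/2 * d"
      unfolding abs_mult using chb d i by (intro mult_mono) (auto simp: abs_le_iff)
    moreover have "\<bar>x (prv N i) - y (prv N i)\<bar> \<le> d"
      using d i by simp
    moreover have "\<bar>h * lam * A i * g (x i) - h * lam * A i * g (y i)\<bar> \<le> M * d"
      using nonlin[OF i, of "x i" "y i"] x y d i M mult_left_mono[of "\<bar>x i - y i\<bar>" d M]
      by (meson order_trans)
    ultimately have "\<bar>F x i - F y i\<bar> \<le> (5 + M) * d"
      unfolding F_diff distrib_right by linarith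
    then have "\<tau> * \<bar>F x i - F y i\<bar> \<le> \<tau> * ((5 + M) * d)"
      using \<tau> by (intro mult_left_mono) auto
    then have "\<bar>\<tau> * (F x i - F y i)\<bar> \<le> d"
      using \<tau> by (simp add: abs_mult flip: mult.assoc)
    moreover have "K x i - K y i = (x i - y i) + \<tau> * (F x i - F y i)"
      by (simp add: K_def algebra_simps)
    moreover have "\<bar>x i - y i\<bar> \<le> d"
      using d i by blast
    ultimately show ?thesis
      by linarith
  qed
  have eh: "eps * h\<^sup>2 > 0" "eps * h\<^sup>2 < m * h\<^sup>2"
    using eps h by simp_all
  have F0: "F (\<lambda>_. 0) i > 0" for i
    using eh by (simp add: F_def resid_def g0)
  have Fb: "F b i < 0" "F hi i < 0" "F al i > 0" "F (\<lambda>i. 2 * al i) i > 0" if "i < N" for i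
    using rb[OF that] rhi[OF that] ral[OF that] ral2[OF that] eh by (auto simp: F_def)
  have locale1: "monotone_box_map N K hi b al' 2 C"
    if al': "\<And>i. i < N \<Longrightarrow> 0 \<le> al' i \<and> al' i \<le> hi i" "\<And>i. i < N \<Longrightarrow> F al' i > 0" "\<exists>i<N. b i < al' i"
    for al'
  proof
    show "0 \<le> hi i \<and> hi i \<le> C" if "i < N" for i
      using b[OF that] hi[OF that] by linarith
    show "K x i \<le> K y i" if "\<forall>i<N. 0 \<le> x i \<and> x i \<le> y i \<and> y i \<le> hi i" "i < N" for x y i
      using K_mono that by blast
    show "\<bar>K x i - K y i\<bar> \<le> 2 * d"
      if "\<forall>i<N. 0 \<le> x i \<and> x i \<le> hi i" "\<forall>i<N. 0 \<le> y i \<and> y i \<le> hi i"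
      "\<forall>i<N. \<bar>x i - y i\<bar> \<le> d" "i < N" for x y d i
      using K_lip that by blast
    show "0 \<le> K (\<lambda>_. 0) i" for i
      using F0[of i] \<tau>(1) by (simp add: K_def)
    show "K hi i \<le> hi i" if "i < N" for i
      using Fb(2)[OF that] \<tau>(1) by (simp add: K_def mult_le_0_iff)
    show "K b i < b i" if "i < N" for i
      using Fb(1)[OF that] \<tau>(1) by (simp add: K_def mult_less_0_iff)
    show "al' i < K al' i" if "i < N" for i
      using al'(2)[OF that] \<tau>(1) by (simp add: K_def)
    show "0 \<le> al' i \<and> al' i \<le> hi i" if "i < N" for i
      using al'(1) that .
    show "0 \<le> b i \<and> b i \<le> hi i" if "i < N" for i
      using b that .
    show "\<exists>i<N. b i < al' i"
      using al'(3) .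
  qed simp
  have resid_small: "\<bar>resid c h lam A g N x i\<bar> \<le> 2 * eps * h\<^sup>2"
    if "\<bar>K x i - x i\<bar> \<le> \<tau> * (eps * h\<^sup>2)" for x i
  proof -
    have "\<tau> * \<bar>F x i\<bar> \<le> \<tau> * (eps * h\<^sup>2)"
      using that \<tau>(1) by (simp add: K_def abs_mult)
    then have "\<bar>F x i\<bar> \<le> eps * h\<^sup>2"
      using \<tau>(1) by simp
    then show ?thesis
      unfolding F_def by linarith
  qed
  have \<eta>: "\<tau> * (eps * h\<^sup>2) > 0"
    using \<tau>(1) eh by simp
  \<comment> \<open>The same map and the same \<open>b\<close> with two lower solutions: the saddle
    is compared with \<open>al\<close>, whereas the increasing iteration starts at
    \<open>2 * al\<close>. The gap between them yields the separation by a factor 2.\<close>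
  interpret lower: monotone_box_map N K hi b al 2 C
  proof (rule locale1)
    show "0 \<le> al i \<and> al i \<le> hi i" if "i < N" for i
      using al[OF that] by linarith
  qed (use Fb al_b in auto)
  interpret upper: monotone_box_map N K hi b "\<lambda>i. 2 * al i" 2 C
  proof (rule locale1)
    obtain i where "i < N" "b i < al i"
      using al_b by blast
    then show "\<exists>i<N. b i < 2 * al i"
      using al[of i] by (intro exI[of _ i]) auto
  qed (use al Fb in auto)
  obtain y where y: "\<forall>i<N. 0 \<le> y i \<and> y i \<le> hi i" "\<forall>i<N. \<bar>K y i - y i\<bar> \<le> \<tau> * (eps * h\<^sup>2)"
    "\<exists>i<N. b i < y i" "\<exists>i<N. y i < al i"
    using lower.saddle[OF \<eta>] by blast
  obtain x where x: "\<forall>i<N. 2 * al i \<le> x i \<and> x i \<le> hi i" "\<forall>i<N. \<bar>K x i - x i\<bar> \<le> \<tau> * (eps * h\<^sup>2)"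
    using upper.increasing_iteration[OF \<eta>] by blast
  show ?thesis
  proof (rule that[of x y]; (intro allI impI)?)
    show "0 \<le> x i \<and> x i \<le> C" if "i < N" for i
      using x(1) al[OF that] hi[OF that] that by (meson mult_nonneg_nonneg order_trans zero_le_numeral)
    show "0 \<le> y i \<and> y i \<le> C" if "i < N" for i
      using y(1) hi[OF that] that by (meson order_trans)
  qed (use x y resid_small in auto)
qed

section \<open>Absolute continuity and indefinite integrals\<close>

lemma AE_lebesgue_negligible:
  assumes "AE t in lebesgue. P t"
  obtains N :: "'a::euclidean_space set" where "negligible N" "\<And>t. t \<notin> N \<Longrightarrow> P t"
proof -
  obtain N where N: "{x \<in> space lebesgue. \<not> P x} \<subseteq> N" "emeasure lebesgue N = 0" "N \<in> sets lebesgue"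
    using AE_E[OF assms] by metis
  then have "negligible N"
    by (auto simp: negligible_iff_null_sets null_sets_def)
  then show ?thesis
    using that N(1) by auto
qed

lemma negligible_AE_lebesgue:
  assumes "negligible N" "\<And>t::'a::euclidean_space. t \<notin> N \<Longrightarrow> P t"
  shows "AE t in lebesgue. P t"
  using assms by (intro AE_I[of _ _ N]) (auto simp: negligible_iff_null_sets null_sets_def)

text \<open>Re-indexing: the intervals of a tagged division form a finite set, not a sequence
  indexed by an initial segment of the naturals.\<close>

lemma abs_cont_on_finite_family:
  assumes AC: "abs_cont_on f x y" and \<epsilon>: "\<epsilon> > 0"
  obtains \<delta> where "\<delta> > 0"
    "\<forall>D p q. finite D \<longrightarrow> (\<forall>d\<in>D. x \<le> p d \<and> p d \<le> q d \<and> q d \<le> y) \<longrightarrow>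
      disjoint_family_on (\<lambda>d. {p d<..<q d}) D \<longrightarrow> (\<Sum>d\<in>D. q d - p d) < \<delta> \<longrightarrow>
      (\<Sum>d\<in>D. \<bar>f (q d) - f (p d)\<bar>) < \<epsilon>"
proof -
  obtain \<delta> where \<delta>: "\<delta> > 0" and *: "\<forall>(n::nat) p q.
        (\<forall>i<n. x \<le> p i \<and> p i \<le> q i \<and> q i \<le> y) \<longrightarrow>
        disjoint_family_on (\<lambda>i. {p i<..<q i}) {..<n} \<longrightarrow>
        (\<Sum>i<n. q i - p i) < \<delta> \<longrightarrow> (\<Sum>i<n. \<bar>f (q i) - f (p i)\<bar>) < \<epsilon>"
    using AC[unfolded abs_cont_on_def, rule_format, OF \<epsilon>] by blast
  have "(\<Sum>d\<in>D. \<bar>f (q d) - f (p d)\<bar>) < \<epsilon>"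
    if D: "finite D" "\<forall>d\<in>D. x \<le> p d \<and> p d \<le> q d \<and> q d \<le> y"
      "disjoint_family_on (\<lambda>d. {p d<..<q d}) D" "(\<Sum>d\<in>D. q d - p d) < \<delta>" for D :: "'a set" and p q
  proof -
    obtain e where e: "bij_betw e {..<card D} D"
      using ex_bij_betw_nat_finite[OF D(1)] by (auto simp: atLeast0LessThan)
    have "(\<Sum>i<card D. \<bar>f (q (e i)) - f (p (e i))\<bar>) < \<epsilon>"
    proof (rule *[rule_format, of "card D" "\<lambda>i. p (e i)" "\<lambda>i. q (e i)"])
      have "\<forall>i<card D. x \<le> p (e i) \<and> p (e i) \<le> q (e i) \<and> q (e i) \<le> y"
        using D(2) e by (auto simp: bij_betw_def)
      then show "x \<le> p (e i) \<and> p (e i) \<le> q (e i) \<and> q (e i) \<le> y" if "i < card D" for i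
        using that by blast
      show "disjoint_family_on (\<lambda>i. {p (e i)<..<q (e i)}) {..<card D}"
        unfolding disjoint_family_on_def
      proof (intro ballI impI)
        fix m n assume mn: "m \<in> {..<card D}" "n \<in> {..<card D}" "m \<noteq> n"
        then have "e m \<in> D" "e n \<in> D" "e m \<noteq> e n"
          using e by (auto simp: bij_betw_def inj_on_def)
        then show "{p (e m)<..<q (e m)} \<inter> {p (e n)<..<q (e n)} = {}"
          using D(3) unfolding disjoint_family_on_def by blast
      qed
      show "(\<Sum>i<card D. q (e i) - p (e i)) < \<delta>"
        using D(4) sum.reindex_bij_betw[OF e, of "\<lambda>d. q d - p d"] by simp
    qed
    then show ?thesis
      using sum.reindex_bij_betw[OF e, of "\<lambda>d. \<bar>f (q d) - f (p d)\<bar>"] by simp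
  qed
  then show ?thesis
    using that[OF \<delta>] by blast
qed

lemma sum_length_le_measure:
  fixes p q :: "'b \<Rightarrow> real"
  assumes "finite D" "disjoint_family_on (\<lambda>d. {p d<..<q d}) D" "\<And>d. d \<in> D \<Longrightarrow> p d \<le> q d"
    and "\<And>d. d \<in> D \<Longrightarrow> {p d<..<q d} \<subseteq> U" "U \<in> lmeasurable"
  shows "(\<Sum>d\<in>D. q d - p d) \<le> measure lebesgue U"
proof -
  have "(\<Sum>d\<in>D. q d - p d) = (\<Sum>d\<in>D. measure lebesgue {p d<..<q d})"
    using assms(3) by (intro sum.cong) auto
  also have "\<dots> = measure lebesgue (\<Union>d\<in>D. {p d<..<q d})"
    using assms by (intro measure_finite_Union[symmetric]) auto
  also have "\<dots> \<le> measure lebesgue U"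
    using assms by (intro measure_mono_fmeasurable) auto
  finally show ?thesis .
qed

lemma negligible_open_cover:
  fixes S :: "'a::euclidean_space set"
  assumes S: "negligible S" and \<delta>: "\<delta> > 0"
  obtains U where "open U" "S \<subseteq> U" "U \<in> lmeasurable" "measure lebesgue U < \<delta>"
proof -
  have S': "S \<in> lmeasurable" "measure lebesgue S = 0"
    using S negligible_iff_measure by auto
  obtain U where U: "open U" "S \<subseteq> U" "U - S \<in> lmeasurable" "emeasure lebesgue (U - S) < ennreal \<delta>"
    using sets_lebesgue_outer_open[OF fmeasurableD[OF S'(1)] \<delta>] by metis
  have eq: "U = (U - S) \<union> S"
    using U(2) by blast
  have "measure lebesgue (U - S) < \<delta>"
    using U(3,4) \<delta> by (simp add: emeasure_eq_measure2 ennreal_less_iff)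
  moreover have "measure lebesgue U \<le> measure lebesgue (U - S) + measure lebesgue S"
    by (subst eq, rule measure_Un_le) (use U S' in auto)
  moreover have "U \<in> lmeasurable"
    using fmeasurable.Un[OF U(3) S'(1)] eq by simp
  ultimately show ?thesis
    using that U S'(2) by simp
qed

text \<open>A gauge argument. Intervals tagged in the exceptional set S lie in an open set of small
  measure, where absolute continuity makes the increments of f small in total. At the other tags
  differentiability gives an error proportional to the length.\<close>

theorem fundamental_theorem_abs_cont:
  fixes f f' :: "real \<Rightarrow> real"
  assumes xy: "x \<le> y" and AC: "abs_cont_on f x y" and S: "negligible S"
    and f': "\<And>t. t \<in> {x..y} - S \<Longrightarrow> (f has_real_derivative f' t) (at t within {x..y})"
  shows "(f' has_integral (f y - f x)) {x..y}"
proof (rule has_integral_spike[OF S])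
  \<comment> \<open>On S the derivative is replaced by 0, so badly tagged intervals contribute only
    the increments of f.\<close>
  define g where "g t = (if t \<in> S then 0 else f' t)" for t
  show "f' t = g t" if "t \<in> {x..y} - S" for t
    using that by (simp add: g_def)
  show "(g has_integral (f y - f x)) {x..y}"
    unfolding has_integral_real
  proof (intro allI impI)
    fix \<epsilon> :: real assume \<epsilon>: "\<epsilon> > 0"
    define e1 where "e1 = \<epsilon> / (2 * (y - x + 1))"
    have e1: "e1 > 0" "e1 * (y - x) \<le> \<epsilon> / 2"
      using \<epsilon> xy by (auto simp: e1_def field_simps)
    obtain \<delta> where \<delta>: "\<delta> > 0" and AC': "\<forall>(D :: (real \<times> real set) set) p q. finite D \<longrightarrow>
        (\<forall>d\<in>D. x \<le> p d \<and> p d \<le> q d \<and> q d \<le> y) \<longrightarrow>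
        disjoint_family_on (\<lambda>d. {p d<..<q d}) D \<longrightarrow> (\<Sum>d\<in>D. q d - p d) < \<delta> \<longrightarrow>
        (\<Sum>d\<in>D. \<bar>f (q d) - f (p d)\<bar>) < \<epsilon> / 2"
      using abs_cont_on_finite_family[OF AC half_gt_zero[OF \<epsilon>]] by blast
    obtain U where U: "open U" "S \<subseteq> U" "U \<in> lmeasurable" "measure lebesgue U < \<delta>"
      using negligible_open_cover[OF S \<delta>] by blast
    have "\<exists>d>0. \<forall>s\<in>{x..y}. \<bar>s - t\<bar> < d \<longrightarrow> \<bar>f s - f t - f' t * (s - t)\<bar> \<le> e1 * \<bar>s - t\<bar>"
      if "t \<in> {x..y} - S" for t
      using f'[OF that] e1(1) unfolding has_field_derivative_def has_derivative_within_alt by simp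
    then obtain \<delta>t where \<delta>t: "\<And>t. t \<in> {x..y} - S \<Longrightarrow> \<delta>t t > 0"
      "\<And>t s. t \<in> {x..y} - S \<Longrightarrow> s \<in> {x..y} \<Longrightarrow> \<bar>s - t\<bar> < \<delta>t t \<Longrightarrow>
          \<bar>f s - f t - f' t * (s - t)\<bar> \<le> e1 * \<bar>s - t\<bar>"
      by metis
    define \<gamma> where "\<gamma> t = (if t \<in> S then U else if t \<in> {x..y} then ball t (\<delta>t t) else ball t 1)" for t
    have gauge: "gauge \<gamma>"
      using U \<delta>t(1) by (auto simp: gauge_def \<gamma>_def)
    have main: "norm ((\<Sum>(t, k)\<in>\<D>. measure lborel k *\<^sub>R g t) - (f y - f x)) < \<epsilon>"
      if \<D>: "\<D> tagged_division_of {x..y}" and fine: "\<gamma> fine \<D>" for \<D>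
    proof -
      note tag = tagged_division_ofD[OF \<D>]
      have ends: "k = {Inf k..Sup k} \<and> Inf k \<le> t \<and> t \<le> Sup k \<and> x \<le> Inf k \<and> Sup k \<le> y \<and> measure lborel k = Sup k - Inf k"
        if tk: "(t, k) \<in> \<D>" for t k
      proof -
        obtain a b where ab: "k = {a..b}"
          using tag(4)[OF tk] by auto
        then have "a \<le> t" "t \<le> b"
          using tag(2)[OF tk] by auto
        then show ?thesis
          using tag(3)[OF tk] ab by auto
      qed
      define lo hi where "lo = (\<lambda>d::real \<times> real set. Inf (snd d))" and "hi = (\<lambda>d::real \<times> real set. Sup (snd d))"
      define B where "B = {d \<in> \<D>. fst d \<in> S}"
      have fin: "finite \<D>" "finite B"
        using tag(1) by (auto simp: B_def)
      have lohi: "x \<le> lo d \<and> lo d \<le> hi d \<and> hi d \<le> y" if "d \<in> \<D>" for d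
        using ends[of "fst d" "snd d"] that by (auto simp: lo_def hi_def)
      have "disjoint_family_on (\<lambda>d. {lo d<..<hi d}) \<D>"
        unfolding disjoint_family_on_def
      proof (intro ballI impI)
        fix d d' assume dd: "d \<in> \<D>" "d' \<in> \<D>" "d \<noteq> d'"
        have "{lo d<..<hi d} = interior (snd d)" if "d \<in> \<D>" for d
          using ends[of "fst d" "snd d"] that interior_atLeastAtMost_real[of "lo d" "hi d"]
          by (simp add: lo_def hi_def)
        then show "{lo d<..<hi d} \<inter> {lo d'<..<hi d'} = {}"
          using tag(5)[of "fst d" "snd d" "fst d'" "snd d'"] dd by simp
      qed
      then have disj: "disjoint_family_on (\<lambda>d. {lo d<..<hi d}) B"
        by (rule disjoint_family_on_mono[rotated]) (auto simp: B_def)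
      have "{lo d<..<hi d} \<subseteq> U" if "d \<in> B" for d
      proof -
        have "snd d \<subseteq> \<gamma> (fst d)" "d \<in> \<D>" "fst d \<in> S"
          using fineD[OF fine, of "fst d" "snd d"] that by (auto simp: B_def)
        moreover have "{lo d<..<hi d} \<subseteq> snd d"
          using ends[of "fst d" "snd d"] \<open>d \<in> \<D>\<close> greaterThanLessThan_subseteq_atLeastAtMost_iff[of "lo d" "hi d" "lo d" "hi d"]
          by (simp add: lo_def hi_def)
        ultimately show ?thesis
          by (auto simp: \<gamma>_def)
      qed
      then have "(\<Sum>d\<in>B. hi d - lo d) < \<delta>"
        using sum_length_le_measure[OF fin(2) disj _ _ U(3)] lohi U(4) by (force simp: B_def)
      then have bad: "(\<Sum>d\<in>B. \<bar>f (hi d) - f (lo d)\<bar>) < \<epsilon> / 2"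
        using lohi fin disj by (intro AC'[rule_format]) (auto simp: B_def)
      have good: "\<bar>(hi d - lo d) * f' (fst d) - (f (hi d) - f (lo d))\<bar> \<le> e1 * (hi d - lo d)"
        if dD: "d \<in> \<D> - B" for d
      proof -
        define t where "t = fst d"
        have t: "t \<in> {x..y} - S" "lo d \<le> t" "t \<le> hi d" "snd d = {lo d..hi d}"
          using ends[of "fst d" "snd d"] dD by (auto simp: lo_def hi_def B_def t_def)
        have "snd d \<subseteq> \<gamma> t"
          using fineD[OF fine, of "fst d" "snd d"] dD by (auto simp: t_def)
        moreover have "\<gamma> t = ball t (\<delta>t t)"
          using t(1) by (simp add: \<gamma>_def)
        ultimately have sub: "{lo d..hi d} \<subseteq> ball t (\<delta>t t)"
          using t(4) by simp
        have "lo d \<in> ball t (\<delta>t t)" "hi d \<in> ball t (\<delta>t t)"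
          using sub t(2,3) by (meson atLeastAtMost_iff order_refl order_trans subsetD)+
        then have near: "\<bar>lo d - t\<bar> < \<delta>t t" "\<bar>hi d - t\<bar> < \<delta>t t"
          by (auto simp: dist_real_def abs_minus_commute)
        have "lo d \<in> {x..y}" "hi d \<in> {x..y}"
          using lohi[of d] dD by auto
        then have "\<bar>f (lo d) - f t - f' t * (lo d - t)\<bar> \<le> e1 * (t - lo d)"
          "\<bar>f (hi d) - f t - f' t * (hi d - t)\<bar> \<le> e1 * (hi d - t)"
          using \<delta>t(2)[OF t(1) _ near(1)] \<delta>t(2)[OF t(1) _ near(2)] t(2,3) by auto
        moreover have "(hi d - lo d) * f' t - (f (hi d) - f (lo d)) =
            (f (lo d) - f t - f' t * (lo d - t)) - (f (hi d) - f t - f' t * (hi d - t))"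
          "e1 * (hi d - lo d) = e1 * (t - lo d) + e1 * (hi d - t)"
          by (simp_all add: algebra_simps)
        ultimately show ?thesis
          unfolding t_def by linarith
      qed
      have total: "(\<Sum>d\<in>\<D>. f (hi d) - f (lo d)) = f y - f x" for f :: "real \<Rightarrow> real"
        using additive_tagged_division_1[OF xy \<D>, of f] by (simp add: lo_def hi_def case_prod_unfold)
      have "(\<Sum>(t, k)\<in>\<D>. measure lborel k *\<^sub>R g t) - (f y - f x)
          = (\<Sum>d\<in>\<D>. (hi d - lo d) * g (fst d) - (f (hi d) - f (lo d)))"
        unfolding total[of f, symmetric] sum_subtractf
        using ends by (auto simp: lo_def hi_def intro!: sum.cong)
      also have "\<bar>\<dots>\<bar> \<le> (\<Sum>d\<in>\<D>. \<bar>(hi d - lo d) * g (fst d) - (f (hi d) - f (lo d))\<bar>)"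
        by (rule sum_abs)
      also have "\<dots> = (\<Sum>d\<in>\<D> - B. \<bar>(hi d - lo d) * g (fst d) - (f (hi d) - f (lo d))\<bar>)
          + (\<Sum>d\<in>B. \<bar>(hi d - lo d) * g (fst d) - (f (hi d) - f (lo d))\<bar>)"
        using fin by (intro sum.subset_diff) (auto simp: B_def)
      also have "(\<Sum>d\<in>\<D> - B. \<bar>(hi d - lo d) * g (fst d) - (f (hi d) - f (lo d))\<bar>)
          \<le> (\<Sum>d\<in>\<D> - B. e1 * (hi d - lo d))"
      proof (rule sum_mono)
        fix d assume "d \<in> \<D> - B"
        then show "\<bar>(hi d - lo d) * g (fst d) - (f (hi d) - f (lo d))\<bar> \<le> e1 * (hi d - lo d)"
          using good[of d] by (simp add: g_def B_def)
      qed
      also have "\<dots> \<le> (\<Sum>d\<in>\<D>. e1 * (hi d - lo d))"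
        using fin lohi e1 by (intro sum_mono2) auto
      also have "\<dots> = e1 * (y - x)"
        using total[of "\<lambda>t. t"] by (simp flip: sum_distrib_left)
      also have "(\<Sum>d\<in>B. \<bar>(hi d - lo d) * g (fst d) - (f (hi d) - f (lo d))\<bar>)
          = (\<Sum>d\<in>B. \<bar>f (hi d) - f (lo d)\<bar>)"
        by (intro sum.cong) (auto simp: g_def B_def)
      finally show ?thesis
        using bad e1(2) by simp
    qed
    show "\<exists>\<gamma>. gauge \<gamma> \<and> (\<forall>\<D>. \<D> tagged_division_of {x..y} \<and> \<gamma> fine \<D> \<longrightarrow>
        norm ((\<Sum>(t, k)\<in>\<D>. measure lborel k *\<^sub>R g t) - (f y - f x)) < \<epsilon>)"
      by (rule exI[of _ \<gamma>], rule conjI, rule gauge, intro allI impI, elim conjE, rule main)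
  qed
qed

text \<open>Used twice with a C1 second factor: for v times 1/(lam g(u)) and for z times the
  exponential integrating factor.\<close>

lemma abs_cont_on_mult_lipschitz:
  assumes f: "abs_cont_on f x y" and k: "\<And>s t. s \<in> {x..y} \<Longrightarrow> t \<in> {x..y} \<Longrightarrow> \<bar>k s - k t\<bar> \<le> L * \<bar>s - t\<bar>"
    and bf: "\<And>t. t \<in> {x..y} \<Longrightarrow> \<bar>f t\<bar> \<le> B" and bk: "\<And>t. t \<in> {x..y} \<Longrightarrow> \<bar>k t\<bar> \<le> B'"
  shows "abs_cont_on (\<lambda>t. f t * k t) x y"
  unfolding abs_cont_on_def
proof (intro allI impI)
  fix \<epsilon> :: real assume \<epsilon>: "\<epsilon> > 0"
  define M where "M = 1 + \<bar>B\<bar> + \<bar>B'\<bar> + \<bar>L\<bar>"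
  have M: "M \<ge> 1" by (simp add: M_def)
  have "\<epsilon> / (2 * M) > 0"
    using \<epsilon> M by simp
  from f[unfolded abs_cont_on_def, rule_format, OF this]
  obtain \<delta> where \<delta>: "\<delta> > 0" and f': "\<forall>(n::nat) p q.
        (\<forall>i<n. x \<le> p i \<and> p i \<le> q i \<and> q i \<le> y) \<longrightarrow>
        disjoint_family_on (\<lambda>i. {p i<..<q i}) {..<n} \<longrightarrow>
        (\<Sum>i<n. q i - p i) < \<delta> \<longrightarrow> (\<Sum>i<n. \<bar>f (q i) - f (p i)\<bar>) < \<epsilon> / (2 * M)"
    by blast
  show "\<exists>\<delta>>0. \<forall>(n::nat) p q.
        (\<forall>i<n. x \<le> p i \<and> p i \<le> q i \<and> q i \<le> y) \<longrightarrow>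
        disjoint_family_on (\<lambda>i. {p i<..<q i}) {..<n} \<longrightarrow>
        (\<Sum>i<n. q i - p i) < \<delta> \<longrightarrow> (\<Sum>i<n. \<bar>f (q i) * k (q i) - f (p i) * k (p i)\<bar>) < \<epsilon>"
  proof (intro exI[of _ "min \<delta> (\<epsilon> / (2 * M * M))"] conjI allI impI)
    show "min \<delta> (\<epsilon> / (2 * M * M)) > 0"
      using \<delta> \<epsilon> M by simp
    fix n :: nat and p q
    assume pq: "\<forall>i<n. x \<le> p i \<and> p i \<le> q i \<and> q i \<le> y"
      and disj: "disjoint_family_on (\<lambda>i. {p i<..<q i}) {..<n}"
      and len: "(\<Sum>i<n. q i - p i) < min \<delta> (\<epsilon> / (2 * M * M))"
    have "\<bar>f (q i) * k (q i) - f (p i) * k (p i)\<bar> \<le> M * \<bar>f (q i) - f (p i)\<bar> + M * M * (q i - p i)"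
      if "i < n" for i
    proof -
      have pqi: "p i \<in> {x..y}" "q i \<in> {x..y}" "p i \<le> q i"
        using pq that by force+
      have "\<bar>(f (q i) - f (p i)) * k (q i)\<bar> \<le> \<bar>f (q i) - f (p i)\<bar> * M"
        unfolding abs_mult using bk[OF pqi(2)] by (intro mult_left_mono) (auto simp: M_def)
      moreover have "\<bar>f (p i) * (k (q i) - k (p i))\<bar> \<le> M * (M * (q i - p i))"
        unfolding abs_mult
      proof (rule mult_mono)
        show "\<bar>f (p i)\<bar> \<le> M"
          using bf[OF pqi(1)] by (auto simp: M_def)
        have "\<bar>k (q i) - k (p i)\<bar> \<le> L * (q i - p i)"
          using k[OF pqi(2,1)] pqi(3) by simp
        also have "\<dots> \<le> M * (q i - p i)"
          using pqi(3) by (intro mult_right_mono) (auto simp: M_def)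
        finally show "\<bar>k (q i) - k (p i)\<bar> \<le> M * (q i - p i)" .
      qed (use M in auto)
      moreover have "f (q i) * k (q i) - f (p i) * k (p i) =
          (f (q i) - f (p i)) * k (q i) + f (p i) * (k (q i) - k (p i))"
        by (simp add: algebra_simps)
      ultimately show ?thesis
        by (simp add: mult_ac)
    qed
    then have "(\<Sum>i<n. \<bar>f (q i) * k (q i) - f (p i) * k (p i)\<bar>)
        \<le> (\<Sum>i<n. M * \<bar>f (q i) - f (p i)\<bar> + M * M * (q i - p i))"
      by (intro sum_mono) auto
    also have "\<dots> = M * (\<Sum>i<n. \<bar>f (q i) - f (p i)\<bar>) + M * M * (\<Sum>i<n. q i - p i)"
      by (simp only: sum.distrib sum_distrib_left)
    also have "\<dots> < M * (\<epsilon> / (2 * M)) + M * M * (\<epsilon> / (2 * M * M))"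
      using M len f' pq disj by (intro add_strict_mono mult_strict_left_mono) auto
    also have "\<dots> = \<epsilon>"
      using M by (simp add: field_simps)
    finally show "(\<Sum>i<n. \<bar>f (q i) * k (q i) - f (p i) * k (p i)\<bar>) < \<epsilon>" .
  qed
qed

lemma sum_integral_disjoint_le:
  fixes r :: "real \<Rightarrow> real"
  assumes r: "r integrable_on {x..y}" "\<And>t. t \<in> {x..y} \<Longrightarrow> 0 \<le> r t"
    and pq: "\<forall>i<n. x \<le> p i \<and> p i \<le> q i \<and> q i \<le> y"
    and disj: "disjoint_family_on (\<lambda>i. {p i<..<q i}) {..<n::nat}"
  shows "(\<Sum>i<n. integral {p i..q i} r) \<le> integral {x..y} r"
proof -
  define s where "s i t = (if t \<in> {p i<..<q i} then r t else 0)" for i t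
  have s: "(s i has_integral integral {p i..q i} r) {x..y}" if "i < n" for i
  proof -
    have "r integrable_on {p i..q i}"
      by (rule integrable_subinterval_real[OF r(1)]) (use pq that in force)
    then have "(r has_integral integral {p i..q i} r) {p i<..<q i}"
      using has_integral_Icc_iff_Ioo by blast
    moreover have "{p i<..<q i} \<subseteq> {x..y}"
      using pq that by force
    ultimately show ?thesis
      unfolding s_def by (subst has_integral_restrict)
  qed
  have "((\<lambda>t. \<Sum>i<n. s i t) has_integral (\<Sum>i<n. integral {p i..q i} r)) {x..y}"
    using s by (intro has_integral_sum) auto
  moreover have "(\<Sum>i<n. s i t) \<le> r t" if t: "t \<in> {x..y}" for t
  proof (cases "\<exists>i<n. t \<in> {p i<..<q i}")
    case True
    then obtain i where i: "i < n" "t \<in> {p i<..<q i}" by blast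
    have "(\<Sum>j<n. s j t) = (\<Sum>j\<in>{i}. s j t)"
    proof (rule sum.mono_neutral_right)
      show "\<forall>j\<in>{..<n} - {i}. s j t = 0"
      proof
        fix j assume j: "j \<in> {..<n} - {i}"
        have "{p j<..<q j} \<inter> {p i<..<q i} = {}"
          using disj i(1) j unfolding disjoint_family_on_def by blast
        then show "s j t = 0"
          using i(2) unfolding s_def by (meson disjoint_iff)
      qed
    qed (use i in auto)
    then show ?thesis
      using i(2) by (simp add: s_def)
  next
    case False
    then have "(\<Sum>i<n. s i t) = 0"
      by (intro sum.neutral) (auto simp: s_def)
    then show ?thesis
      using r(2)[OF t] by simp
  qed
  ultimately show ?thesis
    using r(1) by (meson has_integral_integral has_integral_le)
qed

text \<open>Truncation: |f| is at most n plus the excess \<open>r n\<close>, whose integral tends to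
  0 by dominated convergence. Once n is fixed, the excess is small over any disjoint family and the
  bounded part is at most n times the total length.\<close>

lemma abs_cont_on_indefinite_integral:
  fixes f F :: "real \<Rightarrow> real"
  assumes f: "f absolutely_integrable_on {x..y}"
    and F: "\<And>s t. x \<le> s \<Longrightarrow> s \<le> t \<Longrightarrow> t \<le> y \<Longrightarrow> (f has_integral F t - F s) {s..t}"
  shows "abs_cont_on F x y"
  unfolding abs_cont_on_def
proof (intro allI impI)
  fix \<epsilon> :: real assume \<epsilon>: "\<epsilon> > 0"
  have absf: "(\<lambda>t. \<bar>f t\<bar>) integrable_on {x..y}"
    using f by (simp add: absolutely_integrable_on_def)
  define r where "r n t = max 0 (\<bar>f t\<bar> - real n)" for n t
  have r_int: "r n integrable_on {x..y}" for n
  proof -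
    have "(\<lambda>t. max 0 (\<bar>f t\<bar> - real n)) absolutely_integrable_on {x..y}"
    proof (rule absolutely_integrable_max_1)
      have "(\<lambda>t. \<bar>f t\<bar>) absolutely_integrable_on {x..y}"
        using absf by (simp add: absolutely_integrable_on_def)
      then show "(\<lambda>t. \<bar>f t\<bar> - real n) absolutely_integrable_on {x..y}"
        by (rule set_integral_diff(1)) (auto intro: absolutely_integrable_continuous_real)
    qed (auto intro: absolutely_integrable_continuous_real)
    moreover have "r n = (\<lambda>t. max 0 (\<bar>f t\<bar> - real n))"
      by (simp add: r_def fun_eq_iff)
    ultimately show ?thesis
      by (simp add: absolutely_integrable_on_def)
  qed
  have "(\<lambda>n. integral {x..y} (r n)) \<longlonglongrightarrow> integral {x..y} (\<lambda>_. 0)"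
  proof (rule dominated_convergence(2)[OF r_int absf])
    fix t assume "t \<in> {x..y}"
    have "\<forall>\<^sub>F n in sequentially. r n t = 0"
      using eventually_ge_at_top[of "nat \<lceil>\<bar>f t\<bar>\<rceil>"]
      by eventually_elim (auto simp: r_def max_def nat_le_iff ceiling_le_iff)
    then show "(\<lambda>n. r n t) \<longlonglongrightarrow> 0"
      by (rule tendsto_eventually)
  qed (auto simp: r_def)
  then have "\<forall>\<^sub>F n in sequentially. integral {x..y} (r n) < \<epsilon> / 2"
    using \<epsilon> by (intro order_tendstoD(2)) auto
  then obtain n where n: "integral {x..y} (r n) < \<epsilon> / 2"
    by (auto simp: eventually_sequentially)
  show "\<exists>\<delta>>0. \<forall>(m::nat) p q.
        (\<forall>i<m. x \<le> p i \<and> p i \<le> q i \<and> q i \<le> y) \<longrightarrow>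
        disjoint_family_on (\<lambda>i. {p i<..<q i}) {..<m} \<longrightarrow>
        (\<Sum>i<m. q i - p i) < \<delta> \<longrightarrow> (\<Sum>i<m. \<bar>F (q i) - F (p i)\<bar>) < \<epsilon>"
  proof (intro exI[of _ "\<epsilon> / (2 * (real n + 1))"] conjI allI impI)
    show "\<epsilon> / (2 * (real n + 1)) > 0"
      using \<epsilon> by simp
    fix m :: nat and p q
    assume pq: "\<forall>i<m. x \<le> p i \<and> p i \<le> q i \<and> q i \<le> y"
      and disj: "disjoint_family_on (\<lambda>i. {p i<..<q i}) {..<m}"
      and len: "(\<Sum>i<m. q i - p i) < \<epsilon> / (2 * (real n + 1))"
    have "\<bar>F (q i) - F (p i)\<bar> \<le> integral {p i..q i} (r n) + real n * (q i - p i)" if "i < m" for i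
    proof -
      have pqi: "x \<le> p i" "p i \<le> q i" "q i \<le> y"
        using pq that by auto
      have "r n integrable_on {p i..q i}"
        by (rule integrable_subinterval_real[OF r_int]) (use pqi in auto)
      then have "((\<lambda>t. r n t + real n) has_integral integral {p i..q i} (r n) + real n * (q i - p i)) {p i..q i}"
        using has_integral_const_real[of "real n" "p i" "q i"] pqi
        by (intro has_integral_add) (auto simp: integrable_integral mult.commute)
      moreover have "(f has_integral F (q i) - F (p i)) {p i..q i}"
        using F pqi by auto
      ultimately have "norm (integral {p i..q i} f) \<le> integral {p i..q i} (\<lambda>t. r n t + real n)"
        by (intro integral_norm_bound_integral) (auto simp: r_def)
      then show ?thesis
        using \<open>(f has_integral F (q i) - F (p i)) {p i..q i}\<close>
          \<open>((\<lambda>t. r n t + real n) has_integral integral {p i..q i} (r n) + real n * (q i - p i)) {p i..q i}\<close>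
        by (simp add: integral_unique)
    qed
    then have "(\<Sum>i<m. \<bar>F (q i) - F (p i)\<bar>)
        \<le> (\<Sum>i<m. integral {p i..q i} (r n) + real n * (q i - p i))"
      by (intro sum_mono) auto
    also have "\<dots> = (\<Sum>i<m. integral {p i..q i} (r n)) + real n * (\<Sum>i<m. q i - p i)"
      by (simp only: sum.distrib sum_distrib_left)
    also have "\<dots> \<le> integral {x..y} (r n) + real n * (\<Sum>i<m. q i - p i)"
      using sum_integral_disjoint_le[OF r_int[of n] _ pq disj] by (simp add: r_def)
    also have "\<dots> < \<epsilon> / 2 + \<epsilon> / 2"
    proof (rule add_less_le_mono[OF n])
      have "real n * (\<Sum>i<m. q i - p i) \<le> real n * (\<epsilon> / (2 * (real n + 1)))"
        using len by (intro mult_left_mono) auto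
      also have "\<dots> \<le> \<epsilon> / 2"
        using \<epsilon> by (simp add: field_simps)
      finally show "real n * (\<Sum>i<m. q i - p i) \<le> \<epsilon> / 2" .
    qed
    finally show "(\<Sum>i<m. \<bar>F (q i) - F (p i)\<bar>) < \<epsilon>"
      by simp
  qed
qed

text \<open>The library only has the one-sided Lebesgue differentiation theorem; the left derivative
  comes from the reflected function.\<close>

lemma indefinite_integral_deriv_ae:
  fixes f F :: "real \<Rightarrow> real"
  assumes F: "\<And>s t. s \<le> t \<Longrightarrow> (f has_integral F t - F s) {s..t}"
  obtains N where "negligible N" "\<And>t. t \<notin> N \<Longrightarrow> (F has_real_derivative f t) (at t)"
proof -
  have int: "f integrable_on cbox s t" for s t
    using F[of s t] by (cases "s \<le> t") auto
  have int': "(\<lambda>t. f (- t)) integrable_on cbox s t" for s t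
    using int[of "-t" "-s"] Henstock_Kurzweil_Integration.integrable_reflect_real[where f = f and a = "-t" and b = "-s"] by simp
  obtain N1 where N1: "negligible N1" "\<And>x e. x \<notin> N1 \<Longrightarrow> 0 < e \<Longrightarrow>
      \<exists>d>0. \<forall>h. 0 < h \<and> h < d \<longrightarrow> norm (integral (cbox x (x + h *\<^sub>R One)) f /\<^sub>R h ^ DIM(real) - f x) < e"
    using integrable_ccontinuous_explicit[OF int] by metis
  obtain N2 where N2: "negligible N2" "\<And>x e. x \<notin> N2 \<Longrightarrow> 0 < e \<Longrightarrow>
      \<exists>d>0. \<forall>h. 0 < h \<and> h < d \<longrightarrow>
        norm (integral (cbox x (x + h *\<^sub>R One)) (\<lambda>t. f (- t)) /\<^sub>R h ^ DIM(real) - f (- x)) < e"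
    using integrable_ccontinuous_explicit[OF int'] by metis
  have "negligible (uminus ` N2)"
    using N2(1) by (intro negligible_differentiable_image_negligible) (auto intro!: derivative_intros simp: differentiable_on_def)
  moreover have "(F has_real_derivative f t) (at t)" if t: "t \<notin> N1 \<union> uminus ` N2" for t
  proof -
    have right: "((\<lambda>h. (F (t + h) - F t) / h) \<longlongrightarrow> f t) (at_right 0)"
    proof (rule tendstoI)
      fix e :: real assume "e > 0"
      then obtain d where d: "d > 0" "\<And>h. 0 < h \<and> h < d \<Longrightarrow> norm (integral (cbox t (t + h *\<^sub>R One)) f /\<^sub>R h ^ DIM(real) - f t) < e"
        using N1(2)[of t e] t by auto
      have "dist ((F (t + h) - F t) / h) (f t) < e" if "0 < h" "h < d" for h
        using d(2)[of h] that integral_unique[OF F[of t "t + h"]] by (simp add: dist_real_def divide_inverse mult.commute)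
      then show "\<forall>\<^sub>F h in at_right 0. dist ((F (t + h) - F t) / h) (f t) < e"
        using d(1) unfolding eventually_at_right_field by blast
    qed
    have left: "((\<lambda>h. (F (t + h) - F t) / h) \<longlongrightarrow> f t) (at_left 0)"
    proof (rule tendstoI)
      fix e :: real assume "e > 0"
      moreover have "- t \<notin> N2"
        using t by force
      ultimately obtain d where d: "d > 0" "\<And>h. 0 < h \<and> h < d \<Longrightarrow>
          norm (integral (cbox (- t) (- t + h *\<^sub>R One)) (\<lambda>t. f (- t)) /\<^sub>R h ^ DIM(real) - f (- (- t))) < e"
        using N2(2)[of "- t" e] by blast
      have "dist ((F (t + h) - F t) / h) (f t) < e" if "- d < h" "h < 0" for h
      proof -
        have "integral {- t..- t + - h} (\<lambda>t. f (- t)) = F t - F (t + h)"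
          using Henstock_Kurzweil_Integration.integral_reflect_real[where f = f and a = "t + h" and b = t] integral_unique[OF F[of "t + h" t]] that by simp
        then have "\<bar>(F t - F (t + h)) / (- h) - f t\<bar> < e"
          using d(2)[of "- h"] that by (simp add: divide_inverse mult.commute)
        moreover have "(F t - F (t + h)) / (- h) = (F (t + h) - F t) / h"
          using that by (simp add: field_simps)
        ultimately show ?thesis
          by (simp add: dist_real_def)
      qed
      then show "\<forall>\<^sub>F h in at_left 0. dist ((F (t + h) - F t) / h) (f t) < e"
        using d(1) unfolding eventually_at_left_field by (intro exI[of _ "- d"]) auto
    qed
    show ?thesis
      unfolding DERIV_def using filterlim_split_at[OF left right] .
  qed
  ultimately show ?thesis
    using that[of "N1 \<union> uminus ` N2"] N1(1) by auto
qed

section \<open>Nonexistence and necessity\<close>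

lemma C1_lipschitz_on_Icc:
  fixes k k' :: "real \<Rightarrow> real"
  assumes k: "\<And>t. (k has_real_derivative k' t) (at t)" and k': "continuous_on {x..y} k'"
  obtains L where "\<And>s t. s \<in> {x..y} \<Longrightarrow> t \<in> {x..y} \<Longrightarrow> \<bar>k s - k t\<bar> \<le> L * \<bar>s - t\<bar>"
proof -
  have "bounded (k' ` {x..y})"
    using k' by (intro compact_imp_bounded compact_continuous_image) auto
  then obtain L where L: "\<And>t. t \<in> {x..y} \<Longrightarrow> \<bar>k' t\<bar> \<le> L"
    unfolding bounded_iff by (metis imageI real_norm_def)
  have "\<bar>k s - k t\<bar> \<le> L * \<bar>s - t\<bar>" if "s \<in> {x..y}" "t \<in> {x..y}" for s t
    using field_differentiable_bound[of "{x..y}" k k' L s t] L that has_field_derivative_at_within[OF k]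
    by auto
  then show ?thesis
    using that by blast
qed

lemma bounded_on_Icc:
  fixes k :: "real \<Rightarrow> real"
  assumes "continuous_on {x..y} k"
  obtains B where "\<And>t. t \<in> {x..y} \<Longrightarrow> \<bar>k t\<bar> \<le> B"
proof -
  have "bounded (k ` {x..y})"
    using assms by (intro compact_imp_bounded compact_continuous_image) auto
  then show ?thesis
    using that unfolding bounded_iff by (metis imageI real_norm_def)
qed

lemma periodic_withD: "periodic_with T f \<Longrightarrow> f (t + T) = f t"
  by (simp add: periodic_with_def)

locale indefinite_equation =
  fixes T c :: real and g g' a :: "real \<Rightarrow> real"
  assumes T_pos: "T > 0"
    and g_nonneg: "s \<ge> 0 \<Longrightarrow> g s \<ge> 0"
    and g_deriv: "s \<ge> 0 \<Longrightarrow> (g has_real_derivative g' s) (at s within {0..})"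
    and g'_cont: "continuous_on {0..} g'"
    and g_zero: "g 0 = 0"
    and g_pos: "s > 0 \<Longrightarrow> g s > 0"
    and g'_zero: "g' 0 = 0"
    and g'_inf: "(g' \<longlongrightarrow> 0) at_top"
    and a_loc: "locally_integrable a"
    and a_per: "periodic_with T a"
begin

lemma g'_bounded:
  obtains D where "D > 0" "\<And>s. s \<ge> 0 \<Longrightarrow> \<bar>g' s\<bar> \<le> D"
proof -
  have "\<forall>\<^sub>F s in at_top. dist (g' s) 0 < 1"
    using g'_inf by (rule tendstoD) simp
  then obtain R where R: "\<And>s. s \<ge> R \<Longrightarrow> \<bar>g' s\<bar> < 1"
    by (auto simp: eventually_at_top_linorder)
  have "continuous_on {0..\<bar>R\<bar>} g'"
    using g'_cont by (rule continuous_on_subset) auto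
  then obtain B where B: "\<And>t. t \<in> {0..\<bar>R\<bar>} \<Longrightarrow> \<bar>g' t\<bar> \<le> B"
    by (rule bounded_on_Icc) blast
  have "\<bar>g' s\<bar> \<le> \<bar>B\<bar> + 1" if "s \<ge> 0" for s
  proof (cases "s \<ge> R")
    case True
    then show ?thesis
      using R[of s] by linarith
  next
    case False
    then show ?thesis
      using B[of s] that by force
  qed
  then show ?thesis
    using that[of "\<bar>B\<bar> + 1"] by force
qed

lemma g_diff_le:
  assumes "\<And>r. min s t \<le> r \<Longrightarrow> r \<le> max s t \<Longrightarrow> \<bar>g' r\<bar> \<le> D" "0 \<le> s" "0 \<le> t"
  shows "\<bar>g s - g t\<bar> \<le> D * \<bar>s - t\<bar>"
proof -
  have "(g has_real_derivative g' r) (at r within {min s t..max s t})" if "r \<in> {min s t..max s t}" for r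
  proof (rule DERIV_subset[OF g_deriv])
    show "r \<ge> 0" "{min s t..max s t} \<subseteq> {0..}"
      using that assms(2,3) by auto
  qed
  then show ?thesis
    using field_differentiable_bound[of "{min s t..max s t}" g g' D s t] assms by auto
qed

lemma g_DERIV:
  assumes "s > 0"
  shows "(g has_real_derivative g' s) (at s)"
proof -
  have "(g has_real_derivative g' s) (at s within {0<..})"
    by (rule DERIV_subset[OF g_deriv]) (use assms in auto)
  then show ?thesis
    using at_within_open[of s "{0<..}"] assms by simp
qed

lemma g_continuous: "continuous_on {0..} g"
  using g_deriv by (intro DERIV_continuous_on) auto

lemma a_abs_int: "a absolutely_integrable_on {s..t}"
  using a_loc by (simp add: locally_integrable_def)

lemma a_int: "a integrable_on {s..t}" "(\<lambda>r. \<bar>a r\<bar>) integrable_on {s..t}"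
  using a_abs_int[of s t] by (auto simp: absolutely_integrable_on_def)

text \<open>The quotient \<^term>\<open>z = v / (lam * g u)\<close>, \<^term>\<open>v\<close> the derivative of the solution \<^term>\<open>u\<close>, is the
  derivative of a function of \<^term>\<open>u\<close> and satisfies a Riccati equation whose forcing term is
  \<^term>\<open>a\<close> alone.\<close>

lemma solution_riccati:
  assumes sol: "positive_periodic_solution T c lam a g u" and lam: "lam > 0"
  obtains z where "continuous_on UNIV z" "continuous_on UNIV (\<lambda>t. g' (u t))" "\<forall>t. u t > 0"
    "periodic_with T z" "\<exists>t\<in>{0..T}. z t = 0" "(z has_integral 0) {0..T}"
    "\<forall>s t. s \<le> t \<longrightarrow> ((\<lambda>r. - c * z r - a r - lam * g' (u r) * (z r)\<^sup>2) has_integral z t - z s) {s..t}"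
    "\<forall>s t. s \<le> t \<longrightarrow> ((\<lambda>r. - (exp (c * r) * (a r + lam * g' (u r) * (z r)\<^sup>2)))
        has_integral exp (c * t) * z t - exp (c * s) * z s) {s..t}"
proof -
  obtain v where u': "\<And>t. (u has_real_derivative v t) (at t)" and vc: "continuous_on UNIV v"
    and vac: "locally_abs_cont v"
    and ae: "AE t in lebesgue. \<exists>w. (v has_real_derivative w) (at t) \<and> w + c * v t + lam * a t * g (u t) = 0"
    and per: "periodic_with T u" and pos: "\<And>t. u t > 0"
    using sol unfolding positive_periodic_solution_def caratheodory_solution_def by blast
  obtain N where N: "negligible N" "\<And>t. t \<notin> N \<Longrightarrow>
      \<exists>w. (v has_real_derivative w) (at t) \<and> w + c * v t + lam * a t * g (u t) = 0"
    using AE_lebesgue_negligible[OF ae] by blast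
  have v': "(v has_real_derivative - c * v t - lam * a t * g (u t)) (at t)" if "t \<notin> N" for t
  proof -
    obtain w where w: "(v has_real_derivative w) (at t)" "w + c * v t + lam * a t * g (u t) = 0"
      using N(2)[OF \<open>t \<notin> N\<close>] by blast
    from w(2) have "w = - c * v t - lam * a t * g (u t)"
      by (simp add: algebra_simps eq_neg_iff_add_eq_0)
    then show ?thesis
      using w(1) by simp
  qed
  have uc: "continuous_on UNIV u"
    using u' by (meson DERIV_isCont continuous_at_imp_continuous_on)
  have gu: "g (u t) > 0" "((\<lambda>t. g (u t)) has_real_derivative g' (u t) * v t) (at t)" for t
    using g_pos[OF pos] DERIV_chain2[OF g_DERIV[OF pos] u'] by auto
  have guc: "continuous_on UNIV (\<lambda>t. g (u t))"
    using gu(2) by (meson DERIV_isCont continuous_at_imp_continuous_on)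
  have g'uc: "continuous_on UNIV (\<lambda>t. g' (u t))"
  proof -
    have "continuous_on {0<..} g'"
      using g'_cont by (rule continuous_on_subset) auto
    then show ?thesis
      by (rule continuous_on_compose2[OF _ uc]) (use pos in auto)
  qed
  define \<psi> where "\<psi> t = 1 / (lam * g (u t))" for t
  have \<psi>': "(\<psi> has_real_derivative - (g' (u t) * v t) / (lam * (g (u t))\<^sup>2)) (at t)" for t
    unfolding \<psi>_def using gu(1)[of t] lam
    by (auto intro!: derivative_eq_intros gu(2) simp: power2_eq_square field_simps)
  have \<psi>'c: "continuous_on UNIV (\<lambda>t. - (g' (u t) * v t) / (lam * (g (u t))\<^sup>2))"
    using gu(1) lam by (intro continuous_intros g'uc vc guc) (auto simp: less_imp_neq[symmetric])
  have \<psi>c: "continuous_on UNIV \<psi>"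
    using \<psi>' by (meson DERIV_isCont continuous_at_imp_continuous_on)
  define z where "z t = v t * \<psi> t" for t
  have zc: "continuous_on UNIV z"
    unfolding z_def by (intro continuous_intros vc \<psi>c)
  have AC_mult: "abs_cont_on (\<lambda>t. f t * k t) s t"
    if f: "abs_cont_on f s t" "continuous_on UNIV f"
      and k: "\<And>t. (k has_real_derivative k' t) (at t)" "continuous_on UNIV k'"
    for f k k' s t
  proof -
    have kc: "continuous_on UNIV k"
      using k(1) by (meson DERIV_isCont continuous_at_imp_continuous_on)
    obtain L where L: "\<And>x y. x \<in> {s..t} \<Longrightarrow> y \<in> {s..t} \<Longrightarrow> \<bar>k x - k y\<bar> \<le> L * \<bar>x - y\<bar>"
      using C1_lipschitz_on_Icc[OF k(1), of s t] continuous_on_subset[OF k(2)] by blast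
    obtain B where B: "\<And>x. x \<in> {s..t} \<Longrightarrow> \<bar>f x\<bar> \<le> B"
      using bounded_on_Icc[of s t f] continuous_on_subset[OF f(2)] by blast
    obtain B' where B': "\<And>x. x \<in> {s..t} \<Longrightarrow> \<bar>k x\<bar> \<le> B'"
      using bounded_on_Icc[of s t k] continuous_on_subset[OF kc] by blast
    show ?thesis
      by (rule abs_cont_on_mult_lipschitz[OF f(1) L B B'])
  qed
  have zAC: "abs_cont_on z s t" if "s \<le> t" for s t
    unfolding z_def using vac that by (intro AC_mult[OF _ vc \<psi>' \<psi>'c]) (auto simp: locally_abs_cont_def)
  have z': "(z has_real_derivative - c * z t - a t - lam * g' (u t) * (z t)\<^sup>2) (at t)" if "t \<notin> N" for t
  proof -
    have "(z has_real_derivative (- c * v t - lam * a t * g (u t)) * \<psi> t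
        + (- (g' (u t) * v t) / (lam * (g (u t))\<^sup>2)) * v t) (at t)"
      unfolding z_def using DERIV_mult[OF v'[OF that] \<psi>'[of t]] by simp
    moreover have "(- c * v t - lam * a t * g (u t)) * \<psi> t + (- (g' (u t) * v t) / (lam * (g (u t))\<^sup>2)) * v t
        = - c * z t - a t - lam * g' (u t) * (z t)\<^sup>2"
      using gu(1)[of t] lam by (simp add: z_def \<psi>_def power2_eq_square field_simps)
    ultimately show ?thesis
      by simp
  qed
  have zint: "((\<lambda>r. - c * z r - a r - lam * g' (u r) * (z r)\<^sup>2) has_integral z t - z s) {s..t}" if "s \<le> t" for s t
    by (rule fundamental_theorem_abs_cont[OF that zAC[OF that] N(1)])
      (blast intro: has_field_derivative_at_within z')
  have expAC: "abs_cont_on (\<lambda>r. z r * exp (c * r)) s t" if "s \<le> t" for s t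
    by (rule AC_mult[OF zAC[OF that] zc, of _ "\<lambda>r. c * exp (c * r)"])
      (auto intro!: derivative_eq_intros continuous_intros)
  have exp': "((\<lambda>r. z r * exp (c * r)) has_real_derivative - (exp (c * t) * (a t + lam * g' (u t) * (z t)\<^sup>2))) (at t)"
    if "t \<notin> N" for t
    by (rule derivative_eq_intros z'[OF that] refl)+ (simp add: algebra_simps)
  have expint: "((\<lambda>r. - (exp (c * r) * (a r + lam * g' (u r) * (z r)\<^sup>2)))
        has_integral exp (c * t) * z t - exp (c * s) * z s) {s..t}" if "s \<le> t" for s t
  proof -
    have "((\<lambda>r. - (exp (c * r) * (a r + lam * g' (u r) * (z r)\<^sup>2)))
        has_integral z t * exp (c * t) - z s * exp (c * s)) {s..t}"
      by (rule fundamental_theorem_abs_cont[OF that expAC[OF that] N(1)])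
        (blast intro: has_field_derivative_at_within exp')
    then show ?thesis
      by (simp add: mult.commute)
  qed
  have vper: "v (t + T) = v t" for t
  proof -
    have "((\<lambda>t. u (t + T)) has_real_derivative v (t + T)) (at t)"
      using DERIV_shift[of u "v (t + T)" t T] u' by simp
    moreover have "(\<lambda>t. u (t + T)) = u"
      using per by (auto simp: periodic_with_def)
    ultimately show ?thesis
      using DERIV_unique[OF _ u'[of t]] by simp
  qed
  have uT: "u (t + T) = u t" for t
    using per by (rule periodic_withD)
  obtain t0 where t0: "0 < t0" "t0 < T" "v t0 = 0"
  proof -
    have "\<exists>l t. 0 < t \<and> t < T \<and> DERIV u t :> l \<and> u T - u 0 = (T - 0) * l"
      using T_pos u' by (intro MVT) (auto intro: continuous_on_subset[OF uc] simp: real_differentiable_def)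
    then obtain l t where "0 < t" "t < T" "DERIV u t :> l" "T * l = 0"
      using uT[of 0] by auto
    moreover then have "v t = l"
      using DERIV_unique u' by blast
    ultimately show ?thesis
      using that[of t] T_pos by auto
  qed
  have zH: "(z has_integral 0) {0..T}"
  proof -
    \<comment> \<open>The interval is chosen strictly larger than the range of \<open>u\<close> over
      a period, so that every \<open>u t\<close> is an interior point and the primitive
      \<open>H\<close> is differentiable there from both sides.\<close>
    obtain m M where mM: "m > 0" "\<And>t. t \<in> {0..T} \<Longrightarrow> m < u t \<and> u t < M"
    proof -
      have "\<exists>x\<in>{0..T}. \<forall>y\<in>{0..T}. u x \<le> u y" "\<exists>x\<in>{0..T}. \<forall>y\<in>{0..T}. u y \<le> u x"
        using T_pos by (auto intro!: continuous_attains_inf continuous_attains_sup continuous_on_subset[OF uc])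
      then obtain x y where "\<forall>t\<in>{0..T}. u x \<le> u t" "\<forall>t\<in>{0..T}. u t \<le> u y"
        by blast
      then show ?thesis
        using that[of "u x / 2" "u y + 1"] pos[of x] by force
    qed
    have inv_c: "continuous_on {m..M} (\<lambda>s. 1 / (lam * g s))"
    proof (intro continuous_intros)
      show "continuous_on {m..M} g"
        using g_continuous by (rule continuous_on_subset) (use mM(1) in auto)
      show "\<forall>s\<in>{m..M}. lam * g s \<noteq> 0"
        using g_pos lam mM(1) by (auto simp: less_imp_neq[symmetric])
    qed
    \<comment> \<open>A primitive of 1/(lam g): then z is the derivative of the periodic function
      H(u), hence of mean zero.\<close>
    define H where "H s = integral {m..s} (\<lambda>s. 1 / (lam * g s))" for s
    have "((\<lambda>t. H (u t)) has_real_derivative z t) (at t)" if "t \<in> {0..T}" for t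
    proof -
      have ut: "u t \<in> {m..M}" "u t \<in> {m<..<M}"
        using mM(2)[OF that] by auto
      have "(H has_real_derivative 1 / (lam * g (u t))) (at (u t) within {m..M})"
        unfolding H_def by (rule integral_has_real_derivative[OF inv_c ut(1)])
      then have "(H has_real_derivative 1 / (lam * g (u t))) (at (u t))"
        using ut(2) by (simp add: at_within_Icc_at)
      from DERIV_chain2[OF this u'[of t]] show ?thesis
        by (simp add: z_def \<psi>_def)
    qed
    then have "(z has_integral H (u T) - H (u 0)) {0..T}"
      using T_pos by (intro fundamental_theorem_of_calculus)
        (auto simp: has_real_derivative_iff_has_vector_derivative[symmetric] intro: has_field_derivative_at_within)
    then show ?thesis
      using uT[of 0] by simp
  qed
  show ?thesis
  proof (rule that[of z])
    show "periodic_with T z"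
      by (simp add: periodic_with_def z_def \<psi>_def vper uT)
    show "\<exists>t\<in>{0..T}. z t = 0"
      using t0 by (intro bexI[of _ t0]) (auto simp: z_def)
  qed (use zc g'uc pos zH zint expint in auto)
qed

text \<open>Integrating the Riccati equation over a period kills the boundary term, by periodicity
  of z, and the drift term, by its zero mean.\<close>

lemma solution_mean:
  assumes sol: "positive_periodic_solution T c lam a g u" and lam: "lam > 0"
  obtains z where "continuous_on UNIV z" "continuous_on UNIV (\<lambda>t. g' (u t))" "\<forall>t. u t > 0"
    "periodic_with T z" "\<exists>t\<in>{0..T}. z t = 0"
    "integral {0..T} a = - (lam * integral {0..T} (\<lambda>r. g' (u r) * (z r)\<^sup>2))"
    "\<forall>s t. s \<le> t \<longrightarrow> ((\<lambda>r. - c * z r - a r - lam * g' (u r) * (z r)\<^sup>2) has_integral z t - z s) {s..t}"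
    "\<forall>s t. s \<le> t \<longrightarrow> ((\<lambda>r. - (exp (c * r) * (a r + lam * g' (u r) * (z r)\<^sup>2)))
        has_integral exp (c * t) * z t - exp (c * s) * z s) {s..t}"
proof -
  obtain z where z: "continuous_on UNIV z" "continuous_on UNIV (\<lambda>t. g' (u t))" "\<forall>t. u t > 0"
    "periodic_with T z" "\<exists>t\<in>{0..T}. z t = 0" and z0: "(z has_integral 0) {0..T}"
    and zint: "\<forall>s t. s \<le> t \<longrightarrow> ((\<lambda>r. - c * z r - a r - lam * g' (u r) * (z r)\<^sup>2) has_integral z t - z s) {s..t}"
    and zexp: "\<forall>s t. s \<le> t \<longrightarrow> ((\<lambda>r. - (exp (c * r) * (a r + lam * g' (u r) * (z r)\<^sup>2)))
        has_integral exp (c * t) * z t - exp (c * s) * z s) {s..t}"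
    by (rule solution_riccati[OF assms], rule that, assumption+)
  have "(\<lambda>r. g' (u r) * (z r)\<^sup>2) integrable_on {0..T}"
    by (intro integrable_continuous_real continuous_intros continuous_on_subset[OF z(1)]
        continuous_on_subset[OF z(2)]) auto
  then have A: "((\<lambda>r. - c * z r - a r - lam * (g' (u r) * (z r)\<^sup>2)) has_integral
      - c * 0 - integral {0..T} a - lam * integral {0..T} (\<lambda>r. g' (u r) * (z r)\<^sup>2)) {0..T}"
    using a_int(1)[of 0 T] by (intro has_integral_diff has_integral_mult_right z0 integrable_integral)
  have B: "((\<lambda>r. - c * z r - a r - lam * (g' (u r) * (z r)\<^sup>2)) has_integral 0) {0..T}"
    using zint[rule_format, of 0 T] T_pos periodic_withD[OF z(4), of 0] by (simp add: mult.assoc)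
  have "integral {0..T} a = - (lam * integral {0..T} (\<lambda>r. g' (u r) * (z r)\<^sup>2))"
    using has_integral_unique[OF A B] by simp
  then show ?thesis
    by (intro that[of z] z zint zexp)
qed

text \<open>A continuation argument bounds z by a constant M independent of lam, starting from a
  zero of z: while |z| \<le> M, the integrated equation gives |z| < M. The mean identity then yields
  |mean| \<le> lam D M^2 T, which is too small.\<close>

theorem no_solution_small_parameter:
  assumes mean: "integral {0..T} a < 0"
  obtains lam0 where "lam0 > 0"
    "\<And>lam u. 0 < lam \<Longrightarrow> lam < lam0 \<Longrightarrow> \<not> positive_periodic_solution T c lam a g u"
proof -
  obtain D where D: "D > 0" "\<And>s. s \<ge> 0 \<Longrightarrow> \<bar>g' s\<bar> \<le> D"
    using g'_bounded by blast
  define a2 where "a2 = integral {0..2 * T} (\<lambda>r. \<bar>a r\<bar>)"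
  define E where "E = exp (\<bar>c\<bar> * (2 * T))"
  \<comment> \<open>One factor E bounds the integrating factor and one its inverse on [0, 2 T], the
    range reached within one period of a zero in [0, T]. The summand 1 leaves room for the quadratic
    term.\<close>
  define M where "M = E * E * (a2 + 1)"
  define \<alpha> where "\<alpha> = - integral {0..T} a"
  have a2: "a2 \<ge> 0"
    unfolding a2_def by (intro integral_nonneg a_int) auto
  have E: "E \<ge> 1"
    using T_pos by (simp add: E_def)
  have M: "M > 0"
    using a2 E by (simp add: M_def)
  have \<alpha>: "\<alpha> > 0"
    using mean by (simp add: \<alpha>_def)
  define lam0 where "lam0 = min 1 \<alpha> / (D * T * M\<^sup>2)"
  have lam0: "lam0 > 0"
    using D T_pos M \<alpha> by (simp add: lam0_def)
  have "\<not> positive_periodic_solution T c lam a g u" if lam: "0 < lam" "lam < lam0" for lam u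
  proof
    assume sol: "positive_periodic_solution T c lam a g u"
    have small: "lam * D * T * M\<^sup>2 < 1" "lam * D * T * M\<^sup>2 < \<alpha>"
    proof -
      have "lam * (D * T * M\<^sup>2) < min 1 \<alpha>"
        using lam(2) D T_pos M by (simp add: lam0_def field_simps)
      then show "lam * D * T * M\<^sup>2 < 1" "lam * D * T * M\<^sup>2 < \<alpha>"
        by (auto simp: mult.assoc)
    qed
    obtain z where zc: "continuous_on UNIV z" and g'uc: "continuous_on UNIV (\<lambda>t. g' (u t))"
      and pos: "\<forall>t. u t > 0" and zper: "periodic_with T z" and zero: "\<exists>t\<in>{0..T}. z t = 0"
      and avg: "integral {0..T} a = - (lam * integral {0..T} (\<lambda>r. g' (u r) * (z r)\<^sup>2))"
      and zexp: "\<forall>s t. s \<le> t \<longrightarrow> ((\<lambda>r. - (exp (c * r) * (a r + lam * g' (u r) * (z r)\<^sup>2)))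
        has_integral exp (c * t) * z t - exp (c * s) * z s) {s..t}"
      by (rule solution_mean[OF sol lam(1)], rule that, assumption+)
    obtain t0 where "t0 \<in> {0..T}" and zt0: "z t0 = 0"
      using zero by blast
    then have t0: "0 \<le> t0" "t0 \<le> T" "z t0 = 0"
      by auto
    have quad: "\<bar>g' (u r) * (z r)\<^sup>2\<bar> \<le> D * M\<^sup>2" if "\<bar>z r\<bar> \<le> M" for r
    proof -
      have "(z r)\<^sup>2 \<le> M\<^sup>2"
        using that M abs_le_square_iff[of "z r" M] by simp
      then show ?thesis
        unfolding abs_mult using D(2)[OF less_imp_le[OF pos[rule_format, of r]]] D(1) by (intro mult_mono) auto
    qed
    have expb: "exp (c * r) \<le> E" "exp (- (c * r)) \<le> E" if "0 \<le> r" "r \<le> 2 * T" for r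
    proof -
      have "\<bar>c * r\<bar> \<le> \<bar>c\<bar> * (2 * T)"
        unfolding abs_mult using that by (intro mult_left_mono) auto
      then show "exp (c * r) \<le> E" "exp (- (c * r)) \<le> E"
        by (auto simp: E_def)
    qed
    have step: "\<bar>z t\<bar> < M" if t: "t0 \<le> t" "t \<le> t0 + T" and zM: "\<And>r. r \<in> {t0..t} \<Longrightarrow> \<bar>z r\<bar> \<le> M" for t
    proof -
      let ?F = "\<lambda>r. - (exp (c * r) * (a r + lam * g' (u r) * (z r)\<^sup>2))"
      have F: "(?F has_integral exp (c * t) * z t) {t0..t}"
        using zexp[rule_format, OF t(1)] t0(3) by simp
      have G: "(\<lambda>r. E * (\<bar>a r\<bar> + lam * (D * M\<^sup>2))) integrable_on {t0..t}"
        by (intro integrable_on_mult_right integrable_add a_int(2)) auto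
      have "norm (integral {t0..t} ?F) \<le> integral {t0..t} (\<lambda>r. E * (\<bar>a r\<bar> + lam * (D * M\<^sup>2)))"
      proof (rule integral_norm_bound_integral)
        show "?F integrable_on {t0..t}"
          using F by blast
        fix r assume r: "r \<in> {t0..t}"
        have "\<bar>lam * (g' (u r) * (z r)\<^sup>2)\<bar> \<le> lam * (D * M\<^sup>2)"
          using quad[OF zM[OF r]] lam(1) by (simp add: abs_mult)
        then have "\<bar>a r + lam * g' (u r) * (z r)\<^sup>2\<bar> \<le> \<bar>a r\<bar> + lam * (D * M\<^sup>2)"
          by (simp add: mult.assoc)
        then show "norm (?F r) \<le> E * (\<bar>a r\<bar> + lam * (D * M\<^sup>2))"
          using expb(1)[of r] r t t0 E by (auto simp: abs_mult intro!: mult_mono)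
      qed (rule G)
      also have "\<dots> \<le> integral {0..2 * T} (\<lambda>r. E * (\<bar>a r\<bar>)) + E * lam * D * M\<^sup>2 * T"
      proof -
        have "integral {t0..t} (\<lambda>r. E * (\<bar>a r\<bar> + lam * (D * M\<^sup>2)))
            = integral {t0..t} (\<lambda>r. E * \<bar>a r\<bar>) + E * (lam * (D * M\<^sup>2)) * (t - t0)"
          unfolding distrib_left using t
          by (subst integral_add) (auto intro!: integrable_on_mult_right a_int(2) simp: mult_ac)
        moreover have "integral {t0..t} (\<lambda>r. E * \<bar>a r\<bar>) \<le> integral {0..2 * T} (\<lambda>r. E * \<bar>a r\<bar>)"
          using t t0 E by (intro integral_subset_le integrable_on_mult_right a_int(2)) auto
        moreover have "E * (lam * (D * M\<^sup>2)) * (t - t0) \<le> E * (lam * (D * M\<^sup>2)) * T"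
          using t E lam D by (intro mult_left_mono) auto
        ultimately show ?thesis
          by (simp add: mult_ac)
      qed
      also have "\<dots> = E * (a2 + lam * D * T * M\<^sup>2)"
        by (simp add: a2_def algebra_simps)
      also have "\<dots> < E * (a2 + 1)"
        using small E by simp
      finally have "\<bar>exp (c * t) * z t\<bar> < E * (a2 + 1)"
        unfolding integral_unique[OF F] real_norm_def .
      then have "exp (- (c * t)) * \<bar>exp (c * t) * z t\<bar> < exp (- (c * t)) * (E * (a2 + 1))"
        by simp
      also have "\<dots> \<le> E * (E * (a2 + 1))"
        using expb(2)[of t] t t0 E a2 by (intro mult_right_mono) auto
      finally show ?thesis
        by (simp add: M_def abs_mult exp_minus field_simps)
    qed
    have zM: "\<bar>z t\<bar> < M" if t: "t0 \<le> t" "t \<le> t0 + T" for t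
    proof (rule ccontr)
      assume "\<not> \<bar>z t\<bar> < M"
      \<comment> \<open>The infimum of S is the first time at which |z| reaches M. Up to it |z|
        \<le> M holds, so \<open>step\<close> gives a strict inequality exactly there.\<close>
      define S where "S = {r \<in> {t0..t}. M \<le> \<bar>z r\<bar>}"
      have "closed {r. M \<le> \<bar>z r\<bar>}"
        by (intro closed_Collect_le continuous_on_const continuous_on_rabs zc)
      moreover have "S = {t0..t} \<inter> {r. M \<le> \<bar>z r\<bar>}"
        by (auto simp: S_def)
      ultimately have "closed S"
        by (simp add: closed_Int)
      moreover have S: "S \<noteq> {}" "bdd_below S"
        using \<open>\<not> \<bar>z t\<bar> < M\<close> t by (auto simp: S_def)
      ultimately have Inf: "Inf S \<in> S"
        by (intro closed_contains_Inf)
      define t1 where "t1 = Inf S"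
      have t1: "t0 \<le> t1" "t1 \<le> t" "M \<le> \<bar>z t1\<bar>"
        using Inf by (auto simp: S_def t1_def)
      have before: "\<bar>z r\<bar> < M" if "t0 \<le> r" "r < t1" for r
      proof (rule ccontr)
        assume "\<not> \<bar>z r\<bar> < M"
        then have "r \<in> S"
          using that t1 by (auto simp: S_def)
        then show False
          using cInf_lower[OF _ S(2), of r] that by (auto simp: t1_def)
      qed
      have "\<bar>z t1\<bar> \<le> M"
      proof (rule ccontr)
        assume gt: "\<not> \<bar>z t1\<bar> \<le> M"
        have "continuous_on {t0..t1} (\<lambda>r. \<bar>z r\<bar>)"
          by (intro continuous_intros continuous_on_subset[OF zc]) auto
        then obtain r where "t0 \<le> r" "r \<le> t1" "\<bar>z r\<bar> = M"
          using IVT'[of "\<lambda>r. \<bar>z r\<bar>" t0 M t1] t0(3) M gt t1(1) by auto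
        then show False
          using before[of r] gt by (cases "r = t1") auto
      qed
      then have "\<And>r. r \<in> {t0..t1} \<Longrightarrow> \<bar>z r\<bar> \<le> M"
        using before by (metis atLeastAtMost_iff less_eq_real_def)
      then show False
        using step[of t1] t1 t by auto
    qed
    have zM': "\<bar>z t\<bar> \<le> M" if "t \<in> {0..T}" for t
      using zM[of t] zM[of "t + T"] periodic_withD[OF zper, of t] that t0 by (cases "t0 \<le> t") auto
    have "continuous_on {0..T} (\<lambda>r. g' (u r) * (z r)\<^sup>2)"
      by (intro continuous_intros continuous_on_subset[OF zc] continuous_on_subset[OF g'uc]) auto
    from integral_bound[OF less_imp_le[OF T_pos] this, of "D * M\<^sup>2"]
    have "\<bar>integral {0..T} (\<lambda>r. g' (u r) * (z r)\<^sup>2)\<bar> \<le> D * M\<^sup>2 * T"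
      using quad[OF zM'] by simp
    then have "lam * integral {0..T} (\<lambda>r. g' (u r) * (z r)\<^sup>2) \<le> lam * (D * M\<^sup>2 * T)"
      using lam(1) by (intro mult_left_mono) auto
    then show False
      using avg small(2) by (simp add: \<alpha>_def mult_ac)
  qed
  then show ?thesis
    using that[OF lam0] by blast
qed

text \<open>The mean identity gives the weak inequality, as g'(u) z^2 \<ge> 0. In case of equality
  continuity forces z = 0 on the period, and the Riccati equation would make \<open>a\<close>
  integrate to 0 over [s, t].\<close>

theorem mean_negative_of_solution:
  assumes sol: "positive_periodic_solution T c lam a g u" and lam: "lam > 0"
    and mono: "\<And>s. s > 0 \<Longrightarrow> g' s > 0"
    and nontriv: "integral {s..t} a \<noteq> 0" "0 \<le> s" "s \<le> t" "t \<le> T"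
  shows "integral {0..T} a < 0"
proof -
  obtain z where zc: "continuous_on UNIV z" and g'uc: "continuous_on UNIV (\<lambda>t. g' (u t))"
    and pos: "\<forall>t. u t > 0"
    and avg: "integral {0..T} a = - (lam * integral {0..T} (\<lambda>r. g' (u r) * (z r)\<^sup>2))"
    and zint: "\<forall>s t. s \<le> t \<longrightarrow> ((\<lambda>r. - c * z r - a r - lam * g' (u r) * (z r)\<^sup>2) has_integral z t - z s) {s..t}"
    by (rule solution_mean[OF sol lam], rule that, assumption+)
  have cont: "continuous_on {0..T} (\<lambda>r. g' (u r) * (z r)\<^sup>2)"
    by (intro continuous_intros continuous_on_subset[OF zc] continuous_on_subset[OF g'uc]) auto
  have nonneg: "0 \<le> g' (u r) * (z r)\<^sup>2" for r
    using mono[OF pos[rule_format, of r]] by simp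
  have "integral {0..T} (\<lambda>r. g' (u r) * (z r)\<^sup>2) \<ge> 0"
    using nonneg cont by (intro integral_nonneg integrable_continuous_real) auto
  moreover have "integral {0..T} (\<lambda>r. g' (u r) * (z r)\<^sup>2) \<noteq> 0"
  proof
    assume "integral {0..T} (\<lambda>r. g' (u r) * (z r)\<^sup>2) = 0"
    then have "\<forall>r\<in>{0..T}. g' (u r) * (z r)\<^sup>2 = 0"
      using integral_eq_0_iff[OF cont T_pos] nonneg by simp
    then have z0: "z r = 0" if "r \<in> {0..T}" for r
      using mono[OF pos[rule_format, of r]] that by force
    have "((\<lambda>r. - c * z r - a r - lam * g' (u r) * (z r)\<^sup>2) has_integral 0) {s..t}"
      using zint[rule_format, OF nontriv(3)] z0[of s] z0[of t] nontriv by simp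
    then have "((\<lambda>r. - a r) has_integral 0) {s..t}"
      by (rule has_integral_eq[rotated]) (use z0 nontriv in auto)
    from has_integral_neg[OF this] have "(a has_integral 0) {s..t}"
      by simp
    then show False
      using nontriv(1) by (simp add: integral_unique)
  qed
  ultimately show ?thesis
    using avg lam by (simp add: less_le)
qed

end

section \<open>Limits of discrete solutions\<close>

lemma floor_cell:
  fixes h r :: real
  assumes "h > 0"
  shows "of_int \<lfloor>r / h\<rfloor> * h \<le> r" "r < (of_int \<lfloor>r / h\<rfloor> + 1) * h"
proof -
  show "of_int \<lfloor>r / h\<rfloor> * h \<le> r"
    using assms floor_divide_lower[of h r] by simp
  show "r < (of_int \<lfloor>r / h\<rfloor> + 1) * h"
    using assms floor_divide_upper[of h r] by simp
qed

text \<open>Turns sums weighted by cell masses into integrals of f against a step function. The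
  right endpoint of a cell belongs to the next one, hence the spike in the proof.\<close>

lemma has_integral_step_product:
  fixes f :: "real \<Rightarrow> real" and s :: "int \<Rightarrow> real"
  assumes h: "h > 0" and f: "\<And>x y. f integrable_on {x..y}" and ij: "i \<le> j"
  shows "((\<lambda>r. f r * s \<lfloor>r / h\<rfloor>) has_integral
    (\<Sum>k\<in>{i..<j}. s k * integral {of_int k * h..(of_int k + 1) * h} f)) {of_int i * h..of_int j * h}"
  using ij
proof (induction rule: int_ge_induct)
  case base
  then show ?case
    by (simp add: has_integral_refl)
next
  case (step j)
  let ?c = "integral {of_int j * h..(of_int j + 1) * h} f"
  have "((\<lambda>r. f r * s j) has_integral ?c * s j) {of_int j * h..(of_int j + 1) * h}"
    using f by (intro has_integral_mult_left integrable_integral)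
  then have "((\<lambda>r. f r * s \<lfloor>r / h\<rfloor>) has_integral ?c * s j) {of_int j * h..(of_int j + 1) * h}"
  proof (rule has_integral_spike[rotated 2])
    show "negligible {(of_int j + 1) * h}"
      by simp
    fix r assume r: "r \<in> {of_int j * h..(of_int j + 1) * h} - {(of_int j + 1) * h}"
    then have "\<lfloor>r / h\<rfloor> = j"
      using h by (auto simp: floor_eq_iff field_simps)
    then show "f r * s \<lfloor>r / h\<rfloor> = f r * s j"
      by simp
  qed
  moreover have "of_int i * h \<le> of_int j * h" "of_int j * h \<le> (of_int j + 1) * h"
    using step h by (auto simp: mult_right_mono)
  ultimately have "((\<lambda>r. f r * s \<lfloor>r / h\<rfloor>) has_integral
    (\<Sum>k\<in>{i..<j}. s k * integral {of_int k * h..(of_int k + 1) * h} f) + ?c * s j)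
    {of_int i * h..(of_int j + 1) * h}"
    using step.IH by (intro has_integral_combine[of _ "of_int j * h"])
  moreover have "{i..<j + 1} = insert j {i..<j}"
    using step.hyps by auto
  ultimately show ?case
    by (simp add: add.commute mult.commute)
qed

lemma integral_shrinking_left:
  fixes f :: "real \<Rightarrow> real"
  assumes f: "\<And>x y. f integrable_on {x..y}" and x: "x \<longlonglongrightarrow> s" "\<And>n. x n \<le> s"
  shows "(\<lambda>n. integral {x n..s} f) \<longlonglongrightarrow> 0"
proof -
  have ev: "\<forall>\<^sub>F n in sequentially. x n > s - 1"
    using x(1) by (rule order_tendstoD) simp
  have cont: "continuous_on {s - 1..s} (\<lambda>t. integral {s - 1..t} f)"
    by (rule indefinite_integral_continuous_1[OF f])
  have "(\<lambda>n. integral {s - 1..x n} f) \<longlonglongrightarrow> integral {s - 1..s} f"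
  proof (rule continuous_on_tendsto_compose[OF cont x(1)])
    show "\<forall>\<^sub>F n in sequentially. x n \<in> {s - 1..s}"
      using ev x(2) by (auto elim: eventually_mono)
  qed simp
  then have "(\<lambda>n. integral {s - 1..s} f - integral {s - 1..x n} f) \<longlonglongrightarrow> integral {s - 1..s} f - integral {s - 1..s} f"
    by (intro tendsto_intros)
  moreover have "\<forall>\<^sub>F n in sequentially. integral {s - 1..s} f - integral {s - 1..x n} f = integral {x n..s} f"
    using ev
  proof eventually_elim
    case (elim n)
    then show ?case
      using Henstock_Kurzweil_Integration.integral_combine[of "s - 1" "x n" s f] f x(2)[of n] by auto
  qed
  ultimately show ?thesis
    by (simp add: tendsto_cong)
qed

lemma floor_mult_tendsto:
  fixes h :: "nat \<Rightarrow> real"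
  assumes h: "\<And>n. h n > 0" "h \<longlonglongrightarrow> 0"
  shows "(\<lambda>n. of_int \<lfloor>t / h n\<rfloor> * h n) \<longlonglongrightarrow> t"
proof (rule tendsto_sandwich)
  show "\<forall>\<^sub>F n in sequentially. t - h n \<le> of_int \<lfloor>t / h n\<rfloor> * h n"
  proof (intro always_eventually allI)
    fix n
    show "t - h n \<le> of_int \<lfloor>t / h n\<rfloor> * h n"
      using floor_cell(2)[OF h(1)[of n], of t] by (simp add: distrib_right)
  qed
  show "\<forall>\<^sub>F n in sequentially. of_int \<lfloor>t / h n\<rfloor> * h n \<le> t"
    using floor_cell(1)[OF h(1)] by simp
  show "(\<lambda>n. t - h n) \<longlonglongrightarrow> t"
    using tendsto_diff[OF tendsto_const h(2), of t] by simp
qed simp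

text \<open>As f is merely integrable, the weights are exact integrals over cells. The sum is then
  exactly an integral of f times a step function between grid points; dominated convergence with
  majorant G |f| applies, and the pieces between s, t and the grid points to their left
  vanish.\<close>

lemma step_sum_tendsto_integral:
  fixes f \<phi> :: "real \<Rightarrow> real" and S :: "nat \<Rightarrow> int \<Rightarrow> real"
  assumes h: "\<And>n. h n > 0" "h \<longlonglongrightarrow> 0" and f: "\<And>x y. f absolutely_integrable_on {x..y}"
    and st: "s \<le> t" and G: "\<And>n k. \<bar>S n k\<bar> \<le> G"
    and conv: "\<And>r. (\<lambda>n. S n \<lfloor>r / h n\<rfloor>) \<longlonglongrightarrow> \<phi> r"
  shows "(\<lambda>r. f r * \<phi> r) integrable_on {s..t}"
    "(\<lambda>n. \<Sum>k\<in>{\<lfloor>s / h n\<rfloor>..<\<lfloor>t / h n\<rfloor>}. S n k * integral {of_int k * h n..(of_int k + 1) * h n} f)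
      \<longlonglongrightarrow> integral {s..t} (\<lambda>r. f r * \<phi> r)"
proof -
  have f1: "f integrable_on {x..y}" and f2: "(\<lambda>r. \<bar>f r\<bar>) integrable_on {x..y}" for x y
    using f[of x y] by (auto simp: absolutely_integrable_on_def)
  define F where "F n r = f r * S n \<lfloor>r / h n\<rfloor>" for n r
  define i j where "i n = \<lfloor>s / h n\<rfloor>" and "j n = \<lfloor>t / h n\<rfloor>" for n
  have ij: "i n \<le> j n" for n
    using st h(1)[of n] by (auto simp: i_def j_def intro!: floor_mono divide_right_mono)
  have Fbound: "\<bar>F n r\<bar> \<le> G * \<bar>f r\<bar>" for n r
    using mult_right_mono[OF G[of n "\<lfloor>r / h n\<rfloor>"], of "\<bar>f r\<bar>"] by (simp add: F_def abs_mult mult.commute)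
  have Fint: "F n integrable_on {x..y}" for n x y
  proof -
    have "F n integrable_on {of_int \<lfloor>x / h n\<rfloor> * h n..of_int (max \<lfloor>x / h n\<rfloor> (\<lfloor>y / h n\<rfloor> + 1)) * h n}"
      unfolding F_def using has_integral_step_product[OF h(1)[of n] f1, where i = "\<lfloor>x / h n\<rfloor>"
          and j = "max \<lfloor>x / h n\<rfloor> (\<lfloor>y / h n\<rfloor> + 1)" and s = "S n"]
      by (meson has_integral_integrable max.cobounded1)
    moreover have "y \<le> of_int (max \<lfloor>x / h n\<rfloor> (\<lfloor>y / h n\<rfloor> + 1)) * h n"
    proof -
      have "y \<le> of_int (\<lfloor>y / h n\<rfloor> + 1) * h n"
        using floor_cell(2)[OF h(1)[of n], of y] by simp
      also have "\<dots> \<le> of_int (max \<lfloor>x / h n\<rfloor> (\<lfloor>y / h n\<rfloor> + 1)) * h n"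
        using h(1)[of n] by (intro mult_right_mono) (simp_all only: of_int_le_iff max.cobounded2 less_imp_le)
      finally show ?thesis .
    qed
    ultimately show ?thesis
      by (elim integrable_subinterval_real) (use floor_cell(1)[OF h(1)[of n], of x] in auto)
  qed
  have dom: "(\<lambda>r. G * \<bar>f r\<bar>) integrable_on {s..t}"
    by (intro integrable_on_mult_right f2)
  have lim: "(\<lambda>n. F n r) \<longlonglongrightarrow> f r * \<phi> r" for r
    unfolding F_def by (intro tendsto_intros conv)
  show "(\<lambda>r. f r * \<phi> r) integrable_on {s..t}"
    by (rule dominated_convergence(1)[OF Fint dom]) (use Fbound lim in auto)
  have main: "(\<lambda>n. integral {s..t} (F n)) \<longlonglongrightarrow> integral {s..t} (\<lambda>r. f r * \<phi> r)"
    by (rule dominated_convergence(2)[OF Fint dom]) (use Fbound lim in auto)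
  have edge: "(\<lambda>n. integral {of_int \<lfloor>x / h n\<rfloor> * h n..x} (F n)) \<longlonglongrightarrow> 0" for x
  proof (rule tendsto_rabs_zero_cancel, rule tendsto_sandwich[of "\<lambda>_. 0"])
    show "\<forall>\<^sub>F n in sequentially. \<bar>integral {of_int \<lfloor>x / h n\<rfloor> * h n..x} (F n)\<bar>
        \<le> G * integral {of_int \<lfloor>x / h n\<rfloor> * h n..x} (\<lambda>r. \<bar>f r\<bar>)"
    proof (intro always_eventually allI)
      fix n
      have "norm (integral {of_int \<lfloor>x / h n\<rfloor> * h n..x} (F n))
          \<le> integral {of_int \<lfloor>x / h n\<rfloor> * h n..x} (\<lambda>r. G * \<bar>f r\<bar>)"
        using Fbound by (intro integral_norm_bound_integral Fint integrable_on_mult_right f2) auto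
      then show "\<bar>integral {of_int \<lfloor>x / h n\<rfloor> * h n..x} (F n)\<bar>
          \<le> G * integral {of_int \<lfloor>x / h n\<rfloor> * h n..x} (\<lambda>r. \<bar>f r\<bar>)"
        by simp
    qed
    have "(\<lambda>n. integral {of_int \<lfloor>x / h n\<rfloor> * h n..x} (\<lambda>r. \<bar>f r\<bar>)) \<longlonglongrightarrow> 0"
      by (rule integral_shrinking_left[OF f2 floor_mult_tendsto[OF h]]) (rule floor_cell(1)[OF h(1)])
    from tendsto_mult_right_zero[OF this, of G]
    show "(\<lambda>n. G * integral {of_int \<lfloor>x / h n\<rfloor> * h n..x} (\<lambda>r. \<bar>f r\<bar>)) \<longlonglongrightarrow> 0" .
  qed auto
  have split: "(\<Sum>k\<in>{i n..<j n}. S n k * integral {of_int k * h n..(of_int k + 1) * h n} f)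
      = integral {of_int (i n) * h n..s} (F n) + integral {s..t} (F n) - integral {of_int (j n) * h n..t} (F n)" for n
  proof -
    have le: "of_int (i n) * h n \<le> of_int (j n) * h n" "of_int (j n) * h n \<le> t" "of_int (i n) * h n \<le> s"
      using ij[of n] h(1)[of n] floor_cell(1)[OF h(1)[of n], of t] floor_cell(1)[OF h(1)[of n], of s]
      by (auto simp: i_def j_def mult_right_mono)
    have "integral {of_int (i n) * h n..of_int (j n) * h n} (F n)
        = (\<Sum>k\<in>{i n..<j n}. S n k * integral {of_int k * h n..(of_int k + 1) * h n} f)"
      unfolding F_def by (rule integral_unique[OF has_integral_step_product[OF h(1) f1 ij]])
    moreover have "integral {of_int (i n) * h n..of_int (j n) * h n} (F n) + integral {of_int (j n) * h n..t} (F n)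
        = integral {of_int (i n) * h n..t} (F n)"
      by (rule Henstock_Kurzweil_Integration.integral_combine[OF le(1,2) Fint])
    moreover have "integral {of_int (i n) * h n..s} (F n) + integral {s..t} (F n) = integral {of_int (i n) * h n..t} (F n)"
      by (rule Henstock_Kurzweil_Integration.integral_combine[OF le(3) st Fint])
    ultimately show ?thesis
      by linarith
  qed
  have "(\<lambda>n. integral {of_int (i n) * h n..s} (F n) + integral {s..t} (F n) - integral {of_int (j n) * h n..t} (F n))
      \<longlonglongrightarrow> 0 + integral {s..t} (\<lambda>r. f r * \<phi> r) - 0"
    unfolding i_def j_def by (intro tendsto_intros edge main)
  then show "(\<lambda>n. \<Sum>k\<in>{\<lfloor>s / h n\<rfloor>..<\<lfloor>t / h n\<rfloor>}. S n k * integral {of_int k * h n..(of_int k + 1) * h n} f)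
      \<longlonglongrightarrow> integral {s..t} (\<lambda>r. f r * \<phi> r)"
    unfolding split[symmetric] by (simp add: i_def j_def)
qed

context indefinite_equation
begin

text \<open>Positivity: a nonnegative solution is determined near a zero by the integrated equation, with a Lipschitz
  constant that is uniform along the line, so a zero propagates to the right by fixed steps and
  then, by periodicity, everywhere.\<close>

lemma limit_is_solution:
  assumes u': "\<And>t. (u has_real_derivative v t) (at t)" and u0: "\<And>t. u t \<ge> 0" and per: "periodic_with T u"
    and lam: "lam > 0" and agu: "\<And>s t. s \<le> t \<Longrightarrow> (\<lambda>r. a r * g (u r)) integrable_on {s..t}"
    and eq: "\<And>s t. s \<le> t \<Longrightarrow> v t - v s = - c * (u t - u s) - lam * integral {s..t} (\<lambda>r. a r * g (u r))"
    and nz: "u \<tau> \<noteq> 0"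
  shows "positive_periodic_solution T c lam a g u"
proof -
  have uc: "continuous_on UNIV u"
    using u' by (meson DERIV_isCont continuous_at_imp_continuous_on)
  have guc: "continuous_on {s..t} (\<lambda>r. g (u r))" for s t
    by (rule continuous_on_compose2[OF g_continuous continuous_on_subset[OF uc]]) (use u0 in auto)
  have vint: "(v has_integral u t - u s) {s..t}" if "s \<le> t" for s t
    by (rule fundamental_theorem_of_calculus[OF that])
      (use u' in \<open>auto simp: has_real_derivative_iff_has_vector_derivative[symmetric] intro: has_field_derivative_at_within\<close>)
  define q where "q r = - c * v r - lam * (a r * g (u r))" for r
  have qint: "(q has_integral v t - v s) {s..t}" if "s \<le> t" for s t
    unfolding q_def eq[OF that]
    using that by (intro has_integral_diff has_integral_mult_right vint integrable_integral agu)
  have agu_abs: "(\<lambda>r. a r * g (u r)) absolutely_integrable_on {s..t}" for s t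
  proof -
    have "(\<lambda>r. g (u r) * a r) absolutely_integrable_on {s..t}"
    proof (rule absolutely_integrable_bounded_measurable_product_real)
      show "(\<lambda>r. g (u r)) \<in> borel_measurable (lebesgue_on {s..t})"
        by (rule continuous_imp_measurable_on_sets_lebesgue[OF guc]) simp
      show "bounded ((\<lambda>r. g (u r)) ` {s..t})"
        by (intro compact_imp_bounded compact_continuous_image guc) simp
    qed (use a_abs_int in auto)
    then show ?thesis
      by (simp add: mult.commute)
  qed
  have vc: "continuous_on UNIV v"
  proof (intro continuous_at_imp_continuous_on ballI)
    fix t
    have "continuous_on {t - 1..t + 1} (\<lambda>x. v (t - 1) + integral {t - 1..x} q)"
      by (intro continuous_intros indefinite_integral_continuous_1) (use qint[of "t - 1" "t + 1"] in auto)
    moreover have "v (t - 1) + integral {t - 1..x} q = v x" if "x \<in> {t - 1..t + 1}" for x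
      using integral_unique[OF qint[of "t - 1" x]] that by simp
    ultimately have "continuous_on {t - 1..t + 1} v"
      by (rule continuous_on_eq)
    then show "isCont v t"
      by (rule continuous_on_interior) simp
  qed
  have q_abs: "q absolutely_integrable_on {s..t}" for s t
    unfolding q_def
    by (intro set_integral_diff(1) absolutely_integrable_continuous_real continuous_intros continuous_on_subset[OF vc]
        set_integrable_mult_right agu_abs) auto
  have "locally_abs_cont v"
    unfolding locally_abs_cont_def
  proof (intro allI impI)
    fix x y :: real
    show "abs_cont_on v x y"
      by (rule abs_cont_on_indefinite_integral[OF q_abs qint])
  qed
  moreover have "AE t in lebesgue. \<exists>w. (v has_real_derivative w) (at t) \<and> w + c * v t + lam * a t * g (u t) = 0"
  proof -
    obtain N where N: "negligible N" "\<And>t. t \<notin> N \<Longrightarrow> (v has_real_derivative q t) (at t)"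
      by (rule indefinite_integral_deriv_ae[OF qint], assumption, erule that, simp)
    show ?thesis
    proof (rule negligible_AE_lebesgue[OF N(1)])
      fix t assume "t \<notin> N"
      then show "\<exists>w. (v has_real_derivative w) (at t) \<and> w + c * v t + lam * a t * g (u t) = 0"
        using N(2)[of t] by (intro exI[of _ "q t"]) (simp add: q_def)
    qed
  qed
  ultimately have "caratheodory_solution c lam a g u"
    unfolding caratheodory_solution_def using u' vc by blast
  moreover have "u t > 0" for t
  proof (rule ccontr)
    assume "\<not> u t > 0"
    then have ut: "u t = 0"
      using u0[of t] by linarith
    obtain D where D: "D > 0" "\<And>s. s \<ge> 0 \<Longrightarrow> \<bar>g' s\<bar> \<le> D"
      using g'_bounded by blast
    have gle: "\<bar>g x\<bar> \<le> D * x" if "x \<ge> 0" for x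
    proof -
      have "\<bar>g x - g 0\<bar> \<le> D * \<bar>x - 0\<bar>"
        by (rule g_diff_le) (use D(2) that in auto)
      then show ?thesis
        using that g_zero by simp
    qed
    have per_n: "u (x + real n * T) = u x" for x n
    proof (induction n)
      case (Suc n)
      have "u (x + real (Suc n) * T) = u ((x + real n * T) + T)"
        by (simp add: algebra_simps)
      then show ?case
        using Suc periodic_withD[OF per] by simp
    qed simp
    obtain n0 where n0: "real n0 * T \<ge> t - \<tau>"
      using T_pos reals_Archimedean3[of T] less_imp_le by (metis mult.commute)
    \<comment> \<open>A translate of \<tau> by whole periods to the right of t, so that propagating
      the zero to the right must reach it.\<close>
    define tau where "tau = \<tau> + real n0 * T"
    have tau: "t \<le> tau" "u tau \<noteq> 0"
      using n0 nz per_n[of \<tau> n0] by (auto simp: tau_def)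
    define a2 where "a2 = integral {t..tau + 1} (\<lambda>r. \<bar>a r\<bar>)"
    have a2: "a2 \<ge> 0"
      unfolding a2_def by (intro integral_nonneg a_int) auto
    define k where "k = \<bar>c\<bar> + lam * D * a2"
    have k: "k \<ge> 0"
      using lam D a2 by (simp add: k_def)
    \<comment> \<open>\<open>d \<le> 1\<close> keeps [x, x + d] inside the interval on which
      \<open>a2\<close> was computed, and \<open>d * k < 1\<close> makes the estimate a
      contraction.\<close>
    define d where "d = 1 / (k + 2)"
    have d: "d > 0" "d \<le> 1" "d * k < 1"
      using k by (auto simp: d_def field_simps)
    have propagate: "\<forall>y\<in>{x..x + d}. u y = 0" if x: "t \<le> x" "x \<le> tau" "u x = 0" for x
    proof -
      \<comment> \<open>A zero of a nonnegative function is a minimum, so both Cauchy data vanish.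
        The maximum u y over [x, x + d] is then at most d k times itself.\<close>
      have vx: "v x = 0"
        by (rule DERIV_local_min[OF u'[of x], of 1]) (use u0 x(3) in auto)
      obtain y where y: "y \<in> {x..x + d}" "\<And>r. r \<in> {x..x + d} \<Longrightarrow> u r \<le> u y"
        using continuous_attains_sup[of "{x..x + d}" u] continuous_on_subset[OF uc] d by force
      have vb: "\<bar>v r\<bar> \<le> k * u y" if r: "r \<in> {x..x + d}" for r
      proof -
        have "norm (integral {x..r} (\<lambda>r. a r * g (u r))) \<le> integral {x..r} (\<lambda>r. (D * u y) * \<bar>a r\<bar>)"
        proof (intro integral_norm_bound_integral agu integrable_on_mult_right a_int(2))
          fix z assume z: "z \<in> {x..r}"
          have "D * u z \<le> D * u y"
            using y(2)[of z] z r D(1) by (intro mult_left_mono) auto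
          then have "\<bar>g (u z)\<bar> \<le> D * u y"
            using gle[OF u0[of z]] by linarith
          then show "norm (a z * g (u z)) \<le> D * u y * \<bar>a z\<bar>"
            by (simp add: abs_mult mult.commute mult_left_mono)
        qed (use r in auto)
        also have "\<dots> = (D * u y) * integral {x..r} (\<lambda>r. \<bar>a r\<bar>)"
          by simp
        also have "\<dots> \<le> (D * u y) * a2"
          unfolding a2_def using r x d D u0[of y]
          by (intro mult_left_mono integral_subset_le a_int(2)) auto
        finally have "lam * \<bar>integral {x..r} (\<lambda>r. a r * g (u r))\<bar> \<le> lam * (D * u y * a2)"
          using lam by simp
        moreover have "\<bar>c * u r\<bar> \<le> \<bar>c\<bar> * u y"
          using y(2)[OF r] u0[of r] by (simp add: abs_mult mult_left_mono)
        moreover have "v r = - (c * u r) - lam * integral {x..r} (\<lambda>r. a r * g (u r))"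
          using eq[of x r] r vx x(3) by simp
        moreover have "\<bar>lam * integral {x..r} (\<lambda>r. a r * g (u r))\<bar> = lam * \<bar>integral {x..r} (\<lambda>r. a r * g (u r))\<bar>"
          using lam by (simp add: abs_mult)
        ultimately have "\<bar>v r\<bar> \<le> \<bar>c\<bar> * u y + lam * (D * u y * a2)"
          by linarith
        then show ?thesis
          by (simp add: k_def algebra_simps)
      qed
      have "\<bar>u y - u x\<bar> \<le> k * u y * \<bar>y - x\<bar>"
        by (rule field_differentiable_bound[of "{x..x + d}" u v "k * u y" y x, simplified real_norm_def])
          (use vb y d u' in \<open>auto intro: has_field_derivative_at_within\<close>)
      also have "\<dots> \<le> k * u y * d"
        using y(1) k u0[of y] by (intro mult_left_mono) auto
      finally have "u y * (1 - d * k) \<le> 0"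
        using u0[of y] x(3) by (simp add: algebra_simps)
      then have "u y \<le> 0"
        using d(3) by (simp add: mult_le_0_iff)
      then show ?thesis
        using y(2) u0 by (meson order_antisym order_trans)
    qed
    have "\<forall>y\<in>{t..min tau (t + real n * d)}. u y = 0" for n
    proof (induction n)
      case 0
      then show ?case
        using ut tau by auto
    next
      case (Suc n)
      show ?case
      proof
        fix y assume y: "y \<in> {t..min tau (t + real (Suc n) * d)}"
        show "u y = 0"
        proof (cases "y \<le> t + real n * d")
          case True
          then show ?thesis
            using Suc y by auto
        next
          case False
          define x where "x = t + real n * d"
          have "u x = 0"
            using Suc y False d tau by (auto simp: x_def)
          moreover have "y \<in> {x..x + d}" "t \<le> x" "x \<le> tau"
            using y False d by (auto simp: x_def algebra_simps)
          ultimately show ?thesis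
            using propagate[of x] by blast
        qed
      qed
    qed
    moreover obtain n where "real n * d \<ge> tau - t"
      using reals_Archimedean3[OF d(1)] less_imp_le by (metis mult.commute)
    ultimately have "u tau = 0"
      using tau(1) by (metis atLeastAtMost_iff diff_le_eq add.commute min.absorb1 order_refl)
    then show False
      using tau(2) by simp
  qed
  ultimately show ?thesis
    using per by (simp add: positive_periodic_solution_def)
qed

end

section \<open>Uniform slope bounds and compactness of discrete solutions\<close>

lemma int_telescope:
  fixes f :: "int \<Rightarrow> real"
  assumes "i \<le> j"
  shows "(\<Sum>k\<in>{i..<j}. f (k + 1) - f k) = f j - f i"
  using assms
proof (induction rule: int_ge_induct)
  case (step j)
  have "{i..<j + 1} = insert j {i..<j}"
    using step.hyps by auto
  then show ?case
    using step.IH by simp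
qed simp

lemma periodic_int_mod:
  fixes f :: "int \<Rightarrow> 'a"
  assumes "\<And>k. f (k + N) = f k"
  shows "f (k mod N) = f k"
proof -
  have up: "f (k + int m * N) = f k" for k m
  proof (induction m)
    case (Suc m)
    have "f (k + int (Suc m) * N) = f ((k + int m * N) + N)"
      by (simp add: algebra_simps)
    then show ?case
      using Suc assms by simp
  qed simp
  show ?thesis
  proof (cases "k div N \<ge> 0")
    case True
    then have "k = k mod N + int (nat (k div N)) * N"
      by simp
    then show ?thesis
      using up by metis
  next
    case False
    then have "k mod N = k + int (nat (- (k div N))) * N"
      by (simp add: minus_div_mult_eq_mod[symmetric])
    then show ?thesis
      using up by metis
  qed
qed

lemma floor_diff_le:
  fixes x y :: real
  shows "\<bar>of_int (\<lfloor>x\<rfloor> - \<lfloor>y\<rfloor>)\<bar> \<le> \<bar>x - y\<bar> + 1"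
  using floor_correct[of x] floor_correct[of y] by simp linarith

context indefinite_equation
begin

text \<open>Cell masses instead of point values, because a is only locally integrable.\<close>

definition cell :: "real \<Rightarrow> int \<Rightarrow> real" where
  "cell h k = integral {of_int k * h..(of_int k + 1) * h} a"

lemma cell_sums:
  assumes N: "N > 0" and h: "h = T / real N"
  shows "\<bar>cell h k\<bar> \<le> integral {of_int k * h..(of_int k + 1) * h} (\<lambda>r. \<bar>a r\<bar>)"
    "(\<Sum>k\<in>{0..<int N}. integral {of_int k * h..(of_int k + 1) * h} (\<lambda>r. \<bar>a r\<bar>)) = integral {0..T} (\<lambda>r. \<bar>a r\<bar>)"
    "(\<Sum>k\<in>{0..<int N}. cell h k) = integral {0..T} a"
proof -
  have hp: "h > 0" "real N * h = T"
    using N T_pos by (auto simp: h)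
  have "norm (integral {of_int k * h..(of_int k + 1) * h} a) \<le> integral {of_int k * h..(of_int k + 1) * h} (\<lambda>r. \<bar>a r\<bar>)"
    by (intro integral_norm_bound_integral a_int) auto
  then show "\<bar>cell h k\<bar> \<le> integral {of_int k * h..(of_int k + 1) * h} (\<lambda>r. \<bar>a r\<bar>)"
    by (simp add: cell_def)
  show "(\<Sum>k\<in>{0..<int N}. integral {of_int k * h..(of_int k + 1) * h} (\<lambda>r. \<bar>a r\<bar>)) = integral {0..T} (\<lambda>r. \<bar>a r\<bar>)"
    using integral_unique[OF has_integral_step_product[OF hp(1) a_int(2), of 0 "int N" "\<lambda>_. 1"]] hp(2) by simp
  show "(\<Sum>k\<in>{0..<int N}. cell h k) = integral {0..T} a"
    using integral_unique[OF has_integral_step_product[OF hp(1) a_int(1), of 0 "int N" "\<lambda>_. 1"]] hp(2)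
    by (simp add: cell_def)
qed

text \<open>P is the discrete u' + c u: its increments contain no drift term, so over a period they
  are controlled by the total mass of |a| and the residuals, whatever the mesh. Since the slopes Y
  sum to 0 over a period, there are indices with Y \<ge> 0 and with Y \<le> 0 from which both bounds
  propagate.\<close>

lemma discrete_slope_bound:
  fixes X :: "int \<Rightarrow> real" and N :: nat
  assumes lam: "lam > 0" and N: "N > 0" and h: "h = T / real N"
    and per: "\<And>k. X (k + int N) = X k" and box: "\<And>k. 0 \<le> X k \<and> X k \<le> C"
    and eq: "\<And>k. \<bar>(1 + c * h) * (X (k + 1) - X k) - (X k - X (k - 1)) + h * lam * cell h k * g (X k)\<bar> \<le> e * h\<^sup>2"
    and e: "0 \<le> e" "e \<le> E" and G: "\<And>x. 0 \<le> x \<Longrightarrow> x \<le> C \<Longrightarrow> \<bar>g x\<bar> \<le> G"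
    and Y: "\<And>k. Y k = (X k - X (k - 1)) / h" and P: "\<And>k. P k = Y k + c * X k"
  shows "\<And>i j. i \<le> j \<Longrightarrow> \<bar>P j - P i + lam * (\<Sum>k\<in>{i..<j}. g (X k) * cell h k)\<bar> \<le> e * h * of_int (j - i)"
    "\<bar>Y k\<bar> \<le> 2 * \<bar>c\<bar> * C + lam * G * integral {0..T} (\<lambda>r. \<bar>a r\<bar>) + E * T"
proof -
  have hp: "h > 0" "real N * h = T"
    using N T_pos by (auto simp: h)
  have C: "C \<ge> 0"
    using box[of 0] by linarith
  have G0: "G \<ge> 0"
    using G[of 0] C by (simp add: abs_ge_zero order_trans)
  have stepP: "\<bar>P (k + 1) - P k + lam * (g (X k) * cell h k)\<bar> \<le> e * h" for k
  proof -
    have "(1 + c * h) * (X (k + 1) - X k) - (X k - X (k - 1)) + h * lam * cell h k * g (X k)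
        = h * (P (k + 1) - P k + lam * (g (X k) * cell h k))"
      using hp(1) by (simp add: P Y field_simps)
    then have "h * \<bar>P (k + 1) - P k + lam * (g (X k) * cell h k)\<bar> \<le> h * (e * h)"
      using eq[of k] hp(1) by (simp add: abs_mult power2_eq_square mult_ac)
    then show ?thesis
      using hp(1) by simp
  qed
  show sumP: "\<bar>P j - P i + lam * (\<Sum>k\<in>{i..<j}. g (X k) * cell h k)\<bar> \<le> e * h * of_int (j - i)" if "i \<le> j" for i j
    using that
  proof (induction rule: int_ge_induct)
    case (step j)
    have "{i..<j + 1} = insert j {i..<j}"
      using step.hyps by auto
    then have "P (j + 1) - P i + lam * (\<Sum>k\<in>{i..<j + 1}. g (X k) * cell h k)
        = (P j - P i + lam * (\<Sum>k\<in>{i..<j}. g (X k) * cell h k)) + (P (j + 1) - P j + lam * (g (X j) * cell h j))"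
      by (simp add: algebra_simps)
    moreover have "e * h * of_int (j + 1 - i) = e * h * of_int (j - i) + e * h"
      by (simp add: algebra_simps)
    ultimately show ?case
      using step.IH stepP[of j] by linarith
  qed simp
  define a2 where "a2 = integral {0..T} (\<lambda>r. \<bar>a r\<bar>)"
  define va where "va k = integral {of_int k * h..(of_int k + 1) * h} (\<lambda>r. \<bar>a r\<bar>)" for k :: int
  have va: "\<bar>cell h k\<bar> \<le> va k" "0 \<le> va k" "(\<Sum>k\<in>{0..<int N}. va k) = a2" for k
    using cell_sums[OF N h] abs_ge_zero[of "cell h k"] order_trans unfolding va_def a2_def by blast+
  define Q where "Q = lam * G * a2 + E * T"
  have near: "\<bar>P j - P i\<bar> \<le> Q" if ij: "0 \<le> i" "i \<le> j" "j \<le> int N" for i j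
  proof -
    have "\<bar>\<Sum>k\<in>{i..<j}. g (X k) * cell h k\<bar> \<le> (\<Sum>k\<in>{i..<j}. \<bar>g (X k) * cell h k\<bar>)"
      by (rule sum_abs)
    also have "\<dots> \<le> (\<Sum>k\<in>{i..<j}. G * va k)"
      unfolding abs_mult using G box va G0 by (intro sum_mono mult_mono) auto
    also have "\<dots> \<le> (\<Sum>k\<in>{0..<int N}. G * va k)"
      using ij va G0 by (intro sum_mono2) auto
    also have "\<dots> = G * a2"
      using va(3) by (simp flip: sum_distrib_left)
    finally have "\<bar>lam * (\<Sum>k\<in>{i..<j}. g (X k) * cell h k)\<bar> \<le> lam * (G * a2)"
      using lam by (simp add: abs_mult)
    moreover have "e * h * of_int (j - i) \<le> E * T"
    proof -
      have "e * (h * of_int (j - i)) \<le> E * (h * of_int (int N))"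
        using e hp(1) ij by (intro mult_mono mult_left_mono) auto
      then show ?thesis
        using hp(2) by (simp add: mult_ac)
    qed
    ultimately show ?thesis
      using sumP[OF ij(2)] by (simp add: Q_def mult.assoc)
  qed
  have near': "\<bar>P j - P i\<bar> \<le> Q" if "i \<in> {0..<int N}" "j \<in> {0..<int N}" for i j
    using near[of i j] near[of j i] that by (cases "i \<le> j") (auto simp: abs_minus_commute)
  have cX: "\<bar>c * X k\<bar> \<le> \<bar>c\<bar> * C" for k
    using box[of k] by (simp add: abs_mult mult_left_mono)
  have sumY: "(\<Sum>k\<in>{0..<int N}. Y k) = 0"
  proof -
    have "(\<Sum>k\<in>{0..<int N}. Y k) = (\<Sum>k\<in>{0..<int N}. X (k + 1 - 1) - X (k - 1)) / h"
      by (simp add: Y sum_divide_distrib)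
    also have "\<dots> = 0"
      using int_telescope[of 0 "int N" "\<lambda>k. X (k - 1)"] per[of "-1"] by (simp add: algebra_simps)
    finally show ?thesis .
  qed
  have ne: "{0..<int N} \<noteq> {}"
    using N by auto
  obtain i where i: "i \<in> {0..<int N}" "Y i \<ge> 0"
    using sum_strict_mono[of "{0..<int N}" Y "\<lambda>_. 0"] sumY ne by (force simp: not_le)
  obtain j where j: "j \<in> {0..<int N}" "Y j \<le> 0"
    using sum_strict_mono[of "{0..<int N}" "\<lambda>_. 0" Y] sumY ne by (force simp: not_le)
  have "\<bar>Y k\<bar> \<le> 2 * \<bar>c\<bar> * C + Q" if k: "k \<in> {0..<int N}" for k
    using near'[OF i(1) k] near'[OF j(1) k] cX[of i] cX[of j] cX[of k] i(2) j(2) P[of i] P[of j] P[of k]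
    by linarith
  moreover have "Y (k mod int N) = Y k"
  proof (rule periodic_int_mod)
    show "Y (k + int N) = Y k" for k
      using per[of k] per[of "k - 1"] by (simp add: Y algebra_simps)
  qed
  moreover have "k mod int N \<in> {0..<int N}"
    using N by simp
  ultimately show "\<bar>Y k\<bar> \<le> 2 * \<bar>c\<bar> * C + lam * G * integral {0..T} (\<lambda>r. \<bar>a r\<bar>) + E * T"
    unfolding Q_def a2_def by (metis add.assoc)
qed

text \<open>An Arzela-Ascoli argument for step functions: convergence at rational times extends to
  all times by the common Lipschitz bound. The summed scheme passes to the limit as an integral
  identity, from which the regularity of the limit follows.\<close>

lemma discrete_limit:
  fixes X :: "nat \<Rightarrow> int \<Rightarrow> real" and Np :: "nat \<Rightarrow> nat" and h e :: "nat \<Rightarrow> real"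
  assumes lam: "lam > 0" and Np: "\<And>n. Np n > 0" and h: "\<And>n. h n = T / real (Np n)" and h0: "h \<longlonglongrightarrow> 0"
    and per: "\<And>n k. X n (k + int (Np n)) = X n k" and box: "\<And>n k. 0 \<le> X n k \<and> X n k \<le> C"
    and eq: "\<And>n k. \<bar>(1 + c * h n) * (X n (k + 1) - X n k) - (X n k - X n (k - 1))
        + h n * lam * cell (h n) k * g (X n k)\<bar> \<le> e n * (h n)\<^sup>2"
    and e: "\<And>n. 0 \<le> e n" "e \<longlonglongrightarrow> 0"
  obtains \<sigma> u v M where "strict_mono \<sigma>" "\<forall>t. (\<lambda>n. X (\<sigma> n) \<lfloor>t / h (\<sigma> n)\<rfloor>) \<longlonglongrightarrow> u t" "M > 0"
    "\<forall>n k l. \<bar>X n k - X n l\<bar> \<le> M * h n * \<bar>of_int (k - l)\<bar>"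
    "\<forall>t. (u has_real_derivative v t) (at t)" "\<forall>t. u t \<ge> 0" "periodic_with T u"
    "\<forall>s t. s \<le> t \<longrightarrow> (\<lambda>r. a r * g (u r)) integrable_on {s..t}"
    "\<forall>s t. s \<le> t \<longrightarrow> v t - v s = - c * (u t - u s) - lam * integral {s..t} (\<lambda>r. a r * g (u r))"
proof -
  have hp: "h n > 0" "real (Np n) * h n = T" for n
    using Np[of n] T_pos by (auto simp: h)
  have C: "C \<ge> 0"
    using box[of 0 0] by linarith
  obtain G where G: "\<And>x. x \<in> {0..C} \<Longrightarrow> \<bar>g x\<bar> \<le> G"
    using bounded_on_Icc[OF continuous_on_subset[OF g_continuous, of "{0..C}"]] by force
  obtain E where E: "\<And>n. \<bar>e n\<bar> \<le> E"
    using convergent_imp_Bseq[OF convergentI[OF e(2)]] unfolding Bseq_def by auto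
  define Y where "Y n k = (X n k - X n (k - 1)) / h n" for n k
  define P where "P n k = Y n k + c * X n k" for n k
  define M0 where "M0 = 2 * \<bar>c\<bar> * C + lam * G * integral {0..T} (\<lambda>r. \<bar>a r\<bar>) + E * T"
  define M where "M = \<bar>M0\<bar> + 1"
  have sumP: "\<bar>P n j - P n i + lam * (\<Sum>k\<in>{i..<j}. g (X n k) * cell (h n) k)\<bar> \<le> e n * h n * of_int (j - i)"
    if "i \<le> j" for n i j
    by (rule discrete_slope_bound(1)[OF lam Np h per box eq e(1) abs_le_D1[OF E] _ Y_def P_def that]) (use G in auto)
  have YM0: "\<bar>Y n k\<bar> \<le> M0" for n k
    unfolding M0_def
    by (rule discrete_slope_bound(2)[OF lam Np h per box eq e(1) abs_le_D1[OF E] _ Y_def P_def]) (use G in auto)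
  have YM: "\<bar>Y n k\<bar> \<le> M" for n k
    using YM0[of n k] by (simp add: M_def)
  have M: "M > 0"
    by (simp add: M_def)
  have X_up: "\<bar>X n l - X n k\<bar> \<le> M * h n * of_int (l - k)" if "k \<le> l" for n k l
    using that
  proof (induction rule: int_ge_induct)
    case (step l)
    have "\<bar>X n (l + 1) - X n l\<bar> \<le> M * h n"
      using YM[of n "l + 1"] hp(1)[of n] by (simp add: Y_def abs_divide field_simps)
    moreover have "M * h n * of_int (l + 1 - k) = M * h n * of_int (l - k) + M * h n"
      by (simp add: algebra_simps)
    ultimately show ?case
      using step.IH by linarith
  qed simp
  have X_lip: "\<bar>X n k - X n l\<bar> \<le> M * h n * \<bar>of_int (k - l)\<bar>" for n k l
    using X_up[of k l n] X_up[of l k n] by (cases "k \<le> l") (auto simp: abs_minus_commute)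
  have X_near: "\<bar>X n \<lfloor>s / h n\<rfloor> - X n \<lfloor>t / h n\<rfloor>\<bar> \<le> M * (\<bar>s - t\<bar> + h n)" for n s t
  proof -
    have "h n * \<bar>of_int (\<lfloor>s / h n\<rfloor> - \<lfloor>t / h n\<rfloor>)\<bar> \<le> h n * (\<bar>s / h n - t / h n\<bar> + 1)"
      using hp(1)[of n] floor_diff_le by (intro mult_left_mono) auto
    also have "\<dots> = \<bar>s - t\<bar> + h n"
      using hp(1)[of n] by (simp add: distrib_left abs_divide flip: diff_divide_distrib)
    finally have "M * (h n * \<bar>of_int (\<lfloor>s / h n\<rfloor> - \<lfloor>t / h n\<rfloor>)\<bar>) \<le> M * (\<bar>s - t\<bar> + h n)"
      using M by (intro mult_left_mono) auto
    then show ?thesis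
      using X_lip[of n "\<lfloor>s / h n\<rfloor>" "\<lfloor>t / h n\<rfloor>"] by (simp add: mult.assoc)
  qed
  \<comment> \<open>Pairing position and slope variable lets a single diagonal extraction serve
    both.\<close>
  define F where "F n t = (X n \<lfloor>t / h n\<rfloor>, P n \<lfloor>t / h n\<rfloor>)" for n t
  have "norm (F n t) \<le> C + (M + \<bar>c\<bar> * C)" for n t
  proof -
    have "norm (F n t) \<le> norm (X n \<lfloor>t / h n\<rfloor>) + norm (P n \<lfloor>t / h n\<rfloor>)"
      unfolding F_def by (rule norm_Pair_le)
    moreover have "\<bar>P n \<lfloor>t / h n\<rfloor>\<bar> \<le> M + \<bar>c\<bar> * C"
      unfolding P_def using YM[of n "\<lfloor>t / h n\<rfloor>"] box[of n "\<lfloor>t / h n\<rfloor>"]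
      by (intro order_trans[OF abs_triangle_ineq] add_mono) (auto simp: abs_mult mult_left_mono)
    moreover have "\<bar>X n \<lfloor>t / h n\<rfloor>\<bar> \<le> C"
      using box[of n "\<lfloor>t / h n\<rfloor>"] by simp
    ultimately show ?thesis
      unfolding real_norm_def by linarith
  qed
  then obtain \<sigma> where \<sigma>: "strict_mono \<sigma>" and \<sigma>conv: "\<And>q. q \<in> \<rat> \<Longrightarrow> \<exists>l. (\<lambda>n. F (\<sigma> n) q) \<longlonglongrightarrow> l"
    using function_convergent_subsequence[OF countable_rat, of F "C + (M + \<bar>c\<bar> * C)"] by metis
  define hs Xs Ys Ps where "hs n = h (\<sigma> n)" and "Xs n = X (\<sigma> n)" and "Ys n = Y (\<sigma> n)" and "Ps n = P (\<sigma> n)" for n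
  have hs: "hs n > 0" "hs \<longlonglongrightarrow> 0" for n
  proof -
    have "hs = h \<circ> \<sigma>"
      by (simp add: hs_def fun_eq_iff)
    then show "hs n > 0" "hs \<longlonglongrightarrow> 0"
      using hp(1) LIMSEQ_subseq_LIMSEQ[OF h0 \<sigma>] by auto
  qed
  have es: "(\<lambda>n. e (\<sigma> n)) \<longlonglongrightarrow> 0"
    using LIMSEQ_subseq_LIMSEQ[OF e(2) \<sigma>] by (simp add: comp_def)
  have "convergent (\<lambda>n. Xs n \<lfloor>t / hs n\<rfloor>)" for t
    unfolding Cauchy_convergent_iff[symmetric]
  proof (rule metric_CauchyI)
    fix d :: real assume d: "d > 0"
    have "t < t + d / (8 * M)"
      using d M by simp
    from Rats_dense_in_real[OF this] obtain q where q: "q \<in> \<rat>" "t < q" "q < t + d / (8 * M)"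
      by blast
    have Mq: "M * \<bar>t - q\<bar> \<le> d / 8"
      using q M by (simp add: field_simps)
    obtain l where "(\<lambda>n. F (\<sigma> n) q) \<longlonglongrightarrow> l"
      using \<sigma>conv[OF q(1)] by blast
    from tendsto_fst[OF this] have "Cauchy (\<lambda>n. Xs n \<lfloor>q / hs n\<rfloor>)"
      unfolding Cauchy_convergent_iff F_def Xs_def hs_def by (auto simp: convergent_def)
    from metric_CauchyD[OF this, of "d / 4"] d
    obtain n1 where n1: "\<forall>m\<ge>n1. \<forall>n\<ge>n1. dist (Xs m \<lfloor>q / hs m\<rfloor>) (Xs n \<lfloor>q / hs n\<rfloor>) < d / 4"
      by auto
    have "\<forall>\<^sub>F n in sequentially. hs n < d / (8 * M)"
      using hs(2) d M by (intro order_tendstoD(2)) auto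
    then obtain n2 where n2: "\<And>n. n \<ge> n2 \<Longrightarrow> hs n < d / (8 * M)"
      by (auto simp: eventually_sequentially)
    have close: "\<bar>Xs n \<lfloor>t / hs n\<rfloor> - Xs n \<lfloor>q / hs n\<rfloor>\<bar> \<le> d / 4" if "n \<ge> n2" for n
    proof -
      have "M * hs n \<le> d / 8"
        using n2[OF that] M by (simp add: field_simps)
      then show ?thesis
        using X_near[of "\<sigma> n" t q] Mq unfolding Xs_def hs_def by (simp add: distrib_left)
    qed
    show "\<exists>n0. \<forall>m\<ge>n0. \<forall>n\<ge>n0. dist (Xs m \<lfloor>t / hs m\<rfloor>) (Xs n \<lfloor>t / hs n\<rfloor>) < d"
    proof (intro exI[of _ "max n1 n2"] allI impI)
      fix m n assume "max n1 n2 \<le> m" "max n1 n2 \<le> n"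
      then show "dist (Xs m \<lfloor>t / hs m\<rfloor>) (Xs n \<lfloor>t / hs n\<rfloor>) < d"
        using n1[rule_format, of m n] close[of m] close[of n] d unfolding dist_real_def by linarith
    qed
  qed
  then have "\<forall>t. \<exists>l. (\<lambda>n. Xs n \<lfloor>t / hs n\<rfloor>) \<longlonglongrightarrow> l"
    unfolding convergent_def by blast
  from choice[OF this] obtain u where u: "\<And>t. (\<lambda>n. Xs n \<lfloor>t / hs n\<rfloor>) \<longlonglongrightarrow> u t"
    by blast
  have u0: "u t \<ge> 0" for t
    using u[of t] box by (intro LIMSEQ_le_const[OF u]) (auto simp: Xs_def)
  have gu: "(\<lambda>n. g (Xs n \<lfloor>t / hs n\<rfloor>)) \<longlonglongrightarrow> g (u t)" for t
    by (rule continuous_on_tendsto_compose[OF g_continuous u]) (use u0 box in \<open>auto simp: Xs_def\<close>)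
  have gG: "\<bar>g (Xs n k)\<bar> \<le> G" for n k
    using G box by (simp add: Xs_def)
  have agu: "(\<lambda>r. a r * g (u r)) integrable_on {s..t}" if "s \<le> t" for s t
    by (rule step_sum_tendsto_integral(1)[where S = "\<lambda>n k. g (Xs n k)" and \<phi> = "\<lambda>r. g (u r)", OF hs a_abs_int that gG gu])
  have P_diff: "(\<lambda>n. Ps n \<lfloor>t / hs n\<rfloor> - Ps n \<lfloor>s / hs n\<rfloor>) \<longlonglongrightarrow> - lam * integral {s..t} (\<lambda>r. a r * g (u r))"
    if st: "s \<le> t" for s t
  proof -
    let ?S = "\<lambda>n. \<Sum>k\<in>{\<lfloor>s / hs n\<rfloor>..<\<lfloor>t / hs n\<rfloor>}. g (Xs n k) * cell (hs n) k"
    have S: "?S \<longlonglongrightarrow> integral {s..t} (\<lambda>r. a r * g (u r))"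
      unfolding cell_def by (rule step_sum_tendsto_integral(2)[where S = "\<lambda>n k. g (Xs n k)" and \<phi> = "\<lambda>r. g (u r)", OF hs a_abs_int st gG gu])
    have R: "(\<lambda>n. Ps n \<lfloor>t / hs n\<rfloor> - Ps n \<lfloor>s / hs n\<rfloor> + lam * ?S n) \<longlonglongrightarrow> 0"
    proof (rule tendsto_rabs_zero_cancel, rule tendsto_sandwich[of "\<lambda>_. 0"])
      show "\<forall>\<^sub>F n in sequentially. \<bar>Ps n \<lfloor>t / hs n\<rfloor> - Ps n \<lfloor>s / hs n\<rfloor> + lam * ?S n\<bar> \<le> e (\<sigma> n) * (t - s + hs n)"
      proof (intro always_eventually allI)
        fix n
        have "\<lfloor>s / hs n\<rfloor> \<le> \<lfloor>t / hs n\<rfloor>"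
          using st hs(1)[of n] by (intro floor_mono divide_right_mono) auto
        then have "\<bar>Ps n \<lfloor>t / hs n\<rfloor> - Ps n \<lfloor>s / hs n\<rfloor> + lam * ?S n\<bar>
            \<le> e (\<sigma> n) * hs n * of_int (\<lfloor>t / hs n\<rfloor> - \<lfloor>s / hs n\<rfloor>)"
          unfolding Ps_def hs_def Xs_def by (rule sumP)
        also have "\<dots> = e (\<sigma> n) * (of_int \<lfloor>t / hs n\<rfloor> * hs n - of_int \<lfloor>s / hs n\<rfloor> * hs n)"
          by (simp add: algebra_simps)
        also have "\<dots> \<le> e (\<sigma> n) * (t - s + hs n)"
          using floor_cell(1)[OF hs(1)[of n], of t] floor_cell(2)[OF hs(1)[of n], of s] e(1)
          by (intro mult_left_mono) (auto simp: distrib_right)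
        finally show "\<bar>Ps n \<lfloor>t / hs n\<rfloor> - Ps n \<lfloor>s / hs n\<rfloor> + lam * ?S n\<bar> \<le> e (\<sigma> n) * (t - s + hs n)" .
      qed
      have "(\<lambda>n. e (\<sigma> n) * (t - s + hs n)) \<longlonglongrightarrow> 0 * (t - s + 0)"
        by (intro tendsto_intros es hs(2))
      then show "(\<lambda>n. e (\<sigma> n) * (t - s + hs n)) \<longlonglongrightarrow> 0"
        by simp
    qed auto
    have "(\<lambda>n. (Ps n \<lfloor>t / hs n\<rfloor> - Ps n \<lfloor>s / hs n\<rfloor> + lam * ?S n) - lam * ?S n)
        \<longlonglongrightarrow> 0 - lam * integral {s..t} (\<lambda>r. a r * g (u r))"
      by (intro tendsto_intros R S)
    then show ?thesis
      by simp
  qed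
  \<comment> \<open>P is not equicontinuous across jumps of the step functions, but its differences
    converge by \<open>P_diff\<close>; convergence at time 0 is therefore enough.\<close>
  have "\<forall>t. \<exists>l. (\<lambda>n. Ps n \<lfloor>t / hs n\<rfloor>) \<longlonglongrightarrow> l"
  proof
    fix t
    obtain l where "(\<lambda>n. F (\<sigma> n) 0) \<longlonglongrightarrow> l"
      using \<sigma>conv[of 0] by auto
    from tendsto_snd[OF this] have l: "(\<lambda>n. Ps n \<lfloor>0 / hs n\<rfloor>) \<longlonglongrightarrow> snd l"
      by (simp add: F_def Ps_def hs_def)
    show "\<exists>l. (\<lambda>n. Ps n \<lfloor>t / hs n\<rfloor>) \<longlonglongrightarrow> l"
    proof (cases "0 \<le> t")
      case True
      from tendsto_add[OF l P_diff[OF this]] show ?thesis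
        by auto
    next
      case False
      then have "t \<le> 0" by simp
      from tendsto_diff[OF l P_diff[OF this]] show ?thesis
        by auto
    qed
  qed
  from choice[OF this] obtain \<pi> where \<pi>: "\<And>t. (\<lambda>n. Ps n \<lfloor>t / hs n\<rfloor>) \<longlonglongrightarrow> \<pi> t"
    by blast
  have \<pi>_diff: "\<pi> t - \<pi> s = - lam * integral {s..t} (\<lambda>r. a r * g (u r))" if "s \<le> t" for s t
    using LIMSEQ_unique[OF tendsto_diff[OF \<pi> \<pi>] P_diff[OF that]] .
  define v where "v t = \<pi> t - c * u t" for t
  have Y_lim: "(\<lambda>n. Ys n \<lfloor>t / hs n\<rfloor>) \<longlonglongrightarrow> v t" for t
  proof -
    have "(\<lambda>n. Ps n \<lfloor>t / hs n\<rfloor> - c * Xs n \<lfloor>t / hs n\<rfloor>) \<longlonglongrightarrow> v t"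
      unfolding v_def by (intro tendsto_intros \<pi> u)
    then show ?thesis
      by (simp add: Ps_def Xs_def Ys_def P_def)
  qed
  have YsM: "\<bar>Ys n k\<bar> \<le> M" for n k
    using YM by (simp add: Ys_def)
  \<comment> \<open>Slopes are backward differences, so their sum telescopes to values one index to
    the left. These have the same limit since h Y tends to 0.\<close>
  have X_prev: "(\<lambda>n. Xs n (\<lfloor>t / hs n\<rfloor> - 1)) \<longlonglongrightarrow> u t" for t
  proof -
    have "(\<lambda>n. hs n * Ys n \<lfloor>t / hs n\<rfloor>) \<longlonglongrightarrow> 0 * v t"
      by (intro tendsto_intros hs(2) Y_lim)
    then have "(\<lambda>n. Xs n \<lfloor>t / hs n\<rfloor> - hs n * Ys n \<lfloor>t / hs n\<rfloor>) \<longlonglongrightarrow> u t - 0"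
      by (intro tendsto_diff u) simp
    moreover have "Xs n \<lfloor>t / hs n\<rfloor> - hs n * Ys n \<lfloor>t / hs n\<rfloor> = Xs n (\<lfloor>t / hs n\<rfloor> - 1)" for n
      using hs(1)[of n] by (simp add: Ys_def Y_def Xs_def hs_def)
    ultimately show ?thesis
      by simp
  qed
  have u_diff: "u t - u s = integral {s..t} v" if st: "s \<le> t" for s t
  proof -
    have "(\<lambda>n. \<Sum>k\<in>{\<lfloor>s / hs n\<rfloor>..<\<lfloor>t / hs n\<rfloor>}. Ys n k * integral {of_int k * hs n..(of_int k + 1) * hs n} (\<lambda>_. 1))
        \<longlonglongrightarrow> integral {s..t} (\<lambda>r. 1 * v r)"
      by (rule step_sum_tendsto_integral(2)[where S = Ys and \<phi> = v, OF hs _ st YsM Y_lim]) (auto intro: absolutely_integrable_continuous_real)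
    moreover have "(\<Sum>k\<in>{\<lfloor>s / hs n\<rfloor>..<\<lfloor>t / hs n\<rfloor>}. Ys n k * integral {of_int k * hs n..(of_int k + 1) * hs n} (\<lambda>_. 1))
        = Xs n (\<lfloor>t / hs n\<rfloor> - 1) - Xs n (\<lfloor>s / hs n\<rfloor> - 1)" for n
    proof -
      have "\<lfloor>s / hs n\<rfloor> \<le> \<lfloor>t / hs n\<rfloor>"
        using st hs(1)[of n] by (intro floor_mono divide_right_mono) auto
      from int_telescope[OF this, of "\<lambda>k. Xs n (k - 1)"]
      have "(\<Sum>k\<in>{\<lfloor>s / hs n\<rfloor>..<\<lfloor>t / hs n\<rfloor>}. Xs n k - Xs n (k - 1)) = Xs n (\<lfloor>t / hs n\<rfloor> - 1) - Xs n (\<lfloor>s / hs n\<rfloor> - 1)"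
        by simp
      moreover have "Ys n k * integral {of_int k * hs n..(of_int k + 1) * hs n} (\<lambda>_. 1) = Xs n k - Xs n (k - 1)" for k
      proof -
        have "of_int k * hs n \<le> (of_int k + 1) * hs n"
          using hs(1)[of n] by (intro mult_right_mono) auto
        then have "integral {of_int k * hs n..(of_int k + 1) * hs n} (\<lambda>_. 1::real) = hs n"
          by (simp add: distrib_right)
        then show ?thesis
          using hs(1)[of n] by (simp add: Ys_def Y_def Xs_def hs_def)
      qed
      ultimately show ?thesis
        by simp
    qed
    ultimately have "(\<lambda>n. Xs n (\<lfloor>t / hs n\<rfloor> - 1) - Xs n (\<lfloor>s / hs n\<rfloor> - 1)) \<longlonglongrightarrow> integral {s..t} v"
      by simp
    from LIMSEQ_unique[OF tendsto_diff[OF X_prev X_prev] this] show ?thesis .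
  qed
  have uc: "continuous_on UNIV u"
  proof (rule lipschitz_on_continuous_on, rule lipschitz_onI)
    fix s t
    have "\<bar>u s - u t\<bar> \<le> M * (\<bar>s - t\<bar> + 0)"
    proof (rule LIMSEQ_le)
      show "(\<lambda>n. \<bar>Xs n \<lfloor>s / hs n\<rfloor> - Xs n \<lfloor>t / hs n\<rfloor>\<bar>) \<longlonglongrightarrow> \<bar>u s - u t\<bar>"
        by (intro tendsto_intros u)
      show "(\<lambda>n. M * (\<bar>s - t\<bar> + hs n)) \<longlonglongrightarrow> M * (\<bar>s - t\<bar> + 0)"
        by (intro tendsto_intros hs(2))
      show "\<exists>N. \<forall>n\<ge>N. \<bar>Xs n \<lfloor>s / hs n\<rfloor> - Xs n \<lfloor>t / hs n\<rfloor>\<bar> \<le> M * (\<bar>s - t\<bar> + hs n)"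
        using X_near unfolding Xs_def hs_def by blast
    qed
    then show "dist (u s) (u t) \<le> M * dist s t"
      by (simp add: dist_real_def)
  qed (use M in simp)
  \<comment> \<open>A pointwise limit need not be continuous; continuity comes from the integral
    identity. Only then does u, an indefinite integral of v, become differentiable
    everywhere.\<close>
  have vc: "isCont v t" for t
  proof -
    have "continuous_on {t - 1..t + 1} (\<lambda>x. \<pi> (t - 1) - lam * integral {t - 1..x} (\<lambda>r. a r * g (u r)) - c * u x)"
      by (intro continuous_intros indefinite_integral_continuous_1 agu continuous_on_subset[OF uc]) auto
    moreover have "\<pi> (t - 1) - lam * integral {t - 1..x} (\<lambda>r. a r * g (u r)) - c * u x = v x"
      if "x \<in> {t - 1..t + 1}" for x
      using \<pi>_diff[of "t - 1" x] that by (simp add: v_def)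
    ultimately have "continuous_on {t - 1..t + 1} v"
      by (rule continuous_on_eq)
    then show ?thesis
      by (rule continuous_on_interior) simp
  qed
  have u': "(u has_real_derivative v t) (at t)" for t
  proof -
    have "continuous_on {t - 1..t + 1} v"
      using vc by (intro continuous_at_imp_continuous_on) auto
    from integral_has_real_derivative[OF this, of t]
    have "((\<lambda>x. integral {t - 1..x} v) has_real_derivative v t) (at t)"
      by (simp add: at_within_Icc_at)
    then have "((\<lambda>x. u (t - 1) + integral {t - 1..x} v) has_real_derivative v t) (at t)"
      using DERIV_add[OF DERIV_const] by fastforce
    then show ?thesis
    proof (rule has_field_derivative_transform_within_open)
      show "u (t - 1) + integral {t - 1..x} v = u x" if "x \<in> {t - 1<..<t + 1}" for x
        using u_diff[of "t - 1" x] that by simp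
    qed auto
  qed
  have uT: "u (t + T) = u t" for t
  proof -
    have "\<lfloor>(t + T) / hs n\<rfloor> = \<lfloor>t / hs n\<rfloor> + int (Np (\<sigma> n))" for n
    proof -
      have "(t + T) / hs n = t / hs n + of_int (int (Np (\<sigma> n)))"
      proof -
        have "T / hs n = real (Np (\<sigma> n)) * h (\<sigma> n) / h (\<sigma> n)"
          by (simp only: hp(2) hs_def)
        also have "\<dots> = real (Np (\<sigma> n))"
          using hp(1)[of "\<sigma> n"] by simp
        finally show ?thesis
          by (simp add: add_divide_distrib)
      qed
      then show ?thesis
        by (simp only: floor_add_int)
    qed
    then have "Xs n \<lfloor>(t + T) / hs n\<rfloor> = Xs n \<lfloor>t / hs n\<rfloor>" for n
      using per by (simp add: Xs_def)
    then show ?thesis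
      using LIMSEQ_unique[OF u[of t]] u[of "t + T"] by simp
  qed
  have v_diff: "v t - v s = - c * (u t - u s) - lam * integral {s..t} (\<lambda>r. a r * g (u r))" if "s \<le> t" for s t
    using \<pi>_diff[OF that] by (simp add: v_def algebra_simps)
  show ?thesis
  proof (rule that[of \<sigma> u M v, OF \<sigma> _ M])
    show "\<forall>t. (\<lambda>n. X (\<sigma> n) \<lfloor>t / h (\<sigma> n)\<rfloor>) \<longlonglongrightarrow> u t"
      using u by (simp add: Xs_def hs_def)
    show "\<forall>n k l. \<bar>X n k - X n l\<bar> \<le> M * h n * \<bar>of_int (k - l)\<bar>"
      using X_lip by blast
    show "periodic_with T u"
      using uT by (simp add: periodic_with_def)
  qed (use u' u0 agu v_diff in simp_all)
qed

end

section \<open>Upper and lower solutions for the discretized equation\<close>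

text \<open>With x = |c| h \<le> 1/2, the lower bound rests on (1 + 2 x)(1 - x) \<ge> 1 and 1 + 2 x
  \<le> exp(2 x).\<close>

lemma power_one_plus_bounds:
  fixes c h T :: real
  assumes h: "h > 0" and ch: "\<bar>c\<bar> * h \<le> 1/2" and k: "real k * h \<le> T"
  shows "1 / exp (2 * \<bar>c\<bar> * T) \<le> (1 + c * h) ^ k" "(1 + c * h) ^ k \<le> exp (2 * \<bar>c\<bar> * T)"
proof -
  define x where "x = \<bar>c\<bar> * h"
  have x: "0 \<le> x" "x \<le> 1/2" "- x \<le> c * h" "c * h \<le> x"
    using h ch abs_ge_self[of "c * h"] abs_ge_minus_self[of "c * h"] by (auto simp: x_def abs_mult)
  have kx: "real k * (2 * x) \<le> 2 * \<bar>c\<bar> * T"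
    using mult_left_mono[OF k, of "2 * \<bar>c\<bar>"] by (simp add: x_def mult_ac)
  have "(1 + c * h) ^ k \<le> exp (2 * x) ^ k"
  proof (rule power_mono)
    have "1 + c * h \<le> 1 + 2 * x"
      using x by linarith
    also have "\<dots> \<le> exp (2 * x)"
      by (rule exp_ge_add_one_self)
    finally show "1 + c * h \<le> exp (2 * x)" .
  qed (use x in linarith)
  also have "\<dots> = exp (real k * (2 * x))"
    by (simp add: exp_of_nat_mult)
  finally show "(1 + c * h) ^ k \<le> exp (2 * \<bar>c\<bar> * T)"
    using kx by (meson exp_le_cancel_iff order_trans)
  have "1 \<le> exp (2 * x) * (1 + c * h)"
  proof -
    have "0 \<le> x * (1 - 2 * x)"
      using x by simp
    then have "1 \<le> (1 + 2 * x) * (1 - x)"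
      by (simp add: algebra_simps)
    also have "\<dots> \<le> exp (2 * x) * (1 + c * h)"
      using x by (intro mult_mono exp_ge_add_one_self) auto
    finally show ?thesis .
  qed
  then have "1 \<le> (exp (2 * x) * (1 + c * h)) ^ k"
    by (rule one_le_power)
  also have "\<dots> = exp (real k * (2 * x)) * (1 + c * h) ^ k"
    by (simp add: power_mult_distrib exp_of_nat_mult)
  also have "\<dots> \<le> exp (2 * \<bar>c\<bar> * T) * (1 + c * h) ^ k"
    using kx x by (intro mult_right_mono) auto
  finally show "1 / exp (2 * \<bar>c\<bar> * T) \<le> (1 + c * h) ^ k"
    by (simp add: divide_le_eq mult.commute)
qed

text \<open>The point \<^term>\<open>\<tau>\<close> is where the integral first reaches half of its total.\<close>

lemma left_support_point:
  fixes f :: "real \<Rightarrow> real"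
  assumes f: "f integrable_on {x..y}" and xy: "x \<le> y" and pos: "integral {x..y} f > 0"
  obtains \<tau> where "x < \<tau>" "\<tau> < y" "\<And>s. x \<le> s \<Longrightarrow> s < \<tau> \<Longrightarrow> integral {s..\<tau>} f > 0"
proof -
  define A where "A t = integral {x..t} f" for t
  have Ac: "continuous_on {x..y} A"
    unfolding A_def by (rule indefinite_integral_continuous_1[OF f])
  define S where "S = {t \<in> {x..y}. A y / 2 \<le> A t}"
  have "closed S"
    unfolding S_def by (intro continuous_on_closed_Collect_le continuous_on_const Ac) simp
  have Ay: "A x = 0" "A y > 0"
    using pos by (auto simp: A_def)
  have S: "S \<noteq> {}" "bdd_below S"
    using xy Ay by (auto simp: S_def)
  define \<tau> where "\<tau> = Inf S"
  have "\<tau> \<in> S"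
    unfolding \<tau>_def using \<open>closed S\<close> S by (intro closed_contains_Inf)
  then have \<tau>: "x \<le> \<tau>" "\<tau> \<le> y" "A y / 2 \<le> A \<tau>"
    by (auto simp: S_def)
  have before: "A s < A y / 2" if "x \<le> s" "s < \<tau>" for s
    using cInf_lower[OF _ S(2), of s] that \<tau> unfolding \<tau>_def S_def by fastforce
  have "x < \<tau>"
    using \<tau> Ay by (cases "\<tau> = x") auto
  moreover have "\<tau> < y"
  proof -
    obtain t where t: "x \<le> t" "t \<le> y" "A t = A y / 2"
      using IVT'[of A x "A y / 2" y] Ay xy Ac by auto
    then have "\<tau> \<le> t"
      using before[of t] by force
    moreover have "t \<noteq> y"
      using t(3) Ay by auto
    ultimately show ?thesis
      using t(2) by linarith
  qed
  moreover have "integral {s..\<tau>} f > 0" if s: "x \<le> s" "s < \<tau>" for s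
  proof -
    have "integral {x..s} f + integral {s..\<tau>} f = integral {x..\<tau>} f"
      using s \<tau> by (intro Henstock_Kurzweil_Integration.integral_combine integrable_subinterval_real[OF f]) auto
    then show ?thesis
      using before[OF s] \<tau>(3) by (simp add: A_def)
  qed
  ultimately show ?thesis
    using that by blast
qed

text \<open>I may contain either endpoint or not; it differs from [Inf I, Sup I] by at most these
  two points, which do not affect the integral.\<close>

lemma interval_endpoints:
  fixes I :: "real set" and f :: "real \<Rightarrow> real"
  assumes "is_interval I" "I \<subseteq> {0..T}" "f absolutely_integrable_on {0..T}" "(LINT t:I|lebesgue. f t) > 0"
  obtains x y where "0 \<le> x" "x \<le> y" "y \<le> T" "{x<..<y} \<subseteq> I" "integral {x..y} f > 0"
proof -
  have ne: "I \<noteq> {}"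
    using assms(4) by (auto simp: set_lebesgue_integral_def)
  have bdd: "bdd_below I" "bdd_above I"
    using assms(2) by (meson bdd_below_Icc bdd_below_mono bdd_above_Icc bdd_above_mono)+
  define x y where "x = Inf I" and "y = Sup I"
  have I: "I \<subseteq> {x..y}" "{x<..<y} \<subseteq> I"
  proof -
    show "I \<subseteq> {x..y}"
      using bdd by (auto simp: x_def y_def intro: cInf_lower cSup_upper)
    show "{x<..<y} \<subseteq> I"
    proof
      fix t assume t: "t \<in> {x<..<y}"
      obtain p where "p \<in> I" "p < t"
        using t cInf_lessD[OF ne, of t] by (auto simp: x_def)
      moreover obtain q where "q \<in> I" "t < q"
        using t less_cSupD[OF ne, of t] by (auto simp: y_def)
      ultimately show "t \<in> I"
        using assms(1) unfolding is_interval_1 by (meson less_imp_le)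
    qed
  qed
  have xy: "0 \<le> x" "y \<le> T" "x \<le> y"
  proof -
    show "0 \<le> x"
      unfolding x_def using assms(2) by (intro cInf_greatest[OF ne]) auto
    show "y \<le> T"
      unfolding y_def using assms(2) by (intro cSup_least[OF ne]) auto
    show "x \<le> y"
      unfolding x_def y_def using bdd by (intro cInf_le_cSup[OF ne])
  qed
  have sd: "negligible {t \<in> {x..y} - I. f t \<noteq> 0}" "negligible {t \<in> I - {x..y}. f t \<noteq> 0}"
  proof -
    have "{t \<in> {x..y} - I. f t \<noteq> 0} \<subseteq> {x, y}"
      using I(2) by force
    then show "negligible {t \<in> {x..y} - I. f t \<noteq> 0}"
      by (rule negligible_subset[rotated]) (simp add: negligible_finite)
    show "negligible {t \<in> I - {x..y}. f t \<noteq> 0}"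
      using I(1) by (simp add: Diff_eq_empty_iff[THEN iffD2])
  qed
  have fxy: "f absolutely_integrable_on {x..y}"
    using assms(3) xy by (auto intro: absolutely_integrable_on_subinterval)
  have "I \<in> sets lebesgue"
  proof -
    have "I \<in> sets borel"
      using assms(1) by (simp add: is_interval_convex real_interval_borel_measurable is_interval_connected)
    then show ?thesis
      by simp
  qed
  then have "f absolutely_integrable_on I"
    using set_integrable_subset[OF fxy _ I(1)] by simp
  then have "integral I f > 0"
    using assms(4) set_lebesgue_integral_eq_integral(2) by metis
  moreover have "integral I f = integral {x..y} f"
    using integral_spike_set[OF sd(2) sd(1)] .
  ultimately show ?thesis
    using that xy I(2) by simp
qed

section \<open>Levels for the upper solutions and the size of the bump\<close>

context indefinite_equation
begin

lemma small_level:
  assumes \<delta>: "\<delta> > 0"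
  obtains r0 where "r0 > 0" "\<forall>r. 0 < r \<longrightarrow> r \<le> r0 \<longrightarrow> g r \<le> \<delta> * r \<and> (\<forall>s. r / 2 \<le> s \<longrightarrow> s \<le> 3 * r / 2 \<longrightarrow> \<bar>g' s\<bar> \<le> \<delta>)"
proof -
  have "\<exists>d>0. \<forall>s\<in>{0..}. dist s 0 < d \<longrightarrow> dist (g' s) (g' 0) < \<delta>"
    using g'_cont \<delta> unfolding continuous_on_iff by (meson atLeast_iff order_refl)
  then obtain d where d: "d > 0" "\<And>s. 0 \<le> s \<Longrightarrow> s < d \<Longrightarrow> \<bar>g' s\<bar> < \<delta>"
    by (auto simp: g'_zero)
  show ?thesis
  proof (rule that[of "d / 2"]; (intro allI impI conjI)?)
    fix r assume r: "0 < r" "r \<le> d / 2"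
    have "\<bar>g r - g 0\<bar> \<le> \<delta> * \<bar>r - 0\<bar>"
      by (rule g_diff_le) (use r d in \<open>auto intro: less_imp_le\<close>)
    then show "g r \<le> \<delta> * r"
      using r g_zero by simp
    show "\<bar>g' s\<bar> \<le> \<delta>" if "r / 2 \<le> s" "s \<le> 3 * r / 2" for s
      using d(2)[of s] r that d(1) by (simp add: less_imp_le)
  qed (use d in simp)
qed

lemma large_level:
  assumes \<delta>: "\<delta> > 0"
  obtains R0 where "R0 > 0" "\<forall>r. R0 \<le> r \<longrightarrow> g r \<le> \<delta> * r \<and> (\<forall>s. r / 2 \<le> s \<longrightarrow> s \<le> 3 * r / 2 \<longrightarrow> \<bar>g' s\<bar> \<le> \<delta>)"
proof -
  have "\<forall>\<^sub>F s in at_top. dist (g' s) 0 < \<delta> / 2"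
    using g'_inf by (rule tendstoD) (use \<delta> in simp)
  then obtain R where R: "\<And>s. s \<ge> R \<Longrightarrow> \<bar>g' s\<bar> < \<delta> / 2"
    by (auto simp: eventually_at_top_linorder)
  define R1 where "R1 = max R 1"
  \<comment> \<open>The first term keeps [r/2, 3 r/2] beyond R1, where |g'| < \<delta>/2; the second
    lets \<delta> r/2 absorb the initial value g(R1).\<close>
  define R0 where "R0 = max (2 * R1) (2 * g R1 / \<delta>)"
  show ?thesis
  proof (rule that[of R0]; (intro allI impI conjI)?)
    show "R0 > 0"
      by (simp add: R0_def R1_def less_max_iff_disj)
    fix r assume r: "R0 \<le> r"
    then have r1: "2 * R1 \<le> r" "2 * g R1 / \<delta> \<le> r" "R1 \<ge> 1" "R1 \<ge> R"
      by (auto simp: R0_def R1_def)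
    have "\<bar>g r - g R1\<bar> \<le> \<delta> / 2 * \<bar>r - R1\<bar>"
    proof (rule g_diff_le)
      fix s assume "min r R1 \<le> s"
      then have "s \<ge> R"
        using r1 by auto
      then show "\<bar>g' s\<bar> \<le> \<delta> / 2"
        using R[of s] by simp
    qed (use r1 in auto)
    also have "\<dots> \<le> \<delta> / 2 * r"
      using r1 \<delta> by (intro mult_left_mono) auto
    finally have "g r \<le> g R1 + \<delta> / 2 * r"
      by linarith
    moreover have "g R1 \<le> \<delta> / 2 * r"
      using r1(2) \<delta> by (simp add: field_simps)
    ultimately show "g r \<le> \<delta> * r"
      by simp
    show "\<bar>g' s\<bar> \<le> \<delta>" if "r / 2 \<le> s" for s
      using R[of s] r1 that \<delta> by simp
  qed
qed

text \<open>\<open>W\<close> bounds the solution of the linear problem, so the corrected constant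
  stays within lam g(r) W of r. With \<open>\<delta>\<close> as chosen this radius is at most e0 r
  \<le> r/2, and g varies by at most e0 g(r) on it. The value of \<open>e0\<close> turns the
  effective mean a1 + e0 a2 into a1/2, still negative.\<close>

lemma upper_level:
  assumes lam: "lam > 0" and mean: "integral {0..T} a < 0" and r: "r > 0"
    and W: "W = (2 * T + 1 / \<bar>c\<bar>) * (4 * integral {0..T} (\<lambda>t. \<bar>a t\<bar>))"
    and e0: "e0 = - integral {0..T} a / (2 * integral {0..T} (\<lambda>t. \<bar>a t\<bar>))" and \<delta>: "\<delta> = e0 / (lam * W)"
    and level: "g r \<le> \<delta> * r" "\<forall>s. r / 2 \<le> s \<longrightarrow> s \<le> 3 * r / 2 \<longrightarrow> \<bar>g' s\<bar> \<le> \<delta>"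
    and N: "N > 0" and h: "h = T / real N" and ch: "\<bar>c\<bar> * h \<le> 1/2"
  obtains b where "\<forall>i<N. \<bar>b i - r\<bar> \<le> r / 2"
    "\<forall>i<N. resid c h lam (\<lambda>i. cell h (int i)) g N b i \<le> - (lam * g r * (- integral {0..T} a / 2) / T * h\<^sup>2)"
proof -
  define a1 a2 where "a1 = integral {0..T} a" and "a2 = integral {0..T} (\<lambda>t. \<bar>a t\<bar>)"
  have "norm a1 \<le> a2"
    unfolding a1_def a2_def by (intro integral_norm_bound_integral a_int) auto
  then have a12: "- a1 \<le> a2" "a1 < 0" "a2 > 0"
    using mean by (auto simp: a1_def)
  have e0': "e0 = - a1 / (2 * a2)" "0 < e0" "e0 \<le> 1/2"
  proof -
    show eq: "e0 = - a1 / (2 * a2)"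
      by (simp add: e0 a1_def a2_def)
    show "0 < e0"
      unfolding eq using a12 by (intro divide_pos_pos) auto
    show "e0 \<le> 1/2"
      unfolding eq using a12 by (subst pos_divide_le_eq) auto
  qed
  have W': "W = (2 * T + 1 / \<bar>c\<bar>) * (4 * a2)" "W > 0"
  proof -
    have "2 * T + 1 / \<bar>c\<bar> > 0"
      using T_pos by (intro add_pos_nonneg) auto
    then show "W = (2 * T + 1 / \<bar>c\<bar>) * (4 * a2)" "W > 0"
      using a12 by (auto simp: W a2_def)
  qed
  have \<delta>': "lam * W * \<delta> = e0" "\<delta> > 0"
  proof -
    show "lam * W * \<delta> = e0"
      unfolding \<delta> using lam W'(2) by simp
    show "\<delta> > 0"
      unfolding \<delta> using lam W'(2) e0'(2) by (intro divide_pos_pos mult_pos_pos)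
  qed
  have gr: "g r \<ge> 0"
    using r by (intro g_nonneg) auto
  have small: "lam * g r * W \<le> r / 2"
  proof -
    have "lam * W * g r \<le> lam * W * (\<delta> * r)"
      using level(1) lam W' by (intro mult_left_mono) auto
    also have "\<dots> = e0 * r"
      using \<delta>'(1) by simp
    also have "\<dots> \<le> 1/2 * r"
      using e0' r by (intro mult_right_mono) auto
    finally show ?thesis
      by (simp add: mult_ac)
  qed
  have osc: "\<bar>g s - g r\<bar> \<le> e0 * g r" if s: "\<bar>s - r\<bar> \<le> lam * g r * W" for s
  proof -
    have sr: "r / 2 \<le> s" "s \<le> 3 * r / 2"
      using s small by (auto simp: abs_le_iff)
    have "\<bar>g s - g r\<bar> \<le> \<delta> * \<bar>s - r\<bar>"
    proof (rule g_diff_le)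
      fix t assume "min s r \<le> t" "t \<le> max s r"
      then have "r / 2 \<le> t" "t \<le> 3 * r / 2"
        using sr r by auto
      then show "\<bar>g' t\<bar> \<le> \<delta>"
        using level(2) by blast
    qed (use sr r in auto)
    also have "\<dots> \<le> \<delta> * (lam * g r * W)"
      using s \<delta>' by (intro mult_left_mono) auto
    also have "\<dots> = e0 * g r"
      unfolding \<delta>'(1)[symmetric] by simp
    finally show ?thesis .
  qed
  define Ab where "Ab i = integral {of_int (int i) * h..(of_int (int i) + 1) * h} (\<lambda>t. \<bar>a t\<bar>)" for i
  have int_sum: "(\<Sum>i<N. f (int i)) = (\<Sum>k\<in>{0..<int N}. f k)" for f :: "int \<Rightarrow> real"
  proof -
    have "{0..<int N} = int ` {..<N}"
      using image_int_atLeastLessThan[of 0 N] by (simp add: atLeast0LessThan)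
    then show ?thesis
      by (simp add: sum.reindex)
  qed
  have sums: "(\<Sum>i<N. cell h (int i)) = a1" "(\<Sum>i<N. Ab i) = a2"
    using cell_sums(2,3)[OF N h] int_sum[of "cell h"]
      int_sum[of "\<lambda>k. integral {of_int k * h..(of_int k + 1) * h} (\<lambda>t. \<bar>a t\<bar>)"]
    by (auto simp: a1_def a2_def Ab_def)
  obtain b where b: "\<forall>i<N. \<bar>b i - r\<bar> \<le> r / 2"
    "\<forall>i<N. resid c h lam (\<lambda>i. cell h (int i)) g N b i \<le> h\<^sup>2 * (lam * g r * (a1 + e0 * a2) / T)"
  proof (rule discrete_upper_solution[of N T h c "\<lambda>i. cell h (int i)" Ab a1 a2 e0 lam g r])
    show "\<bar>cell h (int i)\<bar> \<le> Ab i" for i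
      unfolding Ab_def by (rule cell_sums(1)[OF N h])
    show "lam * g r * ((2 * T + 1 / \<bar>c\<bar>) * (4 * a2)) \<le> r / 2"
      using small W' by simp
    show "\<bar>g s - g r\<bar> \<le> e0 * g r" if "\<bar>s - r\<bar> \<le> lam * g r * ((2 * T + 1 / \<bar>c\<bar>) * (4 * a2))" for s
      using osc that W' by simp
  qed (use N T_pos h ch sums e0' lam gr that in auto)
  have half: "a1 + e0 * a2 = a1 / 2"
    using e0'(1) a12 by (simp add: field_simps)
  have "h\<^sup>2 * (lam * g r * (a1 + e0 * a2) / T) = - (lam * g r * (- integral {0..T} a / 2) / T * h\<^sup>2)"
    unfolding half by (simp add: a1_def)
  then show ?thesis
    using that[of b] b by simp
qed

text \<open>The linear part of the residual is homogeneous, so one profile, independent of lam,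
  serves at every scale s. \<open>K\<close> is the reaction strength needed per unit of scale; only
  the scales 1 and 2 are used later.\<close>

definition scalable_bump :: "real \<Rightarrow> real \<Rightarrow> nat \<Rightarrow> real \<Rightarrow> (nat \<Rightarrow> real) \<Rightarrow> bool" where
  "scalable_bump \<rho> K N h al \<longleftrightarrow>
    (\<exists>m<N. al m = \<rho>) \<and> (\<forall>i. 0 \<le> al i \<and> al i \<le> 3 * \<rho> / 2) \<and>
    (\<forall>s lam i. s > 0 \<longrightarrow> lam \<ge> 0 \<longrightarrow>
      (\<forall>x. \<rho> / 2 \<le> x \<and> x \<le> 3 * \<rho> / 2 \<longrightarrow> lam * g (s * x) \<ge> s * K) \<longrightarrow> i < N \<longrightarrow>
      resid c h lam (\<lambda>i. cell h (int i)) g N (\<lambda>i. s * al i) i \<ge> 0)"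

text \<open>The bump bends only on a short window ending at \<tau>, whose mass is positive however
  short the window is. This is why \<tau> was chosen as a point charged from the left.\<close>

lemma bump_level:
  assumes xy: "0 \<le> x" "y \<le> T" and \<tau>: "x < \<tau>" "\<tau> < y"
    and supp: "\<forall>s. x \<le> s \<longrightarrow> s < \<tau> \<longrightarrow> integral {s..\<tau>} a > 0"
    and nn: "\<And>s t. x \<le> s \<Longrightarrow> s \<le> t \<Longrightarrow> t \<le> y \<Longrightarrow> integral {s..t} a \<ge> 0"
  obtains \<rho> K h0 where "\<rho> > 0" "K > 0" "h0 > 0" "\<bar>c\<bar> * h0 \<le> 1/2"
    "\<forall>N h. N > 0 \<longrightarrow> h = T / real N \<longrightarrow> h \<le> h0 \<longrightarrow> (\<exists>al. scalable_bump \<rho> K N h al)"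
proof -
  define d where "d = min (\<tau> - x) (y - \<tau>)"
  define e where "e = exp (2 * \<bar>c\<bar> * T)"
  \<comment> \<open>The height is a quarter of what slope 1/e achieves over the distance d. The
    window \<eta> and the mesh each cost at most \<rho>/4 of oscillation while bending, and the last
    term in \<open>h0\<close> ensures |c| h \<le> 1/2.\<close>
  define \<rho> where "\<rho> = d / (4 * e)"
  define \<eta> where "\<eta> = min (d / 4) (\<rho> / (4 * e))"
  define \<mu> where "\<mu> = integral {\<tau> - \<eta>..\<tau>} a"
  define h0 where "h0 = min (min (d / 8) (\<rho> / (4 * e))) (1 / (2 * (\<bar>c\<bar> + 1)))"
  have d: "d > 0" "d \<le> \<tau> - x" "d \<le> y - \<tau>"
    using \<tau> by (auto simp: d_def)
  have e: "e > 0"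
    by (simp add: e_def)
  have \<rho>: "\<rho> > 0" "\<rho> * e = d / 4"
    using d e by (auto simp: \<rho>_def)
  have \<eta>: "\<eta> > 0" "\<eta> \<le> d / 4" "e * \<eta> \<le> \<rho> / 4"
  proof -
    show "\<eta> > 0" "\<eta> \<le> d / 4"
      using d \<rho> e by (auto simp: \<eta>_def)
    have "e * \<eta> \<le> e * (\<rho> / (4 * e))"
      using e by (intro mult_left_mono) (auto simp: \<eta>_def)
    then show "e * \<eta> \<le> \<rho> / 4"
      using e by simp
  qed
  have \<mu>: "\<mu> > 0"
    unfolding \<mu>_def using supp \<eta> d by simp
  have h0: "h0 > 0" "h0 \<le> d / 8" "e * h0 \<le> \<rho> / 4" "\<bar>c\<bar> * h0 \<le> 1/2"
  proof -
    show "h0 > 0" "h0 \<le> d / 8"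
      using d \<rho> e by (auto simp: h0_def)
    have "e * h0 \<le> e * (\<rho> / (4 * e))"
      using e by (intro mult_left_mono) (auto simp: h0_def)
    then show "e * h0 \<le> \<rho> / 4"
      using e by simp
    have "\<bar>c\<bar> * h0 \<le> \<bar>c\<bar> * (1 / (2 * (\<bar>c\<bar> + 1)))"
      by (intro mult_left_mono) (auto simp: h0_def)
    also have "\<dots> \<le> 1/2"
      by (simp add: field_simps)
    finally show "\<bar>c\<bar> * h0 \<le> 1/2" .
  qed
  have main: "\<exists>al. scalable_bump \<rho> (2 * e / \<mu>) N h al"
    if N: "N > 0" and h: "h = T / real N" and hh: "h \<le> h0" for N h
  proof -
    have hp: "h > 0" "real N * h = T"
      using N T_pos by (auto simp: h)
    have ch: "\<bar>c\<bar> * h \<le> 1/2"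
      using mult_left_mono[OF hh, of "\<bar>c\<bar>"] h0(4) by simp
    have hd: "h \<le> d / 8" "e * h \<le> \<rho> / 4"
      using hh h0(2) order_trans[OF mult_left_mono[OF hh, of e] h0(3)] e by auto
    define fl where "fl t = nat \<lfloor>t / h\<rfloor>" for t
    have fl: "real (fl t) * h \<le> t" "t < (real (fl t) + 1) * h" if "t \<ge> 0" for t
      using floor_cell[OF hp(1), of t] that hp(1) by (auto simp: fl_def)
    have pos: "0 \<le> \<tau> - \<eta>" "0 \<le> \<tau>" "0 \<le> y"
      using xy \<tau> \<eta> d by auto
    \<comment> \<open>Cells strictly between l and r lie inside [x, y], where integrals of a are
      nonnegative. The -1 in r keeps r below N when y = T.\<close>
    define m0 m1 l r where "m0 = fl (\<tau> - \<eta>)" and "m1 = fl \<tau>" and "l = fl x" and "r = fl y - 1"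
    have fx: "real l * h \<le> x" "x < (real l + 1) * h"
      using fl[OF xy(1)] by (auto simp: l_def)
    have fm0: "real m0 * h \<le> \<tau> - \<eta>" "\<tau> - \<eta> < (real m0 + 1) * h"
      using fl[OF pos(1)] by (auto simp: m0_def)
    have fm1: "real m1 * h \<le> \<tau>" "\<tau> < (real m1 + 1) * h"
      using fl[OF pos(2)] by (auto simp: m1_def)
    have fy: "real (fl y) * h \<le> y" "y < (real (fl y) + 1) * h"
      using fl[OF pos(3)] by auto
    have "fl y \<noteq> 0"
      using fy(2) hd d \<tau> xy by (cases "fl y") auto
    then have ry: "fl y = Suc r" "real (fl y) = real r + 1"
      by (auto simp: r_def)
    have lt: "a' < b'" if "real a' * h < real b' * h" for a' b'
      using that hp(1) by simp
    have m0m1: "m0 \<le> m1"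
      unfolding m0_def m1_def fl_def using hp(1) \<eta>
      by (intro nat_mono floor_mono divide_right_mono) auto
    have lm0: "h * (real m0 - real l) \<ge> \<rho> * e"
    proof -
      have "h * (real m0 - real l) \<ge> (\<tau> - \<eta> - h) - x"
        using fm0(2) fx(1) by (simp add: algebra_simps)
      then show ?thesis
        using d \<eta> hd \<rho>(2) by linarith
    qed
    have rm1: "h * (real r - real m1) \<ge> 3 * \<rho> / 2 * e"
    proof -
      have "h * (real r - real m1) \<ge> (y - 2 * h) - \<tau>"
        using fy(2) fm1(1) ry by (simp add: algebra_simps)
      moreover have "3 * \<rho> / 2 * e = 3 * d / 8"
        using \<rho>(2) by simp
      ultimately show ?thesis
        using d hd by linarith
    qed
    have pos_diff: "a' < b'" if "h * (real b' - real a') > 0" for a' b'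
      using that hp(1) by (simp add: zero_less_mult_iff)
    have l_m0: "l < m0"
      using lm0 mult_pos_pos[OF \<rho>(1) e] by (intro pos_diff) linarith
    have m1_r: "m1 < r"
      using rm1 mult_pos_pos[OF \<rho>(1) e] by (intro pos_diff) linarith
    have rN: "r < N"
    proof (rule lt)
      have "real r * h < real (fl y) * h"
        using ry(2) hp(1) by simp
      then show "real r * h < real N * h"
        using fy(1) xy hp(2) by linarith
    qed
    have cell_nonneg: "cell h (int j) \<ge> 0" if "l < j" "j < r" for j
    proof -
      have "(real l + 1) * h \<le> real j * h" "(real j + 1) * h \<le> real r * h"
        using that hp(1) by (auto intro!: mult_right_mono)
      moreover have "real r * h \<le> real (fl y) * h" "real j * h \<le> (real j + 1) * h"
        using ry(2) hp(1) by auto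
      ultimately show ?thesis
        unfolding cell_def using fx fy by (simp add: nn)
    qed
    \<comment> \<open>The cells m0, ..., m1 cover the window; what they cover beyond it still lies
      in [x, y] and adds nonnegative mass.\<close>
    have sum_ge: "(\<Sum>j=m0..m1. cell h (int j)) \<ge> \<mu>"
    proof -
      have "(\<Sum>j=m0..m1. cell h (int j)) = (\<Sum>k\<in>{int m0..<int m1 + 1}. cell h k)"
      proof -
        have "{int m0..<int m1 + 1} = int ` {m0..m1}"
          using image_int_atLeastAtMost[of m0 m1] by auto
        then show ?thesis
          by (simp add: sum.reindex)
      qed
      also have "\<dots> = integral {real m0 * h..(real m1 + 1) * h} a"
        using integral_unique[OF has_integral_step_product[OF hp(1) a_int(1), of "int m0" "int m1 + 1" "\<lambda>_. 1"]] m0m1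
        by (simp add: cell_def)
      also have "\<dots> = integral {real m0 * h..\<tau> - \<eta>} a + (integral {\<tau> - \<eta>..\<tau>} a + integral {\<tau>..(real m1 + 1) * h} a)"
        using fm0 fm1 \<eta>(1) a_int(1) by (simp add: Henstock_Kurzweil_Integration.integral_combine)
      also have "\<dots> \<ge> 0 + (\<mu> + 0)"
      proof -
        have "(real l + 1) * h \<le> real m0 * h" "(real m1 + 1) * h \<le> real r * h" "real r * h \<le> real (fl y) * h"
          using l_m0 m1_r ry(2) hp(1) by (auto intro!: mult_right_mono)
        then have "integral {real m0 * h..\<tau> - \<eta>} a \<ge> 0" "integral {\<tau>..(real m1 + 1) * h} a \<ge> 0"
          using fx fy fm0 fm1 \<tau> \<eta> d by (auto intro!: nn)
        then show ?thesis
          unfolding \<mu>_def by linarith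
      qed
      finally show ?thesis
        by simp
    qed
    have width: "h * e * (real m1 - real m0) \<le> \<rho> / 2"
    proof -
      have "h * (real m1 - real m0) \<le> \<eta> + h"
        using fm0(2) fm1(1) by (simp add: algebra_simps)
      then have "e * (h * (real m1 - real m0)) \<le> e * (\<eta> + h)"
        using e by (intro mult_left_mono) auto
      then show ?thesis
        using \<eta>(3) hd(2) by (simp add: algebra_simps)
    qed
    have pow: "1 / e \<le> (1 + c * h) ^ k \<and> (1 + c * h) ^ k \<le> e" if "k \<le> N" for k
    proof -
      have "real k * h \<le> T"
        unfolding hp(2)[symmetric] using that hp(1) by (intro mult_right_mono) auto
      then show ?thesis
        unfolding e_def using power_one_plus_bounds[OF hp(1) ch] by blast
    qed
    obtain al where al: "\<forall>i. 0 \<le> al i \<and> al i \<le> 3 * \<rho> / 2" "al m0 = \<rho>"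
      and al': "\<forall>s lam g i. s > 0 \<longrightarrow> g 0 = 0 \<longrightarrow> (\<forall>x\<ge>0. g x \<ge> 0) \<longrightarrow> lam \<ge> 0 \<longrightarrow>
       (\<forall>x. \<rho> / 2 \<le> x \<and> x \<le> 3 * \<rho> / 2 \<longrightarrow> lam * g (s * x) \<ge> s * (2 * e / \<mu>)) \<longrightarrow> i < N \<longrightarrow>
       resid c h lam (\<lambda>i. cell h (int i)) g N (\<lambda>i. s * al i) i \<ge> 0"
    proof (rule discrete_lower_solution[where A = "\<lambda>j. cell h (int j)", OF hp(1) ch _ e m0m1 m1_r rN
          less_imp_le[OF l_m0] \<rho>(1) width lm0 rm1 _ sum_ge \<mu>])
      show "1 / e \<le> (1 + c * h) ^ k \<and> (1 + c * h) ^ k \<le> e" if "k \<le> N" for k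
        by (rule pow[OF that])
      show "0 \<le> cell h (int j)" if "l < j" "j < r" for j
        by (rule cell_nonneg[OF that])
    qed (rule that)
    have "\<forall>x\<ge>0. g x \<ge> 0"
      using g_nonneg by blast
    then have "\<forall>s lam i. s > 0 \<longrightarrow> lam \<ge> 0 \<longrightarrow>
        (\<forall>x. \<rho> / 2 \<le> x \<and> x \<le> 3 * \<rho> / 2 \<longrightarrow> lam * g (s * x) \<ge> s * (2 * e / \<mu>)) \<longrightarrow> i < N \<longrightarrow>
        resid c h lam (\<lambda>i. cell h (int i)) g N (\<lambda>i. s * al i) i \<ge> 0"
      using al' g_zero by simp
    moreover have "m0 < N"
      using m0m1 m1_r rN by linarith
    ultimately have "scalable_bump \<rho> (2 * e / \<mu>) N h al"
      unfolding scalable_bump_def using al by blast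
    then show ?thesis
      by blast
  qed
  have "2 * e / \<mu> > 0"
    using e \<mu> by simp
  show ?thesis
    by (rule that[OF \<rho>(1) \<open>2 * e / \<mu> > 0\<close> h0(1,4)]) (intro allI impI main)
qed

end

section \<open>Two solutions for large parameters\<close>

text \<open>The sites have positions in a compact interval; along a convergent subsequence the
  common Lipschitz bounds carry the values at the sites to the limit functions. A linear inequality
  in both sequences covers the two nontriviality conditions and the comparison at once.\<close>

lemma touching_point:
  fixes Z W :: "nat \<Rightarrow> int \<Rightarrow> real" and h :: "nat \<Rightarrow> real" and i :: "nat \<Rightarrow> int"
  assumes h: "\<And>n. h n > 0" "h \<longlonglongrightarrow> 0"
    and Z: "\<forall>t. (\<lambda>n. Z n \<lfloor>t / h n\<rfloor>) \<longlonglongrightarrow> u t" "\<forall>n k l. \<bar>Z n k - Z n l\<bar> \<le> M * h n * \<bar>of_int (k - l)\<bar>" "M > 0"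
    and W: "\<forall>t. (\<lambda>n. W n \<lfloor>t / h n\<rfloor>) \<longlonglongrightarrow> w t" "\<forall>n k l. \<bar>W n k - W n l\<bar> \<le> M' * h n * \<bar>of_int (k - l)\<bar>" "M' > 0"
    and i: "\<And>n. of_int (i n) * h n \<in> {0..T}" and ineq: "\<And>n. \<gamma> \<le> \<alpha> * Z n (i n) + \<beta> * W n (i n)"
  obtains t where "\<gamma> \<le> \<alpha> * u t + \<beta> * w t"
proof -
  define p where "p n = of_int (i n) * h n" for n
  have "seq_compact {0..T}"
    by (simp add: compact_imp_seq_compact)
  moreover have "\<forall>n. p n \<in> {0..T}"
    using i by (simp add: p_def)
  ultimately obtain l s where s: "strict_mono (s :: nat \<Rightarrow> nat)" "(p \<circ> s) \<longlonglongrightarrow> l"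
    unfolding seq_compact_def by blast
  have hs: "(\<lambda>n. h (s n)) \<longlonglongrightarrow> 0"
    using LIMSEQ_subseq_LIMSEQ[OF h(2) s(1)] by (simp add: comp_def)
  have conv: "(\<lambda>n. V (s n) (i (s n))) \<longlonglongrightarrow> v l"
    if V: "\<forall>t. (\<lambda>n. V n \<lfloor>t / h n\<rfloor>) \<longlonglongrightarrow> v t" "\<forall>n k l. \<bar>V n k - V n l\<bar> \<le> K * h n * \<bar>of_int (k - l)\<bar>" "K > 0"
    for V :: "nat \<Rightarrow> int \<Rightarrow> real" and v K
  proof -
    have "(\<lambda>n. V (s n) \<lfloor>l / h (s n)\<rfloor>) \<longlonglongrightarrow> v l"
      using LIMSEQ_subseq_LIMSEQ[OF V(1)[rule_format, of l] s(1)] by (simp add: comp_def)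
    moreover have "(\<lambda>n. V (s n) (i (s n)) - V (s n) \<lfloor>l / h (s n)\<rfloor>) \<longlonglongrightarrow> 0"
    proof (rule tendsto_rabs_zero_cancel, rule tendsto_sandwich[of "\<lambda>_. 0"])
      show "\<forall>\<^sub>F n in sequentially. \<bar>V (s n) (i (s n)) - V (s n) \<lfloor>l / h (s n)\<rfloor>\<bar> \<le> K * (\<bar>p (s n) - l\<bar> + h (s n))"
      proof (intro always_eventually allI)
        fix n
        have "h (s n) * \<bar>of_int (i (s n) - \<lfloor>l / h (s n)\<rfloor>)\<bar> = \<bar>p (s n) - of_int \<lfloor>l / h (s n)\<rfloor> * h (s n)\<bar>"
        proof -
          have "p (s n) - of_int \<lfloor>l / h (s n)\<rfloor> * h (s n) = h (s n) * of_int (i (s n) - \<lfloor>l / h (s n)\<rfloor>)"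
            by (simp add: p_def algebra_simps)
          then show ?thesis
            using h(1)[of "s n"] by (simp add: abs_mult)
        qed
        also have "\<dots> \<le> \<bar>p (s n) - l\<bar> + h (s n)"
          using floor_cell[OF h(1)[of "s n"], of l] by (simp add: distrib_right)
        finally have "K * (h (s n) * \<bar>of_int (i (s n) - \<lfloor>l / h (s n)\<rfloor>)\<bar>) \<le> K * (\<bar>p (s n) - l\<bar> + h (s n))"
          using V(3) by (intro mult_left_mono) auto
        then show "\<bar>V (s n) (i (s n)) - V (s n) \<lfloor>l / h (s n)\<rfloor>\<bar> \<le> K * (\<bar>p (s n) - l\<bar> + h (s n))"
          using V(2)[rule_format, of "s n" "i (s n)" "\<lfloor>l / h (s n)\<rfloor>"] by (simp add: mult.assoc)
      qed
      have "(\<lambda>n. K * (\<bar>p (s n) - l\<bar> + h (s n))) \<longlonglongrightarrow> K * (\<bar>l - l\<bar> + 0)"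
        using s(2) by (intro tendsto_intros hs) (simp add: comp_def)
      then show "(\<lambda>n. K * (\<bar>p (s n) - l\<bar> + h (s n))) \<longlonglongrightarrow> 0"
        by simp
    qed auto
    ultimately show ?thesis
      using tendsto_add by fastforce
  qed
  have "(\<lambda>n. \<alpha> * Z (s n) (i (s n)) + \<beta> * W (s n) (i (s n))) \<longlonglongrightarrow> \<alpha> * u l + \<beta> * w l"
    by (intro tendsto_intros conv[OF Z] conv[OF W])
  then have "\<gamma> \<le> \<alpha> * u l + \<beta> * w l"
    using ineq by (intro LIMSEQ_le_const) auto
  then show ?thesis
    by (rule that)
qed

context indefinite_equation
begin

lemma cell_periodic:
  assumes N: "N > 0" and h: "h = T / real N"
  shows "cell h (k + int N) = cell h k"
proof -
  have "a \<circ> (+) T = a"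
    using periodic_withD[OF a_per] by (simp add: fun_eq_iff add.commute)
  then have "integral {of_int k * h..(of_int k + 1) * h} a
      = integral {of_int k * h + T..(of_int k + 1) * h + T} a"
    using integral_shift_Icc_real[of "of_int k * h" "(of_int k + 1) * h" a T] by simp
  moreover have "T = real N * h"
    using N by (simp add: h)
  ultimately show ?thesis
    by (simp add: cell_def algebra_simps)
qed

text \<open>Replaces cyclic indices by periodic sequences on the integers, where the limit arguments
  need no wrap-around.\<close>

lemma resid_periodic_extension:
  assumes N: "N > 0" and h: "h = T / real N"
    and x: "\<forall>i<N. \<bar>resid c h lam (\<lambda>i. cell h (int i)) g N x i\<bar> \<le> B"
    and X: "\<And>k. X k = x (nat (k mod int N))"
  shows "\<bar>(1 + c * h) * (X (k + 1) - X k) - (X k - X (k - 1)) + h * lam * cell h k * g (X k)\<bar> \<le> B"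
proof -
  define i where "i = nat (k mod int N)"
  have i: "int i = k mod int N" "i < N"
    using N by (auto simp: i_def nat_less_iff)
  have "cell h k = cell h (int i)"
    unfolding i(1) by (rule periodic_int_mod[symmetric]) (rule cell_periodic[OF N h])
  moreover have "X k = x i"
    by (simp add: X i_def)
  moreover have "X (k + 1) = x (nxt N i)"
  proof -
    have "(k + 1) mod int N = int (nxt N i)"
      unfolding nxt_def zmod_int of_nat_Suc i(1) by (simp add: mod_simps add.commute)
    then show ?thesis
      by (simp add: X)
  qed
  moreover have "X (k - 1) = x (prv N i)"
  proof -
    have "int (i + N - 1) = k mod int N + int N - 1"
      using N i by simp
    then have "int (prv N i) = (k mod int N + int N - 1) mod int N"
      unfolding prv_def zmod_int by simp
    also have "\<dots> = (k mod int N - 1 + int N) mod int N"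
      by (simp add: algebra_simps)
    also have "\<dots> = (k - 1) mod int N"
      by (simp add: mod_simps)
    finally have "(k - 1) mod int N = int (prv N i)"
      by simp
    then show ?thesis
      by (simp add: X)
  qed
  ultimately show ?thesis
    using x i(2) by (simp add: resid_def)
qed

text \<open>All conditions are closed and so survive the limit: values of at least r exclude the
  zero limit, and \<open>2 * q i \<le> p i\<close> excludes equal positive limits.\<close>

definition discrete_pair ::
    "real \<Rightarrow> real \<Rightarrow> real \<Rightarrow> real \<Rightarrow> nat \<Rightarrow> real \<Rightarrow> (nat \<Rightarrow> real) \<Rightarrow> (nat \<Rightarrow> real) \<Rightarrow> bool" where
  "discrete_pair lam C r eps N h p q \<longleftrightarrow>
    (\<forall>i<N. 0 \<le> p i \<and> p i \<le> C) \<and> (\<forall>i<N. 0 \<le> q i \<and> q i \<le> C) \<and>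
    (\<forall>i<N. \<bar>resid c h lam (\<lambda>i. cell h (int i)) g N p i\<bar> \<le> eps * h\<^sup>2) \<and>
    (\<forall>i<N. \<bar>resid c h lam (\<lambda>i. cell h (int i)) g N q i\<bar> \<le> eps * h\<^sup>2) \<and>
    (\<exists>i<N. r \<le> p i) \<and> (\<exists>i<N. r \<le> q i) \<and> (\<exists>i<N. 2 * q i \<le> p i)"

text \<open>The quantifier order is the point: \<open>C\<close> and \<open>r\<close> depend on lam
  but neither on the tolerance nor on the mesh, and lam1 is fixed by the bump alone.\<close>

lemma discrete_pairs:
  assumes mean: "integral {0..T} a < 0" and xy: "0 \<le> x" "x \<le> y" "y \<le> T"
    and nn: "\<And>s t. x \<le> s \<Longrightarrow> s \<le> t \<Longrightarrow> t \<le> y \<Longrightarrow> integral {s..t} a \<ge> 0" and pos: "integral {x..y} a > 0"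
  obtains lam1 where "lam1 > 0" "\<forall>lam>lam1. \<exists>C r. r > 0 \<and> (\<forall>eps>0. \<exists>N0. \<forall>N\<ge>N0. N > 0 \<longrightarrow>
    (\<exists>p q. discrete_pair lam C r eps N (T / N) p q))"
proof -
  obtain \<tau> where \<tau>: "x < \<tau>" "\<tau> < y" "\<forall>s. x \<le> s \<longrightarrow> s < \<tau> \<longrightarrow> integral {s..\<tau>} a > 0"
    using left_support_point[OF a_int(1) xy(2) pos] by metis
  obtain \<rho> K h0 where \<rho>: "\<rho> > 0" and K: "K > 0" and h0: "h0 > 0" "\<bar>c\<bar> * h0 \<le> 1/2"
    and bump: "\<forall>N h. N > 0 \<longrightarrow> h = T / real N \<longrightarrow> h \<le> h0 \<longrightarrow> (\<exists>al. scalable_bump \<rho> K N h al)"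
  proof (rule bump_level[OF xy(1,3) \<tau>])
    show "0 \<le> integral {s..t} a" if "x \<le> s" "s \<le> t" "t \<le> y" for s t
      by (rule nn[OF that])
  qed (rule that)
  obtain \<gamma> where \<gamma>: "\<gamma> > 0" "\<And>s. \<rho> / 2 \<le> s \<Longrightarrow> s \<le> 3 * \<rho> \<Longrightarrow> \<gamma> \<le> g s"
  proof -
    have "continuous_on {\<rho> / 2..3 * \<rho>} g"
      by (rule continuous_on_subset[OF g_continuous]) (use \<rho> in auto)
    then obtain s0 where s0: "s0 \<in> {\<rho> / 2..3 * \<rho>}" "\<forall>s\<in>{\<rho> / 2..3 * \<rho>}. g s0 \<le> g s"
      using continuous_attains_inf[of "{\<rho> / 2..3 * \<rho>}" g] \<rho> by auto
    then show ?thesis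
      using that[of "g s0"] g_pos[of s0] \<rho> by auto
  qed
  \<comment> \<open>\<open>\<gamma>\<close> is a lower bound of g on [\<rho>/2, 3 \<rho>], which
    contains the relevant values of the bump and of its double; the factor 2 serves the scale s =
    2.\<close>
  define lam1 where "lam1 = 2 * K / \<gamma>"
  have lam1: "lam1 > 0"
    using K \<gamma> by (simp add: lam1_def)
  have "\<exists>C r. r > 0 \<and> (\<forall>eps>0. \<exists>N0. \<forall>N\<ge>N0. N > 0 \<longrightarrow>
    (\<exists>p q. discrete_pair lam C r eps N (T / N) p q))" if lam: "lam > lam1" for lam
  proof -
    have lp: "lam > 0"
      using lam lam1 by simp
    have big: "lam * g (s * z) \<ge> s * K" if "s = 1 \<or> s = 2" "\<rho> / 2 \<le> z \<and> z \<le> 3 * \<rho> / 2" for s z :: real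
    proof -
      have "\<gamma> \<le> g (s * z)"
        using that \<rho> by (intro \<gamma>(2)) auto
      then have "lam1 * \<gamma> \<le> lam * g (s * z)"
        using lam lam1 \<gamma>(1) by (intro mult_mono) auto
      moreover have "lam1 * \<gamma> = 2 * K"
        using \<gamma>(1) by (simp add: lam1_def)
      ultimately show ?thesis
        using that(1) K by auto
    qed
    define a1 a2 where "a1 = integral {0..T} a" and "a2 = integral {0..T} (\<lambda>t. \<bar>a t\<bar>)"
    have "norm a1 \<le> a2"
      unfolding a1_def a2_def by (intro integral_norm_bound_integral a_int) auto
    then have a12: "a1 < 0" "a2 > 0"
      using mean by (auto simp: a1_def)
    define W where "W = (2 * T + 1 / \<bar>c\<bar>) * (4 * a2)"
    define e0 where "e0 = - a1 / (2 * a2)"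
    define \<delta> where "\<delta> = e0 / (lam * W)"
    have "W > 0"
    proof -
      have "2 * T + 1 / \<bar>c\<bar> > 0"
        using T_pos by (intro add_pos_nonneg) auto
      then show ?thesis
        using a12 by (simp add: W_def)
    qed
    then have \<delta>: "\<delta> > 0"
      unfolding \<delta>_def e0_def using a12 lp by (intro divide_pos_pos mult_pos_pos) auto
    obtain r0 where r0: "r0 > 0" "\<forall>r. 0 < r \<longrightarrow> r \<le> r0 \<longrightarrow> g r \<le> \<delta> * r \<and> (\<forall>s. r / 2 \<le> s \<longrightarrow> s \<le> 3 * r / 2 \<longrightarrow> \<bar>g' s\<bar> \<le> \<delta>)"
      by (rule small_level[OF \<delta>], rule that, assumption+)
    obtain R0 where R0: "R0 > 0" "\<forall>r. R0 \<le> r \<longrightarrow> g r \<le> \<delta> * r \<and> (\<forall>s. r / 2 \<le> s \<longrightarrow> s \<le> 3 * r / 2 \<longrightarrow> \<bar>g' s\<bar> \<le> \<delta>)"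
      by (rule large_level[OF \<delta>], rule that, assumption+)
    \<comment> \<open>These caps order the barriers: b \<le> 3 r/2 < \<rho> at the site where the
      bump has height \<rho>, and hi \<ge> R/2 \<ge> 3 \<rho> \<ge> 2 al everywhere.\<close>
    define r where "r = min r0 (\<rho> / 2)"
    define R where "R = max R0 (6 * \<rho>)"
    have r: "r > 0" "r \<le> r0" "r \<le> \<rho> / 2" and R: "R0 \<le> R" "6 * \<rho> \<le> R" "R > 0"
      using r0 R0 \<rho> by (auto simp: r_def R_def)
    define m where "m = min (lam * g r * (- a1 / 2) / T) (lam * g R * (- a1 / 2) / T)"
    have m: "m > 0"
      unfolding m_def min_less_iff_conj using lp g_pos[OF r(1)] g_pos[OF R(3)] a12 T_pos
      by (intro conjI divide_pos_pos mult_pos_pos) auto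
    obtain D where D: "D > 0" "\<And>s. s \<ge> 0 \<Longrightarrow> \<bar>g' s\<bar> \<le> D"
      using g'_bounded by blast
    have glip: "\<bar>g s - g t\<bar> \<le> D * \<bar>s - t\<bar>" if "0 \<le> s" "0 \<le> t" for s t
      by (rule g_diff_le) (use D that in auto)
    have pairs: "\<exists>p q. discrete_pair lam (3 * R / 2) (r / 2) eps N h p q"
      if eps: "eps > 0" and N: "N > 0" and h: "h = T / real N" and hh: "h \<le> h0" for eps N h
    proof -
      have hp: "h > 0"
        using N T_pos by (simp add: h)
      have ch: "\<bar>c\<bar> * h \<le> 1/2"
        using mult_left_mono[OF hh, of "\<bar>c\<bar>"] h0(2) by simp
      let ?A = "\<lambda>i. cell h (int i)"
      obtain b where b: "\<forall>i<N. \<bar>b i - r\<bar> \<le> r / 2"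
        "\<forall>i<N. resid c h lam ?A g N b i \<le> - (lam * g r * (- integral {0..T} a / 2) / T * h\<^sup>2)"
        by (rule upper_level[OF lp mean r(1) W_def[unfolded a2_def] e0_def[unfolded a1_def a2_def] \<delta>_def _ _ N h ch])
          (use r0(2) r in blast, use r0(2) r in blast, rule that)
      obtain hi where hi: "\<forall>i<N. \<bar>hi i - R\<bar> \<le> R / 2"
        "\<forall>i<N. resid c h lam ?A g N hi i \<le> - (lam * g R * (- integral {0..T} a / 2) / T * h\<^sup>2)"
        by (rule upper_level[OF lp mean R(3) W_def[unfolded a2_def] e0_def[unfolded a1_def a2_def] \<delta>_def _ _ N h ch])
          (use R0(2) R in blast, use R0(2) R in blast, rule that)
      obtain al where "scalable_bump \<rho> K N h al"
        using bump[rule_format, OF N h hh] by blast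
      then obtain m0 where al: "m0 < N" "al m0 = \<rho>" "\<forall>i. 0 \<le> al i \<and> al i \<le> 3 * \<rho> / 2"
        and al': "\<forall>s lam i. s > 0 \<longrightarrow> lam \<ge> 0 \<longrightarrow>
          (\<forall>x. \<rho> / 2 \<le> x \<and> x \<le> 3 * \<rho> / 2 \<longrightarrow> lam * g (s * x) \<ge> s * K) \<longrightarrow> i < N \<longrightarrow>
          resid c h lam ?A g N (\<lambda>i. s * al i) i \<ge> 0"
        unfolding scalable_bump_def by blast
      have ral: "0 \<le> resid c h lam ?A g N (\<lambda>i. s * al i) i" if "s = 1 \<or> s = 2" "i < N" for s i
        using al'[rule_format, of s lam i] big[OF that(1)] that lp by auto
      have b_bounds: "r / 2 \<le> b i" "b i \<le> 3 * r / 2" and hi_bounds: "R / 2 \<le> hi i" "hi i \<le> 3 * R / 2"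
        if "i < N" for i
        using b(1)[rule_format, OF that] hi(1)[rule_format, OF that] by linarith+
      have le_m: "- (z * h\<^sup>2) \<le> - (m * h\<^sup>2)" if "m \<le> z" for z
        using that by (simp add: mult_right_mono)
      define eps' where "eps' = min (eps / 2) (m / 2)"
      have eps': "0 < eps'" "eps' < m" "2 * eps' * h\<^sup>2 \<le> eps * h\<^sup>2"
        using eps m by (auto simp: eps'_def intro!: mult_right_mono)
      obtain p q where pq: "\<forall>i<N. 0 \<le> p i \<and> p i \<le> 3 * R / 2" "\<forall>i<N. 0 \<le> q i \<and> q i \<le> 3 * R / 2"
        "\<forall>i<N. \<bar>resid c h lam ?A g N p i\<bar> \<le> 2 * eps' * h\<^sup>2"
        "\<forall>i<N. \<bar>resid c h lam ?A g N q i\<bar> \<le> 2 * eps' * h\<^sup>2"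
        "\<forall>i<N. 2 * al i \<le> p i" "\<exists>i<N. b i < q i" "\<exists>i<N. q i < al i"
      proof (rule discrete_two_solutions[of N h c lam g D b hi "3 * R / 2" ?A m eps' al])
        show "0 \<le> b i \<and> b i \<le> hi i" if "i < N" for i
          using b_bounds[OF that] hi_bounds[OF that] r R \<rho> by auto
        show "hi i \<le> 3 * R / 2" if "i < N" for i
          using hi_bounds[OF that] by simp
        show "resid c h lam ?A g N b i \<le> - (m * h\<^sup>2)" if "i < N" for i
          using b(2)[rule_format, OF that] le_m[of "lam * g r * (- a1 / 2) / T"] by (simp add: m_def a1_def)
        show "resid c h lam ?A g N hi i \<le> - (m * h\<^sup>2)" if "i < N" for i
          using hi(2)[rule_format, OF that] le_m[of "lam * g R * (- a1 / 2) / T"] by (simp add: m_def a1_def)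
        show "0 \<le> al i \<and> 2 * al i \<le> hi i" if "i < N" for i
          using al(3)[rule_format, of i] hi_bounds(1)[OF that] R \<rho> by auto
        show "0 \<le> resid c h lam ?A g N al i" if "i < N" for i
          using ral[of 1 i] that by simp
        show "0 \<le> resid c h lam ?A g N (\<lambda>i. 2 * al i) i" if "i < N" for i
          using ral[of 2 i] that by simp
        show "\<exists>i<N. b i < al i"
          using al(1,2) b_bounds(2)[OF al(1)] r \<rho> by (intro exI[of _ m0]) auto
      qed (use N hp ch lp g_zero glip eps' that in auto)
      have "\<exists>i<N. r / 2 \<le> p i"
        using pq(5) al r \<rho> by (intro exI[of _ m0]) force
      moreover have "\<exists>i<N. r / 2 \<le> q i"
        using pq(6) b_bounds(1) by (meson less_imp_le order_trans)
      moreover have "\<exists>i<N. 2 * q i \<le> p i"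
      proof -
        obtain i where "i < N" "q i < al i"
          using pq(7) by blast
        then show ?thesis
          using pq(5)[rule_format, of i] by (intro exI[of _ i]) linarith
      qed
      moreover have "\<forall>i<N. \<bar>resid c h lam ?A g N p i\<bar> \<le> eps * h\<^sup>2" "\<forall>i<N. \<bar>resid c h lam ?A g N q i\<bar> \<le> eps * h\<^sup>2"
        using pq(3,4) eps'(3) by (meson order_trans)+
      ultimately show ?thesis
        unfolding discrete_pair_def using pq(1,2) by blast
    qed
    have fine: "T / real N \<le> h0" if "N \<ge> nat \<lceil>T / h0\<rceil>" "N > 0" for N
    proof -
      have "T / h0 \<le> real N"
        using that(1) by linarith
      then show ?thesis
        using h0(1) that(2) by (simp add: field_simps)
    qed
    show ?thesis
    proof (rule exI[of _ "3 * R / 2"], rule exI[of _ "r / 2"], intro conjI allI impI)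
      fix eps :: real assume eps: "eps > 0"
      show "\<exists>N0. \<forall>N\<ge>N0. N > 0 \<longrightarrow> (\<exists>p q. discrete_pair lam (3 * R / 2) (r / 2) eps N (T / N) p q)"
      proof (rule exI[of _ "nat \<lceil>T / h0\<rceil>"], intro allI impI, goal_cases)
        case (1 N)
        show ?case
          by (rule pairs[OF eps 1(2) refl fine[OF 1]])
      qed
    qed (use r(1) in simp)
  qed
  then show ?thesis
    by (intro that[OF lam1] allI impI)
qed

theorem two_solutions_large_parameter:
  assumes mean: "integral {0..T} a < 0" and xy: "0 \<le> x" "x \<le> y" "y \<le> T"
    and nn: "\<And>s t. x \<le> s \<Longrightarrow> s \<le> t \<Longrightarrow> t \<le> y \<Longrightarrow> integral {s..t} a \<ge> 0" and pos: "integral {x..y} a > 0"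
  obtains lam1 where "lam1 > 0" "\<forall>lam>lam1. \<exists>u1 u2. u1 \<noteq> u2 \<and>
    positive_periodic_solution T c lam a g u1 \<and> positive_periodic_solution T c lam a g u2"
proof -
  obtain lam1 where lam1: "lam1 > 0" and disc: "\<forall>lam>lam1. \<exists>C r. r > 0 \<and> (\<forall>eps>0. \<exists>N0. \<forall>N\<ge>N0. N > 0 \<longrightarrow>
    (\<exists>p q. discrete_pair lam C r eps N (T / N) p q))"
  proof (rule discrete_pairs[OF mean xy _ pos])
    show "0 \<le> integral {s..t} a" if "x \<le> s" "s \<le> t" "t \<le> y" for s t
      by (rule nn[OF that])
  qed (rule that)
  have "\<exists>u1 u2. u1 \<noteq> u2 \<and> positive_periodic_solution T c lam a g u1 \<and> positive_periodic_solution T c lam a g u2"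
    if lam: "lam > lam1" for lam
  proof -
    have lp: "lam > 0"
      using lam lam1 by simp
    obtain C r where r: "r > 0" and CR: "\<forall>eps>0. \<exists>N0. \<forall>N\<ge>N0. N > 0 \<longrightarrow>
        (\<exists>p q. discrete_pair lam C r eps N (T / N) p q)"
      using disc[rule_format, OF lam] by blast
    define e :: "nat \<Rightarrow> real" where "e n = 1 / (real n + 1)" for n
    have "\<exists>N p q. N > n \<and> discrete_pair lam C r (e n) N (T / N) p q" for n
    proof -
      have "e n > 0"
        by (simp add: e_def)
      from CR[rule_format, OF this] obtain N0 where N0: "\<forall>N\<ge>N0. N > 0 \<longrightarrow> (\<exists>p q. discrete_pair lam C r (e n) N (T / N) p q)"
        by blast
      \<comment> \<open>Meshes finer than 1/n in proportion are requested explicitly, since the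
        discrete statement alone does not make the width tend to 0.\<close>
      have "max N0 (Suc n) \<ge> N0" "max N0 (Suc n) > 0" "max N0 (Suc n) > n"
        by auto
      then show ?thesis
        using N0 by blast
    qed
    then obtain Np p q where Np: "\<And>n. Np n > n" and G: "\<And>n. discrete_pair lam C r (e n) (Np n) (T / Np n) (p n) (q n)"
      by metis
    have pq: "\<forall>i<Np n. 0 \<le> p n i \<and> p n i \<le> C" "\<forall>i<Np n. 0 \<le> q n i \<and> q n i \<le> C"
        "\<forall>i<Np n. \<bar>resid c (T / Np n) lam (\<lambda>i. cell (T / Np n) (int i)) g (Np n) (p n) i\<bar> \<le> e n * (T / Np n)\<^sup>2"
        "\<forall>i<Np n. \<bar>resid c (T / Np n) lam (\<lambda>i. cell (T / Np n) (int i)) g (Np n) (q n) i\<bar> \<le> e n * (T / Np n)\<^sup>2"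
        "\<exists>i<Np n. r \<le> p n i" "\<exists>i<Np n. r \<le> q n i" "\<exists>i<Np n. 2 * q n i \<le> p n i" for n
      using G[of n] unfolding discrete_pair_def by auto
    define h where "h n = T / real (Np n)" for n
    have Np0: "Np n > 0" for n
      using Np[of n] by simp
    have hp: "h n > 0" "real (Np n) * h n = T" for n
      using Np0[of n] T_pos by (auto simp: h_def)
    have e: "0 \<le> e n" "e \<longlonglongrightarrow> 0" for n
    proof -
      show "0 \<le> e n"
        by (simp add: e_def)
      show "e \<longlonglongrightarrow> 0"
        using LIMSEQ_inverse_real_of_nat by (simp add: e_def[abs_def] inverse_eq_divide add.commute)
    qed
    have h0: "h \<longlonglongrightarrow> 0"
    proof (rule tendsto_sandwich[of "\<lambda>_. 0"])
      show "\<forall>\<^sub>F n in sequentially. h n \<le> T * e n"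
      proof (intro always_eventually allI)
        fix n
        have "real n + 1 \<le> real (Np n)"
          using Np[of n] by linarith
        then show "h n \<le> T * e n"
          using T_pos by (simp add: h_def e_def frac_le)
      qed
      show "(\<lambda>n. T * e n) \<longlonglongrightarrow> 0"
        by (rule tendsto_mult_right_zero[OF e(2)])
      show "\<forall>\<^sub>F n in sequentially. 0 \<le> h n"
        using hp(1) by (simp add: less_imp_le)
    qed simp
    define X where "X n k = p n (nat (k mod int (Np n)))" for n k
    define Y where "Y n k = q n (nat (k mod int (Np n)))" for n k
    have idx: "nat (k mod int (Np n)) < Np n" for n k
      using Np0[of n] by (simp add: nat_less_iff)
    have Xper: "X n (k + int (Np n)) = X n k" and Yper: "Y n (k + int (Np n)) = Y n k" for n k
      by (auto simp: X_def Y_def)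
    have Xbox: "0 \<le> X n k \<and> X n k \<le> C" and Ybox: "0 \<le> Y n k \<and> Y n k \<le> C" for n k
      using pq(1,2)[of n] idx by (auto simp: X_def Y_def)
    have Xeq: "\<bar>(1 + c * h n) * (X n (k + 1) - X n k) - (X n k - X n (k - 1)) + h n * lam * cell (h n) k * g (X n k)\<bar>
        \<le> e n * (h n)\<^sup>2" for n k
      by (rule resid_periodic_extension[where x = "p n" and X = "X n", OF Np0 h_def _ X_def]) (use pq(3)[of n] in \<open>simp add: h_def\<close>)
    have Yeq: "\<bar>(1 + c * h n) * (Y n (k + 1) - Y n k) - (Y n k - Y n (k - 1)) + h n * lam * cell (h n) k * g (Y n k)\<bar>
        \<le> e n * (h n)\<^sup>2" for n k
      by (rule resid_periodic_extension[where x = "q n" and X = "Y n", OF Np0 h_def _ Y_def]) (use pq(4)[of n] in \<open>simp add: h_def\<close>)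
    obtain \<sigma> u v M where \<sigma>: "strict_mono \<sigma>" and Xlim: "\<forall>t. (\<lambda>n. X (\<sigma> n) \<lfloor>t / h (\<sigma> n)\<rfloor>) \<longlonglongrightarrow> u t" and M: "M > 0"
      and Xlip: "\<forall>n k l. \<bar>X n k - X n l\<bar> \<le> M * h n * \<bar>of_int (k - l)\<bar>"
      and u: "\<forall>t. (u has_real_derivative v t) (at t)" "\<forall>t. u t \<ge> 0" "periodic_with T u"
        "\<forall>s t. s \<le> t \<longrightarrow> (\<lambda>r. a r * g (u r)) integrable_on {s..t}"
        "\<forall>s t. s \<le> t \<longrightarrow> v t - v s = - c * (u t - u s) - lam * integral {s..t} (\<lambda>r. a r * g (u r))"
      by (rule discrete_limit[OF lp Np0 h_def h0 Xper Xbox Xeq e], rule that, assumption+)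
    have h0\<sigma>: "(\<lambda>n. h (\<sigma> n)) \<longlonglongrightarrow> 0" and e\<sigma>: "(\<lambda>n. e (\<sigma> n)) \<longlonglongrightarrow> 0"
      using LIMSEQ_subseq_LIMSEQ[OF h0 \<sigma>] LIMSEQ_subseq_LIMSEQ[OF e(2) \<sigma>] by (auto simp: comp_def)
    \<comment> \<open>The second extraction is made inside the first: comparing the two limits
      requires convergence along one common subsequence.\<close>
    obtain \<tau> w z M' where \<tau>: "strict_mono \<tau>" and Ylim: "\<forall>t. (\<lambda>n. Y (\<sigma> (\<tau> n)) \<lfloor>t / h (\<sigma> (\<tau> n))\<rfloor>) \<longlonglongrightarrow> w t" and M': "M' > 0"
      and Ylip: "\<forall>n k l. \<bar>Y (\<sigma> n) k - Y (\<sigma> n) l\<bar> \<le> M' * h (\<sigma> n) * \<bar>of_int (k - l)\<bar>"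
      and w: "\<forall>t. (w has_real_derivative z t) (at t)" "\<forall>t. w t \<ge> 0" "periodic_with T w"
        "\<forall>s t. s \<le> t \<longrightarrow> (\<lambda>r. a r * g (w r)) integrable_on {s..t}"
        "\<forall>s t. s \<le> t \<longrightarrow> z t - z s = - c * (w t - w s) - lam * integral {s..t} (\<lambda>r. a r * g (w r))"
      by (rule discrete_limit[where X = "\<lambda>n. Y (\<sigma> n)" and Np = "\<lambda>n. Np (\<sigma> n)" and h = "\<lambda>n. h (\<sigma> n)"
            and e = "\<lambda>n. e (\<sigma> n)", OF lp Np0 h_def h0\<sigma> Yper Ybox Yeq e(1) e\<sigma>], rule that, assumption+)
    define \<kappa> where "\<kappa> n = \<sigma> (\<tau> n)" for n
    have h\<kappa>: "(\<lambda>n. h (\<kappa> n)) \<longlonglongrightarrow> 0"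
      using LIMSEQ_subseq_LIMSEQ[OF h0\<sigma> \<tau>] by (simp add: comp_def \<kappa>_def)
    have X\<kappa>: "\<forall>t. (\<lambda>n. X (\<kappa> n) \<lfloor>t / h (\<kappa> n)\<rfloor>) \<longlonglongrightarrow> u t"
      using LIMSEQ_subseq_LIMSEQ[OF Xlim[rule_format] \<tau>] by (simp add: comp_def \<kappa>_def)
    have Y\<kappa>: "\<forall>t. (\<lambda>n. Y (\<kappa> n) \<lfloor>t / h (\<kappa> n)\<rfloor>) \<longlonglongrightarrow> w t"
      using Ylim by (simp add: \<kappa>_def)
    have Xl: "\<forall>n k l. \<bar>X (\<kappa> n) k - X (\<kappa> n) l\<bar> \<le> M * h (\<kappa> n) * \<bar>of_int (k - l)\<bar>"
      and Yl: "\<forall>n k l. \<bar>Y (\<kappa> n) k - Y (\<kappa> n) l\<bar> \<le> M' * h (\<kappa> n) * \<bar>of_int (k - l)\<bar>"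
      using Xlip Ylip by (auto simp: \<kappa>_def)
    have touch: "\<exists>t. \<gamma> \<le> \<alpha> * u t + \<beta> * w t"
      if "\<And>n. \<exists>i<Np n. \<gamma> \<le> \<alpha> * p n i + \<beta> * q n i" for \<alpha> \<beta> \<gamma>
    proof -
      have "\<forall>n. \<exists>i<Np (\<kappa> n). \<gamma> \<le> \<alpha> * p (\<kappa> n) i + \<beta> * q (\<kappa> n) i"
        using that by blast
      from choice[OF this] obtain i where i: "\<And>n. i n < Np (\<kappa> n)"
        "\<And>n. \<gamma> \<le> \<alpha> * p (\<kappa> n) (i n) + \<beta> * q (\<kappa> n) (i n)"
        by blast
      have range: "of_int (int (i n)) * h (\<kappa> n) \<in> {0..T}" for n
      proof -
        have "real (i n) * h (\<kappa> n) \<le> real (Np (\<kappa> n)) * h (\<kappa> n)"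
          using i(1)[of n] hp(1)[of "\<kappa> n"] by (intro mult_right_mono) auto
        then show ?thesis
          using hp(1)[of "\<kappa> n"] hp(2)[of "\<kappa> n"] by simp
      qed
      have ineq: "\<gamma> \<le> \<alpha> * X (\<kappa> n) (int (i n)) + \<beta> * Y (\<kappa> n) (int (i n))" for n
        using i(1)[of n] i(2)[of n] by (simp add: X_def Y_def)
      show ?thesis
        by (rule touching_point[OF hp(1) h\<kappa> X\<kappa> Xl M Y\<kappa> Yl M' range ineq]) blast
    qed
    obtain t1 where t1: "r \<le> u t1"
      using touch[of r 1 0] pq(5) by auto
    obtain t2 where t2: "r \<le> w t2"
      using touch[of r 0 1] pq(6) by auto
    obtain t3 where t3: "2 * w t3 \<le> u t3"
      using touch[of 0 1 "-2"] pq(7) by auto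
    have "positive_periodic_solution T c lam a g u"
      by (rule limit_is_solution[where v = v and \<tau> = t1]) (use u lp t1 r in auto)
    moreover have w_sol: "positive_periodic_solution T c lam a g w"
      by (rule limit_is_solution[where v = z and \<tau> = t2]) (use w lp t2 r in auto)
    moreover have "u \<noteq> w"
    proof
      assume "u = w"
      moreover have "w t3 > 0"
        using w_sol by (simp add: positive_periodic_solution_def)
      ultimately show False
        using t3 by simp
    qed
    ultimately show ?thesis
      by blast
  qed
  then show ?thesis
    by (intro that[OF lam1] allI impI)
qed

end

theorem theorem1p2:
  fixes T c :: real and g g' a :: "real \<Rightarrow> real" and I :: "real set"
  assumes T_pos: "T > 0"
    and g_maps: "g \<in> {0..} \<rightarrow> {0..}"
    and g_deriv: "\<And>s. s \<ge> 0 \<Longrightarrow> (g has_real_derivative g' s) (at s within {0..})"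
    and g'_cont: "continuous_on {0..} g'"
    and g_zero: "g 0 = 0"
    and g_pos: "\<And>s. s > 0 \<Longrightarrow> g s > 0"
    and g'_zero: "g' 0 = 0"
    and g'_inf: "(g' \<longlongrightarrow> 0) at_top"
    and a_loc: "locally_integrable a"
    and a_per: "periodic_with T a"
    and I_interval: "is_interval I" "I \<subseteq> {0..T}"
    and a_nonneg: "AE t in lebesgue. t \<in> I \<longrightarrow> a t \<ge> 0"
    and a_int_pos: "(LINT t:I|lebesgue. a t) > 0"
  shows "((LINT t:{0..T}|lebesgue. a t) < 0 \<longrightarrow>
           (\<exists>lam\<^sub>0>0. \<forall>lam. 0 < lam \<and> lam < lam\<^sub>0 \<longrightarrow>
              \<not> (\<exists>u. positive_periodic_solution T c lam a g u)) \<and>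
           (\<exists>lam\<^sub>1>0. \<forall>lam>lam\<^sub>1.
              \<exists>u\<^sub>1 u\<^sub>2. u\<^sub>1 \<noteq> u\<^sub>2 \<and>
                positive_periodic_solution T c lam a g u\<^sub>1 \<and>
                positive_periodic_solution T c lam a g u\<^sub>2))
       \<and> ((\<forall>s>0. g' s > 0) \<longrightarrow>
           (\<forall>lam>0. (\<exists>u. positive_periodic_solution T c lam a g u) \<longrightarrow>
              (LINT t:{0..T}|lebesgue. a t) < 0))"
proof -
  interpret indefinite_equation T c g g' a
    by unfold_locales (use assms in auto)
  have mean_eq: "(LINT t:{0..T}|lebesgue. a t) = integral {0..T} a"
    by (rule set_lebesgue_integral_eq_integral(2)[OF a_abs_int])
  obtain x y where xy: "0 \<le> x" "x \<le> y" "y \<le> T" "{x<..<y} \<subseteq> I" and pos: "integral {x..y} a > 0"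
    by (rule interval_endpoints[OF I_interval a_abs_int a_int_pos])
  obtain N where N: "negligible N" "\<And>t. t \<notin> N \<Longrightarrow> t \<in> I \<longrightarrow> a t \<ge> 0"
    by (rule AE_lebesgue_negligible[OF a_nonneg], erule that, blast)
  have nn: "integral {s..t} a \<ge> 0" if st: "x \<le> s" "s \<le> t" "t \<le> y" for s t
  proof -
    \<comment> \<open>Nonnegativity is known only off the null set N and, of [x, y], only the open
      interval is known to lie in I; f is a modification by a null set that is nonnegative
      everywhere on [s, t].\<close>
    define f where "f r = (if r \<in> N \<union> {x, y} then 0 else a r)" for r
    have neg: "negligible (N \<union> {x, y})"
      by (rule negligible_Un[OF N(1) negligible_finite]) simp
    have "f integrable_on {s..t}"
      by (rule integrable_spike[OF a_int(1) neg]) (simp add: f_def)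
    moreover have "f r \<ge> 0" if "r \<in> {s..t}" for r
    proof (cases "r \<in> N \<union> {x, y}")
      case False
      then have "r \<in> {x<..<y}"
        using that st by auto
      then show ?thesis
        using N(2)[of r] xy(4) False by (auto simp: f_def)
    qed (simp add: f_def)
    ultimately have "integral {s..t} f \<ge> 0"
      by (rule integral_nonneg)
    moreover have "integral {s..t} f = integral {s..t} a"
      by (rule integral_spike[OF neg]) (simp add: f_def)
    ultimately show ?thesis
      by simp
  qed
  show ?thesis
  proof (intro conjI impI allI)
    assume "(LINT t:{0..T}|lebesgue. a t) < 0"
    then have mean: "integral {0..T} a < 0"
      by (simp add: mean_eq)
    obtain lam0 where "lam0 > 0" "\<And>lam u. 0 < lam \<Longrightarrow> lam < lam0 \<Longrightarrow> \<not> positive_periodic_solution T c lam a g u"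
      using no_solution_small_parameter[OF mean] by metis
    then show "\<exists>lam\<^sub>0>0. \<forall>lam. 0 < lam \<and> lam < lam\<^sub>0 \<longrightarrow> \<not> (\<exists>u. positive_periodic_solution T c lam a g u)"
      by blast
    obtain lam1 where "lam1 > 0" "\<forall>lam>lam1. \<exists>u1 u2. u1 \<noteq> u2 \<and>
        positive_periodic_solution T c lam a g u1 \<and> positive_periodic_solution T c lam a g u2"
    proof (rule two_solutions_large_parameter[OF mean xy(1-3) _ pos])
      show "0 \<le> integral {s..t} a" if "x \<le> s" "s \<le> t" "t \<le> y" for s t
        by (rule nn[OF that])
    qed (rule that)
    then show "\<exists>lam\<^sub>1>0. \<forall>lam>lam\<^sub>1. \<exists>u\<^sub>1 u\<^sub>2. u\<^sub>1 \<noteq> u\<^sub>2 \<and>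
        positive_periodic_solution T c lam a g u\<^sub>1 \<and> positive_periodic_solution T c lam a g u\<^sub>2"
      by blast
  next
    fix lam :: real
    assume mono: "\<forall>s>0. g' s > 0" and lam: "lam > 0" and "\<exists>u. positive_periodic_solution T c lam a g u"
    then obtain u where "positive_periodic_solution T c lam a g u"
      by blast
    then show "(LINT t:{0..T}|lebesgue. a t) < 0"
      unfolding mean_eq using pos xy mono by (intro mean_negative_of_solution[OF _ lam, of u x y]) auto
  qed
qed

end
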